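(* Let $\xi$ be a centered sub-Gaussian real random variable with unit variance. For each $n\ge 1$ let $W_n=(w_{ij})_{1\le i,j\le n}$ be an $n\times n$ real symmetric random matrix whose entries on and above the main diagonal, $(w_{ij})_{1\le i\le j\le n}$, are iid copies of $\xi$ (all $W_n$ being defined on a common probability space). For each $n$ let $\Sigma_n=(\sigma_{ij})_{1\le i,j\le n}$ be a (deterministic) symmetric matrix with non-negative entries such that $\sum_{j=1}^n\sigma_{ij}^2=1$ for every $i\in[n]$ (i.e. $(\sigma_{ij}^2)$ is doubly stochastic), and let $\sigma_n^*=\max_{1\le i,j\le n}\sigma_{ij}$. If $\sigma_n^*\sqrt{\log n}\to 0$ as $n\to\infty$, then $\|\Sigma_n\circ W_n\|\to 2$ almost surely, where $\circ$ denotes the entrywise (Hadamard) product and $\|\cdot\|$ the spectral norm.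
   Context: A random variable $\xi$ is sub-Gaussian if there is a constant $C$ with $\mathbb{E}e^{\lambda(\xi-\mathbb{E}\xi)}\le e^{C\lambda^2}$ for all $\lambda\in\mathbb{R}$. In particular the conclusion means that $\Sigma_n\circ W_n$ has no spectral outliers, i.e. no eigenvalues at non-vanishing distance outside $[-2,2]$. *)

theory Defs
  imports "HOL-Probability.Probability"
begin

definition subgaussian :: "'a measure \<Rightarrow> ('a \<Rightarrow> real) \<Rightarrow> bool" where
  "subgaussian M X \<longleftrightarrow>
     (\<exists>C::real. \<forall>l::real.
        integrable M (\<lambda>x. exp (l * (X x - (\<integral>y. X y \<partial>M)))) \<and>
        (\<integral>x. exp (l * (X x - (\<integral>y. X y \<partial>M))) \<partial>M) \<le> exp (C * l\<^sup>2))"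

definition spec_norm :: "nat \<Rightarrow> (nat \<Rightarrow> nat \<Rightarrow> real) \<Rightarrow> real" where
  "spec_norm n A =
     (SUP x\<in>{x::nat \<Rightarrow> real. (\<Sum>j<n. (x j)\<^sup>2) = 1}.
        sqrt (\<Sum>i<n. (\<Sum>j<n. A i j * x j)\<^sup>2))"

end

theory Submission
  imports Defs "HOL-Real_Asymp.Real_Asymp"
begin

text \<open>Write \<open>X\<close> for the \<open>n \<times> n\<close> matrix, \<open>s\<close> for its largest coefficient \<open>\<sigma>\<^sup>*\<close>.

  Upper bound: expand \<open>E tr X\<^sup>2\<^sup>p\<close>, with \<open>p\<close> of order \<open>log n\<close>, into closed walks and group the walks by the
  pattern in which they revisit vertices.  The steps that discover a new vertex form a tree, whose edges
  carry \<open>\<sigma>\<^sup>2\<close> and sum to one; every other step costs at most \<open>s\<close>.  Since \<open>s\<^sup>2 p\<close> tends to zero, this is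
  dominated by the corresponding sum for an \<open>r \<times> r\<close> Wigner matrix \<open>Y\<close> with \<open>r = D p\<close>, whose entries
  are normalised sums of signs, nearly Gaussian, plus a small skewed part that dominates odd moments.
  For sign sums, Wick's formula is an inequality between non-negative quantities; it yields a recursion for
  expected products of traces of powers.  The terms which merge two traces are split again pointwise by
  \<open>tr A\<^sup>k\<^sup>+\<^sup>l \<le> tr A\<^sup>k tr A\<^sup>l\<close> for even exponents, so the recursion is the one of the Catalan numbers up to a relative
  error of order \<open>p / r = 1 / D\<close>.

  Lower bound: for fixed \<open>k\<close> the walks that traverse a tree depth first give \<open>E tr X\<^sup>2\<^sup>k \<ge> (2 - \<epsilon>)\<^sup>2\<^sup>k n\<close>, so by
  Paley and Zygmund \<open>tr X\<^sup>2\<^sup>k\<close> is large with probability bounded below.  By duality the norm of \<open>X\<close> is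
  then attained up to \<open>\<epsilon>\<close> on a matrix with entries of order \<open>1 / n\<close>, namely a multiple of \<open>X\<^sup>2\<^sup>k\<^sup>-\<^sup>1\<close>.  The
  supremum over such matrices has bounded differences once the entries of \<open>W\<close> are clipped at order \<open>log n\<close>,
  and hence concentrates so well that the Borel-Cantelli lemma applies.\<close>

text \<open>Three obstacles shape the argument. (1) \<open>s^2\<close> may be only slightly smaller
  than \<open>1 / log n\<close>, so at order \<open>log n\<close> there may be no loss on walks that
  cross every edge exactly twice, and at most a constant factor per further pair of steps. Comparing
  with a small dense matrix achieves this for every profile at once, because only the pattern of a
  walk matters. (2) \<open>\<xi>\<close> may be skewed while a symmetric sum of signs has vanishing
  odd moments. The added skewed part violates the Wick inequality but is itself a sum of three
  symmetric signs, so the triangle inequality reduces it to matrices that satisfy it. (3) Nothing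
  relates different \<open>n\<close>, so almost sure convergence needs summable failure
  probabilities, whereas Paley-Zygmund yields a positive constant. Bounded differences for the norm
  itself are too weak: the increments in single entries are of order
  \<open>\<sigma> i j * T\<close>, and their squares may sum to order \<open>n * T^2\<close>.
  Pairing with matrices whose entries are of order \<open>1 / n\<close> reduces this sum to order
  \<open>T^2 / n\<close>, which gives a failure probability
  \<open>exp (- c * n / (log n)^2)\<close>.\<close>

fun mat_pow :: "nat \<Rightarrow> (nat \<Rightarrow> nat \<Rightarrow> real) \<Rightarrow> nat \<Rightarrow> nat \<Rightarrow> nat \<Rightarrow> real" where
  "mat_pow n A 0 = (\<lambda>i j. if i = j then 1 else 0)"
| "mat_pow n A (Suc k) = (\<lambda>i j. \<Sum>l<n. A i l * mat_pow n A k l j)"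

definition sym_mat :: "nat \<Rightarrow> (nat \<Rightarrow> nat \<Rightarrow> real) \<Rightarrow> bool" where
  "sym_mat n A \<longleftrightarrow> (\<forall>i<n. \<forall>j<n. A i j = A j i)"

definition trace_pow :: "nat \<Rightarrow> (nat \<Rightarrow> nat \<Rightarrow> real) \<Rightarrow> nat \<Rightarrow> real" where
  "trace_pow n A k = (\<Sum>i<n. mat_pow n A k i i)"

section \<open>Traces of powers as Frobenius inner products\<close>

lemma mat_pow_add:
  assumes "i < n"
  shows "mat_pow n A (a + b) i j = (\<Sum>k<n. mat_pow n A a i k * mat_pow n A b k j)"
  using assms
proof (induction a arbitrary: i)
  case 0
  have "(\<Sum>k<n. (if i = k then 1 else 0) * mat_pow n A b k j) = (\<Sum>k<n. if i = k then mat_pow n A b k j else 0)"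
    by (intro sum.cong) auto
  then show ?case using 0 by simp
next
  case (Suc a)
  have "mat_pow n A (Suc a + b) i j = (\<Sum>l<n. A i l * (\<Sum>k<n. mat_pow n A a l k * mat_pow n A b k j))"
    using Suc.IH by simp
  also have "\<dots> = (\<Sum>l<n. \<Sum>k<n. A i l * mat_pow n A a l k * mat_pow n A b k j)"
    by (simp add: sum_distrib_left mult.assoc)
  also have "\<dots> = (\<Sum>k<n. \<Sum>l<n. A i l * mat_pow n A a l k * mat_pow n A b k j)"
    by (rule sum.swap)
  finally show ?case by (simp add: sum_distrib_right)
qed

lemma mat_pow_1: "j < n \<Longrightarrow> mat_pow n A (Suc 0) i j = A i j"
proof -
  assume "j < n"
  have "(\<Sum>l<n. A i l * (if l = j then 1 else 0)) = (\<Sum>l<n. if l = j then A i l else 0)"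
    by (intro sum.cong) auto
  with \<open>j < n\<close> show ?thesis by simp
qed

lemma mat_pow_sym:
  assumes "sym_mat n A" "i < n" "j < n"
  shows "mat_pow n A k i j = mat_pow n A k j i"
  using assms(2,3)
proof (induction k arbitrary: i j)
  case (Suc k)
  have "mat_pow n A (Suc k) i j = (\<Sum>l<n. A i l * mat_pow n A k l j)" by simp
  also have "\<dots> = (\<Sum>l<n. mat_pow n A k j l * mat_pow n A (Suc 0) l i)"
    using assms(1) Suc by (intro sum.cong) (auto simp: sym_mat_def mat_pow_1 simp del: mat_pow.simps)
  also have "\<dots> = mat_pow n A (k + Suc 0) j i" using mat_pow_add Suc.prems by metis
  finally show ?case by simp
qed simp

lemma trace_pow_0 [simp]: "trace_pow n A 0 = real n"
  by (simp add: trace_pow_def)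

lemma trace_pow_add:
  assumes "sym_mat n A"
  shows "trace_pow n A (a + b) = (\<Sum>i<n. \<Sum>j<n. mat_pow n A a i j * mat_pow n A b i j)"
  unfolding trace_pow_def using mat_pow_sym[OF assms] by (intro sum.cong refl) (simp add: mat_pow_add)

lemma trace_pow_double: "sym_mat n A \<Longrightarrow> trace_pow n A (2 * a) = (\<Sum>i<n. \<Sum>j<n. (mat_pow n A a i j)\<^sup>2)"
  using trace_pow_add[of n A a a] by (simp add: mult_2 power2_eq_square)

lemma trace_pow_even_nonneg: "sym_mat n A \<Longrightarrow> even k \<Longrightarrow> 0 \<le> trace_pow n A k"
  using trace_pow_double[of n A "k div 2"] by (simp add: sum_nonneg)

lemma trace_pow_add_cs:
  assumes "sym_mat n A"
  shows "(trace_pow n A (a + b))\<^sup>2 \<le> trace_pow n A (2 * a) * trace_pow n A (2 * b)"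
proof -
  have "(\<Sum>p\<in>{..<n}\<times>{..<n}. mat_pow n A a (fst p) (snd p) * mat_pow n A b (fst p) (snd p))\<^sup>2
    \<le> (\<Sum>p\<in>{..<n}\<times>{..<n}. (mat_pow n A a (fst p) (snd p))\<^sup>2) * (\<Sum>p\<in>{..<n}\<times>{..<n}. (mat_pow n A b (fst p) (snd p))\<^sup>2)"
    by (rule Cauchy_Schwarz_ineq_sum)
  then show ?thesis
    by (simp add: trace_pow_add[OF assms] trace_pow_double[OF assms] sum.cartesian_product case_prod_beta)
qed

text \<open>The Frobenius norm is submultiplicative, and an even trace is a squared Frobenius
  norm.\<close>

lemma trace_pow_even_mult:
  assumes "sym_mat n A"
  shows "trace_pow n A (2 * a + 2 * b) \<le> trace_pow n A (2 * a) * trace_pow n A (2 * b)"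
proof -
  have "trace_pow n A (2 * a + 2 * b) = (\<Sum>i<n. \<Sum>j<n. (mat_pow n A (a + b) i j)\<^sup>2)"
    using trace_pow_double[OF assms, of "a + b"] by (simp add: algebra_simps)
  also have "\<dots> \<le> (\<Sum>i<n. \<Sum>j<n. (\<Sum>k<n. (mat_pow n A a i k)\<^sup>2) * (\<Sum>k<n. (mat_pow n A b k j)\<^sup>2))"
    by (intro sum_mono) (simp add: mat_pow_add Cauchy_Schwarz_ineq_sum)
  also have "\<dots> = (\<Sum>i<n. \<Sum>k<n. (mat_pow n A a i k)\<^sup>2) * (\<Sum>j<n. \<Sum>k<n. (mat_pow n A b k j)\<^sup>2)"
    by (simp add: sum_product)
  also have "(\<Sum>j<n. \<Sum>k<n. (mat_pow n A b k j)\<^sup>2) = trace_pow n A (2 * b)"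
    unfolding trace_pow_double[OF assms] by (rule sum.swap)
  finally show ?thesis by (simp add: trace_pow_double[OF assms])
qed

text \<open>An odd trace has no sign. Cauchy-Schwarz bounds it by the geometric mean of its two even
  neighbours, and the arithmetic-geometric mean inequality recombines the four factors so that each
  product keeps the total exponent \<open>2*i + 2*j + 2\<close>.\<close>

lemma trace_pow_odd_pair:
  assumes "sym_mat n A"
  shows "\<bar>trace_pow n A (2*i+1) * trace_pow n A (2*j+1)\<bar>
    \<le> (trace_pow n A (2*i) * trace_pow n A (2*j+2) + trace_pow n A (2*i+2) * trace_pow n A (2*j)) / 2"
proof -
  define a b c d where "a = trace_pow n A (2*i)" and "b = trace_pow n A (2*i+2)" and "c = trace_pow n A (2*j)" and "d = trace_pow n A (2*j+2)"
  have nn: "0 \<le> a" "0 \<le> b" "0 \<le> c" "0 \<le> d"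
    unfolding a_def b_def c_def d_def by (auto intro!: trace_pow_even_nonneg assms)
  have 1: "(trace_pow n A (2*i+1))\<^sup>2 \<le> a * b" using trace_pow_add_cs[OF assms, of i "i+1"]
    by (simp add: a_def b_def mult_2 mult_2_right)
  have 2: "(trace_pow n A (2*j+1))\<^sup>2 \<le> c * d" using trace_pow_add_cs[OF assms, of j "j+1"]
    by (simp add: c_def d_def mult_2 mult_2_right)
  have "(trace_pow n A (2*i+1) * trace_pow n A (2*j+1))\<^sup>2 \<le> (a * b) * (c * d)"
    unfolding power_mult_distrib using 1 2 nn by (intro mult_mono) auto
  also have "\<dots> \<le> ((a * d + b * c) / 2)\<^sup>2"
    using zero_le_power2[of "a * d - b * c"] by (simp add: power2_eq_square field_simps)
  finally have "(trace_pow n A (2*i+1) * trace_pow n A (2*j+1))\<^sup>2 \<le> ((a * d + b * c) / 2)\<^sup>2" .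
  then have "\<bar>trace_pow n A (2*i+1) * trace_pow n A (2*j+1)\<bar> \<le> \<bar>(a * d + b * c) / 2\<bar>"
    by (simp only: abs_le_square_iff)
  also have "\<dots> = (a * d + b * c) / 2" using nn by simp
  finally show ?thesis by (simp add: a_def b_def c_def d_def)
qed

lemma trace_pow_ratio_mono:
  assumes "sym_mat n A"
  shows "(trace_pow n A (2*k+2))\<^sup>2 \<le> trace_pow n A (2*k) * trace_pow n A (2*k+4)"
  using trace_pow_add_cs[OF assms, of k "k+2"] by (simp add: mult_2 numeral_eq_Suc)

subsection \<open>The spectral norm\<close>

lemma spec_norm_alt:
  "spec_norm n A = (SUP x\<in>{x. L2_set x {..<n} = 1}. L2_set (\<lambda>i. \<Sum>j<n. A i j * x j) {..<n})"
  unfolding spec_norm_def L2_set_def by simp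

text \<open>A crude bound, whose purpose is to make the set in the supremum bounded above; for reals
  \<open>SUP\<close> carries information only then.\<close>

lemma matvec_bound:
  fixes n :: nat
  shows "L2_set (\<lambda>i. \<Sum>j<n. A i j * x j) {..<n} \<le> (\<Sum>i<n. L2_set (A i) {..<n}) * L2_set x {..<n}"
proof -
  have "L2_set (\<lambda>i. \<Sum>j<n. A i j * x j) {..<n} \<le> (\<Sum>i<n. \<bar>\<Sum>j<n. A i j * x j\<bar>)"
    by (rule L2_set_le_sum_abs)
  also have "\<dots> \<le> (\<Sum>i<n. L2_set (A i) {..<n} * L2_set x {..<n})"
  proof (intro sum_mono)
    fix i
    have "\<bar>\<Sum>j<n. A i j * x j\<bar> \<le> (\<Sum>j<n. \<bar>A i j\<bar> * \<bar>x j\<bar>)"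
      by (rule order_trans[OF sum_abs]) (simp add: abs_mult)
    also have "\<dots> \<le> L2_set (A i) {..<n} * L2_set x {..<n}" by (rule L2_set_mult_ineq)
    finally show "\<bar>\<Sum>j<n. A i j * x j\<bar> \<le> L2_set (A i) {..<n} * L2_set x {..<n}" .
  qed
  finally show ?thesis by (simp add: sum_distrib_right)
qed

lemma spec_norm_bdd:
  fixes n :: nat
  shows "bdd_above ((\<lambda>x. L2_set (\<lambda>i. \<Sum>j<n. A i j * x j) {..<n}) ` {x. L2_set x {..<n} = 1})"
proof (rule bdd_aboveI, clarify)
  fix x :: "nat \<Rightarrow> real" assume "L2_set x {..<n} = 1"
  then show "L2_set (\<lambda>i. \<Sum>j<n. A i j * x j) {..<n} \<le> (\<Sum>i<n. L2_set (A i) {..<n})"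
    using matvec_bound[of A x n] by simp
qed

lemma spec_norm_apply: "L2_set (\<lambda>i. \<Sum>j<n. A i j * x j) {..<n} \<le> spec_norm n A * L2_set x {..<n}"
proof (cases "L2_set x {..<n} = 0")
  case True
  then show ?thesis using matvec_bound[of A x n] by simp
next
  case False
  define c where "c = L2_set x {..<n}"
  have c: "c > 0" using False L2_set_nonneg[of x "{..<n}"] by (simp add: c_def less_le)
  have "L2_set (\<lambda>j. inverse c * x j) {..<n} = 1"
    using L2_set_right_distrib[of "inverse c" x "{..<n}"] c by (simp add: c_def)
  then have "L2_set (\<lambda>i. \<Sum>j<n. A i j * (inverse c * x j)) {..<n} \<le> spec_norm n A"
    unfolding spec_norm_alt by (intro cSUP_upper[OF _ spec_norm_bdd]) simp
  moreover have "L2_set (\<lambda>i. \<Sum>j<n. A i j * (inverse c * x j)) {..<n}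
      = inverse c * L2_set (\<lambda>i. \<Sum>j<n. A i j * x j) {..<n}"
    using c by (subst L2_set_right_distrib) (simp_all add: sum_distrib_left mult_ac)
  ultimately have "inverse c * L2_set (\<lambda>i. \<Sum>j<n. A i j * x j) {..<n} \<le> spec_norm n A" by simp
  from mult_left_mono[OF this, of c] c show ?thesis
    unfolding c_def[symmetric] mult.assoc[symmetric] by (simp add: mult.commute[of c "spec_norm n A"])
qed

lemma unit_vector: "(i::nat) < n \<Longrightarrow> L2_set (\<lambda>j. if j = i then 1 else 0) {..<n} = 1"
proof -
  assume "i < n"
  have "(\<Sum>j<n. (if j = i then 1 else 0 :: real)\<^sup>2) = (\<Sum>j<n. if j = i then 1 else 0)"
    by (intro sum.cong) auto
  with \<open>i < n\<close> show ?thesis by (simp add: L2_set_def)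
qed

text \<open>\<open>0 < n\<close> provides a unit vector; for \<open>n = 0\<close> the supremum
  ranges over the empty set.\<close>

lemma spec_norm_least:
  assumes "0 < n" "\<And>x. L2_set x {..<n} = 1 \<Longrightarrow> L2_set (\<lambda>i. \<Sum>j<n. A i j * x j) {..<n} \<le> c"
  shows "spec_norm n A \<le> c"
  unfolding spec_norm_alt using assms unit_vector by (intro cSUP_least) auto

lemma spec_norm_nonneg:
  assumes "0 < n" shows "0 \<le> spec_norm n A"
  using spec_norm_apply[of A "\<lambda>j. if j = 0 then 1 else 0" n] unit_vector[OF assms] L2_set_nonneg
  by (metis (no_types, lifting) mult.right_neutral order_trans)

lemma spec_norm_triangle:
  assumes "0 < n"
  shows "spec_norm n (\<lambda>i j. A i j + B i j) \<le> spec_norm n A + spec_norm n B"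
proof (rule spec_norm_least[OF assms])
  fix x assume x: "L2_set x {..<n} = 1"
  have "L2_set (\<lambda>i. \<Sum>j<n. (A i j + B i j) * x j) {..<n}
    = L2_set (\<lambda>i. (\<Sum>j<n. A i j * x j) + (\<Sum>j<n. B i j * x j)) {..<n}"
    by (simp add: algebra_simps sum.distrib)
  also have "\<dots> \<le> L2_set (\<lambda>i. \<Sum>j<n. A i j * x j) {..<n} + L2_set (\<lambda>i. \<Sum>j<n. B i j * x j) {..<n}"
    by (rule L2_set_triangle_ineq)
  also have "\<dots> \<le> spec_norm n A + spec_norm n B"
    using spec_norm_apply[of A x n] spec_norm_apply[of B x n] x by simp
  finally show "L2_set (\<lambda>i. \<Sum>j<n. (A i j + B i j) * x j) {..<n} \<le> spec_norm n A + spec_norm n B" .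
qed

lemma spec_norm_scale:
  assumes "0 < n" "0 \<le> c"
  shows "spec_norm n (\<lambda>i j. c * A i j) \<le> c * spec_norm n A"
proof (rule spec_norm_least[OF assms(1)])
  fix x assume x: "L2_set x {..<n} = 1"
  have "L2_set (\<lambda>i. \<Sum>j<n. c * A i j * x j) {..<n} = c * L2_set (\<lambda>i. \<Sum>j<n. A i j * x j) {..<n}"
    using assms(2) by (subst L2_set_right_distrib) (simp_all add: sum_distrib_left mult_ac)
  then show "L2_set (\<lambda>i. \<Sum>j<n. c * A i j * x j) {..<n} \<le> c * spec_norm n A"
    using spec_norm_apply[of A x n] x assms(2) by (simp add: mult_left_mono)
qed

lemma entry_le_spec_norm:
  assumes "i < n" "j < n"
  shows "\<bar>A i j\<bar> \<le> spec_norm n A"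
proof -
  have *: "(\<Sum>l<n. A k l * (if l = j then 1 else 0)) = A k j" for k
  proof -
    have "(\<Sum>l<n. A k l * (if l = j then 1 else 0)) = (\<Sum>l<n. if l = j then A k l else 0)"
      by (intro sum.cong) auto
    then show ?thesis using assms by simp
  qed
  have "\<bar>A i j\<bar> = L2_set (\<lambda>k. A k j) {i}" by simp
  also have "\<dots> \<le> L2_set (\<lambda>k. A k j) {..<n}"
    unfolding L2_set_def using assms by (intro real_sqrt_le_mono sum_mono2) auto
  also have "\<dots> \<le> spec_norm n A"
    using spec_norm_apply[of A "\<lambda>l. if l = j then 1 else 0" n] unit_vector[OF assms(2)] by (simp add: *)
  finally show ?thesis .
qed

lemma mat_pow_vec_le:
  assumes "0 < n"
  shows "L2_set (\<lambda>i. \<Sum>j<n. mat_pow n A k i j * x j) {..<n} \<le> spec_norm n A ^ k * L2_set x {..<n}"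
proof (induction k)
  case 0
  have "(\<Sum>j<n. (if i = j then 1 else 0) * x j) = x i" if "i < n" for i
  proof -
    have "(\<Sum>j<n. (if i = j then 1 else 0) * x j) = (\<Sum>j<n. if i = j then x j else 0)"
      by (intro sum.cong) auto
    then show ?thesis using that by simp
  qed
  then have "L2_set (\<lambda>i. \<Sum>j<n. (if i = j then 1 else 0) * x j) {..<n} = L2_set x {..<n}"
    by (intro L2_set_cong) auto
  then show ?case by simp
next
  case (Suc k)
  have "(\<Sum>j<n. mat_pow n A (Suc k) i j * x j) = (\<Sum>l<n. A i l * (\<Sum>j<n. mat_pow n A k l j * x j))" for i
    by (simp add: sum_distrib_left sum_distrib_right mult.assoc) (subst sum.swap, simp)
  then have "L2_set (\<lambda>i. \<Sum>j<n. mat_pow n A (Suc k) i j * x j) {..<n}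
    \<le> spec_norm n A * L2_set (\<lambda>i. \<Sum>j<n. mat_pow n A k i j * x j) {..<n}"
    by (simp only: spec_norm_apply)
  also have "\<dots> \<le> spec_norm n A * (spec_norm n A ^ k * L2_set x {..<n})"
    by (intro mult_left_mono Suc spec_norm_nonneg assms)
  finally show ?case by (simp add: mult.assoc)
qed

lemma mat_pow_col_le:
  assumes "0 < n" "j < n"
  shows "L2_set (\<lambda>i. mat_pow n A k i j) {..<n} \<le> spec_norm n A ^ k"
proof -
  have "(\<Sum>l<n. mat_pow n A k i l * (if l = j then 1 else 0)) = mat_pow n A k i j" for i
  proof -
    have "(\<Sum>l<n. mat_pow n A k i l * (if l = j then 1 else 0)) = (\<Sum>l<n. if l = j then mat_pow n A k i l else 0)"
      by (intro sum.cong) auto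
    then show ?thesis using assms by simp
  qed
  then show ?thesis
    using mat_pow_vec_le[OF assms(1), of A k "\<lambda>l. if l = j then 1 else 0"] unit_vector[OF assms(2)] by simp
qed

lemma mat_pow_entry_le:
  assumes "i < n" "j < n"
  shows "\<bar>mat_pow n A k i j\<bar> \<le> spec_norm n A ^ k"
proof -
  have "\<bar>mat_pow n A k i j\<bar> = L2_set (\<lambda>i. mat_pow n A k i j) {i}" by simp
  also have "\<dots> \<le> L2_set (\<lambda>i. mat_pow n A k i j) {..<n}"
    unfolding L2_set_def using assms by (intro real_sqrt_le_mono sum_mono2) auto
  finally show ?thesis using mat_pow_col_le[of n j A k] assms by simp
qed

lemma trace_pow_le_spec_norm:
  assumes "0 < n" "sym_mat n A"
  shows "trace_pow n A (2 * p) \<le> real n * spec_norm n A ^ (2 * p)"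
proof -
  have "trace_pow n A (2 * p) = (\<Sum>j<n. \<Sum>i<n. (mat_pow n A p i j)\<^sup>2)"
    unfolding trace_pow_double[OF assms(2)] by (rule sum.swap)
  also have "\<dots> = (\<Sum>j<n. (L2_set (\<lambda>i. mat_pow n A p i j) {..<n})\<^sup>2)"
    by (simp add: L2_set_def sum_nonneg)
  also have "\<dots> \<le> (\<Sum>j<n. (spec_norm n A ^ p)\<^sup>2)"
    using mat_pow_col_le[OF assms(1)] by (intro sum_mono power_mono) (auto simp: L2_set_nonneg)
  finally show ?thesis by (simp add: power_mult[symmetric] mult.commute)
qed

text \<open>The squared norms \<open>a k\<close> of the vectors \<open>A\<^sup>k x\<close> form a log-convex sequence, so their ratios increase.\<close>

lemma spec_norm_power_le_trace_pow:
  assumes "0 < n" "sym_mat n A"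
  shows "spec_norm n A ^ (2 * p) \<le> trace_pow n A (2 * p)"
proof (cases "p = 0")
  case True
  then show ?thesis using assms by simp
next
  case False
  have key: "(L2_set (\<lambda>i. \<Sum>j<n. A i j * x j) {..<n}) ^ (2 * p) \<le> trace_pow n A (2 * p)"
    if x: "L2_set x {..<n} = 1" for x
  proof -
    define v where "v k i = (\<Sum>j<n. mat_pow n A k i j * x j)" for k i
    define a where "a k = (\<Sum>i<n. (v k i)\<^sup>2)" for k
    have a_nn: "0 \<le> a k" for k by (simp add: a_def sum_nonneg)
    have v_Suc: "v (Suc k) i = (\<Sum>l<n. A i l * v k l)" for k i
      unfolding v_def by (simp add: sum_distrib_left sum_distrib_right mult.assoc) (subst sum.swap, simp)
    have v0: "v 0 i = x i" if "i < n" for i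
    proof -
      have "(\<Sum>j<n. (if i = j then 1 else 0) * x j) = (\<Sum>j<n. if i = j then x j else 0)"
        by (intro sum.cong) auto
      then show ?thesis using that by (simp add: v_def)
    qed
    have "(\<Sum>i<n. (x i)\<^sup>2) = 1" using x by (simp add: L2_set_def)
    then have a0: "a 0 = 1" using v0 by (simp add: a_def)
    \<comment> \<open>Symmetry moves one factor \<open>A\<close> across the inner product, so
      \<open>a (Suc k)\<close> is the inner product of \<open>v k\<close> and
      \<open>v (Suc (Suc k))\<close>. This replaces a diagonalisation of \<open>A\<close>.\<close>
    have lc: "(a (Suc k))\<^sup>2 \<le> a k * a (Suc (Suc k))" for k
    proof -
      have "a (Suc k) = (\<Sum>i<n. \<Sum>l<n. v (Suc k) i * (A i l * v k l))"
        unfolding a_def power2_eq_square by (simp add: v_Suc sum_distrib_left)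
      also have "\<dots> = (\<Sum>l<n. \<Sum>i<n. v (Suc k) i * (A i l * v k l))" by (rule sum.swap)
      also have "\<dots> = (\<Sum>l<n. \<Sum>i<n. v k l * (A l i * v (Suc k) i))"
        using assms(2) by (intro sum.cong refl) (auto simp: sym_mat_def)
      also have "\<dots> = (\<Sum>l<n. v k l * v (Suc (Suc k)) l)"
        by (simp only: v_Suc[of "Suc k"] sum_distrib_left)
      finally show ?thesis unfolding a_def using Cauchy_Schwarz_ineq_sum by metis
    qed
    \<comment> \<open>By log-convexity every ratio \<open>a (Suc k) / a k\<close> is at least the
      first one, which is \<open>a 1\<close> since \<open>a 0 = 1\<close>; the product form also
      covers \<open>a k = 0\<close>.\<close>
    have step: "a k * a 1 \<le> a (Suc k)" for k
    proof (induction k)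
      case 0
      then show ?case by (simp add: a0)
    next
      case (Suc k)
      show ?case
      proof (cases "a k = 0")
        case True
        then have "a (Suc k) = 0" using lc[of k] by simp
        then show ?thesis using a_nn by simp
      next
        case False
        then have pos: "a k > 0" using a_nn[of k] by simp
        have "a k * (a (Suc k) * a 1) \<le> a (Suc k) * a (Suc k)"
          using mult_right_mono[OF Suc a_nn[of "Suc k"]] by (simp add: mult_ac)
        also have "\<dots> \<le> a k * a (Suc (Suc k))" using lc[of k] by (simp add: power2_eq_square)
        finally show ?thesis using pos by simp
      qed
    qed
    have pw: "a 1 ^ k \<le> a k" for k
    proof (induction k)
      case (Suc k)
      then show ?case using step[of k] mult_right_mono[OF Suc a_nn[of 1]] by (simp add: mult.commute)
    qed (simp add: a0)
    have "v 1 i = (\<Sum>j<n. A i j * x j)" for i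
      unfolding v_def by (intro sum.cong refl) (simp add: mat_pow_1 del: mat_pow.simps)
    then have "L2_set (\<lambda>i. \<Sum>j<n. A i j * x j) {..<n} ^ (2 * p) = a 1 ^ p"
      by (simp add: L2_set_def a_def power_mult sum_nonneg)
    also have "\<dots> \<le> a p" by (rule pw)
    also have "a p \<le> (\<Sum>i<n. (\<Sum>j<n. (mat_pow n A p i j)\<^sup>2) * (\<Sum>j<n. (x j)\<^sup>2))"
      unfolding a_def v_def by (intro sum_mono Cauchy_Schwarz_ineq_sum)
    also have "\<dots> = trace_pow n A (2 * p)"
      using \<open>(\<Sum>i<n. (x i)\<^sup>2) = 1\<close> by (simp add: trace_pow_double[OF assms(2)])
    finally show ?thesis .
  qed
  have t: "0 \<le> trace_pow n A (2 * p)" by (simp add: trace_pow_even_nonneg assms)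
  have "spec_norm n A \<le> root (2 * p) (trace_pow n A (2 * p))"
  proof (rule spec_norm_least[OF assms(1)])
    fix x assume "L2_set x {..<n} = 1"
    from real_root_le_mono[OF _ key[OF this], of "2 * p"]
    show "L2_set (\<lambda>i. \<Sum>j<n. A i j * x j) {..<n} \<le> root (2 * p) (trace_pow n A (2 * p))"
      using False by (simp add: real_root_power_cancel L2_set_nonneg)
  qed
  then have "spec_norm n A ^ (2 * p) \<le> root (2 * p) (trace_pow n A (2 * p)) ^ (2 * p)"
    by (intro power_mono spec_norm_nonneg assms)
  then show ?thesis using t False by simp
qed

text \<open>In Frobenius inner products \<open><C, A^(2k+1)> = <A^(k+1), C A^k>\<close>; then
  Cauchy-Schwarz applies, and multiplication by \<open>C\<close> enlarges the Frobenius norm of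
  \<open>A^k\<close> at most by \<open>spec_norm n C\<close>. So \<open>A^(2k+1)\<close> divided by
  the square root lies in the dual unit ball of the spectral norm, which the lower bound
  exploits.\<close>

lemma ip_odd_power_le:
  assumes "0 < n" "sym_mat n A"
  shows "(\<Sum>i<n. \<Sum>j<n. C i j * mat_pow n A (2 * k + 1) i j)
    \<le> spec_norm n C * sqrt (trace_pow n A (2 * k + 2) * trace_pow n A (2 * k))"
proof -
  define D where "D i l = (\<Sum>j<n. C i j * mat_pow n A k j l)" for i l
  have "(\<Sum>i<n. \<Sum>j<n. C i j * mat_pow n A (2 * k + 1) i j)
      = (\<Sum>i<n. \<Sum>j<n. \<Sum>l<n. C i j * (mat_pow n A (k + 1) i l * mat_pow n A k l j))"
    using mat_pow_add[of _ n A "k + 1" k] by (intro sum.cong refl) (simp add: sum_distrib_left mult_2 del: mat_pow.simps)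
  also have "\<dots> = (\<Sum>i<n. \<Sum>l<n. \<Sum>j<n. C i j * (mat_pow n A (k + 1) i l * mat_pow n A k l j))"
    by (intro sum.cong refl sum.swap)
  also have "\<dots> = (\<Sum>i<n. \<Sum>l<n. mat_pow n A (k + 1) i l * D i l)"
    unfolding D_def sum_distrib_left using mat_pow_sym[OF assms(2)]
    by (intro sum.cong refl) (auto simp del: mat_pow.simps)
  also have "\<dots> = (\<Sum>p\<in>{..<n}\<times>{..<n}. mat_pow n A (k + 1) (fst p) (snd p) * D (fst p) (snd p))"
    by (simp add: sum.cartesian_product case_prod_beta)
  also have "\<dots> \<le> \<bar>\<dots>\<bar>" by simp
  also have "\<dots> \<le> sqrt ((\<Sum>p\<in>{..<n}\<times>{..<n}. (mat_pow n A (k + 1) (fst p) (snd p))\<^sup>2) * (\<Sum>p\<in>{..<n}\<times>{..<n}. (D (fst p) (snd p))\<^sup>2))"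
    by (rule real_le_rsqrt) (simp add: Cauchy_Schwarz_ineq_sum del: mat_pow.simps)
  also have "(\<Sum>p\<in>{..<n}\<times>{..<n}. (mat_pow n A (k + 1) (fst p) (snd p))\<^sup>2) = trace_pow n A (2 * k + 2)"
    using trace_pow_double[OF assms(2), of "k + 1"] by (simp add: sum.cartesian_product case_prod_beta del: mat_pow.simps)
  also have "(\<Sum>p\<in>{..<n}\<times>{..<n}. (D (fst p) (snd p))\<^sup>2) = (\<Sum>l<n. (L2_set (\<lambda>i. D i l) {..<n})\<^sup>2)"
    by (simp add: L2_set_def sum_nonneg) (subst sum.swap, simp add: sum.cartesian_product case_prod_beta)
  also have "sqrt (trace_pow n A (2 * k + 2) * (\<Sum>l<n. (L2_set (\<lambda>i. D i l) {..<n})\<^sup>2))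
      \<le> sqrt (trace_pow n A (2 * k + 2) * (\<Sum>l<n. (spec_norm n C * L2_set (\<lambda>j. mat_pow n A k j l) {..<n})\<^sup>2))"
    unfolding D_def
    by (intro real_sqrt_le_mono mult_left_mono sum_mono power_mono spec_norm_apply L2_set_nonneg trace_pow_even_nonneg assms) simp
  also have "(\<Sum>l<n. (spec_norm n C * L2_set (\<lambda>j. mat_pow n A k j l) {..<n})\<^sup>2)
      = (spec_norm n C)\<^sup>2 * (\<Sum>l<n. \<Sum>j<n. (mat_pow n A k j l)\<^sup>2)"
    by (simp add: power_mult_distrib L2_set_def sum_nonneg sum_distrib_left)
  also have "(\<Sum>l<n. \<Sum>j<n. (mat_pow n A k j l)\<^sup>2) = trace_pow n A (2 * k)"
    unfolding trace_pow_double[OF assms(2)] by (rule sum.swap)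
  also have "sqrt (trace_pow n A (2 * k + 2) * ((spec_norm n C)\<^sup>2 * trace_pow n A (2 * k)))
     = spec_norm n C * sqrt (trace_pow n A (2 * k + 2) * trace_pow n A (2 * k))"
    using spec_norm_nonneg[OF assms(1), of C] by (simp add: real_sqrt_mult)
  finally show ?thesis .
qed

subsection \<open>Catalan numbers\<close>

definition catalan :: "nat \<Rightarrow> real" where
  "catalan n = real ((2 * n) choose n) / real (Suc n)"

lemma central_binomial_Suc:
  "real (Suc n) * real ((2 * Suc n) choose Suc n) = 2 * real (2 * n + 1) * real ((2 * n) choose n)"
proof -
  have 1: "Suc n * ((2 * n + 2) choose Suc n) = (2 * n + 2) * ((2 * n + 1) choose n)"
    using Suc_times_binomial_eq[of "2 * n + 1" n] by (simp add: mult.commute)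
  have 2: "Suc n * ((2 * n + 1) choose n) = (2 * n + 1) * ((2 * n) choose n)"
  proof -
    have "(2 * n + 1) choose n = (2 * n + 1) choose Suc n"
      using binomial_symmetric[of n "2 * n + 1"] by (simp add: mult_2)
    then show ?thesis using Suc_times_binomial_eq[of "2 * n" n] by (simp add: mult.commute)
  qed
  have "Suc n * (Suc n * ((2 * n + 2) choose Suc n)) = (2 * n + 2) * (Suc n * ((2 * n + 1) choose n))"
    unfolding 1 by (simp only: mult.left_commute)
  also have "\<dots> = Suc n * (2 * ((2 * n + 1) * ((2 * n) choose n)))"
    unfolding 2 by simp
  finally have "Suc n * (Suc n * ((2 * n + 2) choose Suc n)) = Suc n * (2 * ((2 * n + 1) * ((2 * n) choose n)))" .
  then have "Suc n * ((2 * n + 2) choose Suc n) = 2 * ((2 * n + 1) * ((2 * n) choose n))"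
    by (metis Suc_mult_cancel1)
  then have "real (Suc n * ((2 * n + 2) choose Suc n)) = real (2 * ((2 * n + 1) * ((2 * n) choose n)))"
    by (simp only:)
  then show ?thesis by (simp only: of_nat_mult) (simp del: binomial_Suc_Suc)
qed

lemma catalan_pos: "0 < catalan n"
  by (simp add: catalan_def zero_less_binomial)

lemma catalan_0 [simp]: "catalan 0 = 1"
  by (simp add: catalan_def)

lemma catalan_Suc: "real (n + 2) * catalan (Suc n) = 2 * real (2 * n + 1) * catalan n"
proof -
  have "real (Suc n) * (real (n + 2) * catalan (Suc n)) = real (Suc n) * real ((2 * Suc n) choose Suc n)"
    by (simp add: catalan_def del: binomial_Suc_Suc)
  also have "\<dots> = real (Suc n) * (2 * real (2 * n + 1) * catalan n)"
    unfolding central_binomial_Suc by (simp add: catalan_def)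
  finally show ?thesis by simp
qed

lemma catalan_Suc_le: "catalan (Suc n) \<le> 4 * catalan n"
proof -
  have "real (n + 2) * catalan (Suc n) \<le> real (n + 2) * (4 * catalan n)"
    unfolding catalan_Suc using catalan_pos[of n] by (simp add: algebra_simps)
  then show ?thesis by (simp add: mult_le_cancel_left_pos del: of_nat_add)
qed

lemma catalan_le_Suc: "catalan n \<le> catalan (Suc n)"
proof -
  have "real (n + 2) * catalan n \<le> real (n + 2) * catalan (Suc n)"
    unfolding catalan_Suc using catalan_pos[of n] by (simp add: algebra_simps)
  then show ?thesis by (simp add: mult_le_cancel_left_pos del: of_nat_add)
qed

lemma catalan_mono: "m \<le> n \<Longrightarrow> catalan m \<le> catalan n"
  by (rule lift_Suc_mono_le[of catalan]) (rule catalan_le_Suc)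

lemma catalan_add_le: "catalan (n + m) \<le> 4 ^ m * catalan n"
proof (induction m)
  case (Suc m)
  then show ?case using catalan_Suc_le[of "n + m"] by simp
qed simp

lemma catalan_le_power: "catalan n \<le> 4 ^ n"
  using catalan_add_le[of 0 n] by simp

text \<open>The coefficients of \<open>(1 - sqrt (1 - 4 x)) / (2 x)\<close>, the generating function
  of the Catalan numbers.\<close>

lemma catalan_gbinomial: "catalan n = - (1/2) * (-4) ^ Suc n * ((1/2) gchoose Suc n)"
proof (induction n)
  case (Suc n)
  have "real (n + 2) * ((1/2::real) gchoose Suc (Suc n)) = (1/2 - real (Suc n)) * ((1/2) gchoose Suc n)"
    using gbinomial_mult_1[of "1/2::real" "Suc n"] by (simp add: algebra_simps)
  then have "2 * (-4) ^ Suc n * (real (n + 2) * ((1/2::real) gchoose Suc (Suc n)))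
     = 2 * (-4) ^ Suc n * ((1/2 - real (Suc n)) * ((1/2) gchoose Suc n))"
    by simp
  then have "real (n + 2) * (- (1/2) * (-4) ^ Suc (Suc n) * ((1/2) gchoose Suc (Suc n)))
     = 2 * real (2 * n + 1) * (- (1/2) * (-4) ^ Suc n * ((1/2) gchoose Suc n))"
    by (simp add: algebra_simps)
  also have "\<dots> = real (n + 2) * catalan (Suc n)" by (simp only: catalan_Suc Suc.IH)
  finally show ?case by (simp only: mult_cancel_left of_nat_eq_0_iff) simp
qed simp

text \<open>Squaring \<open>sqrt (1 - 4 x)\<close> gives \<open>1 - 4 x\<close>, whose coefficient
  of order \<open>n + 2\<close> vanishes. By Vandermonde this coefficient is a convolution of
  half-integer binomials; its two end terms yield the right-hand side.\<close>

lemma catalan_convolution: "(\<Sum>a\<le>n. catalan a * catalan (n - a)) = catalan (Suc n)"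
proof -
  let ?g = "\<lambda>k. ((1/2::real) gchoose k)"
  have "(\<Sum>k\<le>n + 2. ?g k * ?g (n + 2 - k)) = (1/2 + 1/2) gchoose (n + 2)"
    using gbinomial_Vandermonde[of "1/2::real" "1/2" "n + 2"] by (simp add: atMost_atLeast0)
  also have "\<dots> = 0"
    using binomial_gbinomial[of 1 "n + 2", where 'a = real] by simp
  finally have 0: "(\<Sum>k\<le>Suc (Suc n). ?g k * ?g (n + 2 - k)) = 0" by simp
  have "(\<Sum>k\<le>Suc (Suc n). ?g k * ?g (n + 2 - k))
      = ?g 0 * ?g (n + 2) + (\<Sum>k\<le>n. ?g (Suc k) * ?g (n + 2 - Suc k)) + ?g (n + 2) * ?g 0"
    by (subst sum.atMost_Suc_shift, subst sum.atMost_Suc) simp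
  with 0 have 1: "(\<Sum>k\<le>n. ?g (Suc k) * ?g (Suc (n - k))) = - 2 * ?g (n + 2)"
    by (simp add: Suc_diff_le)
  have "(\<Sum>a\<le>n. catalan a * catalan (n - a)) = (\<Sum>a\<le>n. (1/4) * (-4) ^ (n + 2) * (?g (Suc a) * ?g (Suc (n - a))))"
  proof (intro sum.cong refl)
    fix a assume "a \<in> {..n}"
    then have "(-4::real) ^ (n + 2) = (-4) ^ Suc a * (-4) ^ Suc (n - a)"
      by (simp flip: power_add)
    moreover have "(-(1/2)) * p * u * ((-(1/2)) * q * v) = 1/4 * (p * q) * (u * v)" for p q u v :: real
      by simp
    ultimately show "catalan a * catalan (n - a) = (1/4) * (-4) ^ (n + 2) * (?g (Suc a) * ?g (Suc (n - a)))"
      by (simp only: catalan_gbinomial)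
  qed
  also have "\<dots> = (1/4) * (-4) ^ (n + 2) * (- 2 * ?g (n + 2))"
    by (simp only: 1 flip: sum_distrib_left)
  also have "\<dots> = catalan (Suc n)" by (simp add: catalan_gbinomial)
  finally show ?thesis .
qed

text \<open>The probability that a simple random walk is at its origin after \<open>2 * h\<close>
  steps.\<close>

definition central_ratio :: "nat \<Rightarrow> real" where
  "central_ratio h = real ((2 * h) choose h) / 4 ^ h"

lemma central_ratio_Suc: "central_ratio (Suc h) = central_ratio h * (real (2 * h + 1) / real (2 * h + 2))"
proof -
  have "real (Suc h) * central_ratio (Suc h) = 2 * real (2 * h + 1) * real ((2 * h) choose h) / 4 ^ Suc h"
    unfolding central_ratio_def by (simp only: times_divide_eq_right central_binomial_Suc)
  then have "central_ratio (Suc h) = (2 * real (2 * h + 1) * real ((2 * h) choose h) / 4 ^ Suc h) / real (Suc h)"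
    by (metis nonzero_mult_div_cancel_left of_nat_neq_0)
  moreover have "(2 * a * b / 4 ^ Suc h) / real (Suc h) = b / 4 ^ h * (a / real (2 * h + 2))" for a b :: real
    by (simp add: field_simps)
  ultimately show ?thesis by (simp only: central_ratio_def)
qed

text \<open>A simple random walk first returns to its origin at time \<open>2 * (b + 1)\<close> with
  probability \<open>2 * catalan b / 4 ^ (b + 1)\<close>, and it does not return up to time
  \<open>2 * h\<close> with probability \<open>central_ratio h\<close>.\<close>

lemma sum_catalan_over_powers: "(\<Sum>b<h. catalan b / 4 ^ Suc b) = (1 - central_ratio h) / 2"
proof (induction h)
  case 0
  then show ?case by (simp add: central_ratio_def)
next
  case (Suc h)
  have "catalan h / 4 ^ Suc h = central_ratio h / (4 * real (Suc h))"
    by (simp add: catalan_def central_ratio_def)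
  then have "(\<Sum>b<Suc h. catalan b / 4 ^ Suc b) = (1 - central_ratio h) / 2 + central_ratio h / (4 * real (Suc h))"
    using Suc.IH by simp
  also have "\<dots> = (1 - central_ratio (Suc h)) / 2"
    unfolding central_ratio_Suc by (simp add: field_simps)
  finally show ?case .
qed

lemma central_ratio_nonneg: "0 \<le> central_ratio h" by (simp add: central_ratio_def)

lemma central_ratio_square_le: "(central_ratio h)\<^sup>2 \<le> 1 / real (2 * h + 1)"
proof (induction h)
  case (Suc h)
  have "(central_ratio (Suc h))\<^sup>2 = (central_ratio h)\<^sup>2 * (real (2 * h + 1) / real (2 * h + 2))\<^sup>2"
    by (simp only: central_ratio_Suc power_mult_distrib)
  also have "\<dots> \<le> (1 / real (2 * h + 1)) * (real (2 * h + 1) / real (2 * h + 2))\<^sup>2"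
    by (intro mult_right_mono Suc) simp
  also have "\<dots> \<le> 1 / real (2 * Suc h + 1)"
  proof -
    have "1 / (x + 1) * ((x + 1) / (x + 2))\<^sup>2 \<le> 1 / (x + 3)" if "0 \<le> x" for x :: real
    proof -
      have eq: "1 / (x + 1) * ((x + 1) / (x + 2))\<^sup>2 = (x + 1) / (x + 2)\<^sup>2"
        using that by (simp add: power2_eq_square)
      have "x + 1 \<le> (x + 2)\<^sup>2 / (x + 3)"
        using that by (intro mult_imp_le_div_pos) (auto simp: power2_eq_square algebra_simps)
      then have "(x + 1) / (x + 2)\<^sup>2 \<le> 1 / (x + 3)"
        using that by (intro mult_imp_div_pos_le) auto
      then show ?thesis unfolding eq .
    qed
    from this[of "real (2 * h)"] show ?thesis by (simp add: add_ac)
  qed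
  finally show ?case .
qed (simp add: central_ratio_def)

lemma central_ratio_tendsto_0: "central_ratio \<longlonglongrightarrow> 0"
proof -
  have "(\<lambda>h. sqrt (1 / real (2 * h + 1))) \<longlonglongrightarrow> 0" by real_asymp
  then show ?thesis
  proof (rule tendsto_sandwich[OF _ _ tendsto_const, rotated 2])
    show "\<forall>\<^sub>F h in sequentially. central_ratio h \<le> sqrt (1 / real (2 * h + 1))"
      using central_ratio_square_le by (intro always_eventually allI real_le_rsqrt)
  qed (simp add: central_ratio_nonneg)
qed

text \<open>A truncated Catalan convolution captures only half of the full one, up to \<open>central_ratio h\<close>; this makes
  shifted Catalan numbers an almost stationary solution of the recursion for odd moments.\<close>

lemma catalan_shift_convolution:
  "2 * (\<Sum>a<i. catalan a * catalan (i - 1 - a + h)) \<le> (1 + central_ratio h) * catalan (i + h)"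
proof (cases "i = 0")
  case True
  then show ?thesis using catalan_pos[of h] central_ratio_nonneg[of h] by (simp add: less_imp_le)
next
  case False
  define n where "n = i + h - 1"
  have n: "Suc n = i + h" using False by (simp add: n_def)
  \<comment> \<open>Split the full convolution at \<open>a = i\<close>: the first part is the
    truncated one, the rest has \<open>h\<close> terms.\<close>
  have "catalan (i + h) = (\<Sum>a\<in>{..<i} \<union> {i..<i + h}. catalan a * catalan (n - a))"
  proof -
    have "{..n} = {..<i} \<union> {i..<i + h}" using n by auto
    then show ?thesis using catalan_convolution[of n] n by simp
  qed
  also have "\<dots> = (\<Sum>a<i. catalan a * catalan (n - a)) + (\<Sum>a\<in>{i..<i+h}. catalan a * catalan (n - a))"
    by (intro sum.union_disjoint) auto
  also have "(\<Sum>a<i. catalan a * catalan (n - a)) = (\<Sum>a<i. catalan a * catalan (i - 1 - a + h))"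
  proof (intro sum.cong refl)
    fix a assume "a \<in> {..<i}"
    then have "n - a = i - 1 - a + h" by (auto simp: n_def)
    then show "catalan a * catalan (n - a) = catalan a * catalan (i - 1 - a + h)" by simp
  qed
  also have "(\<Sum>a\<in>{i..<i+h}. catalan a * catalan (n - a)) = (\<Sum>b<h. catalan (n - b) * catalan b)"
    by (rule sum.reindex_bij_witness[where i = "\<lambda>b. n - b" and j = "\<lambda>a. n - a"]) (use n in auto)
  finally have eq: "catalan (i + h) = (\<Sum>a<i. catalan a * catalan (i - 1 - a + h)) + (\<Sum>b<h. catalan (n - b) * catalan b)" .
  \<comment> \<open>Since \<open>catalan (i + h) <= 4 ^ (b + 1) * catalan (n - b)\<close>, the
    \<open>h\<close> remaining terms make up a share of at least
    \<open>(1 - central_ratio h) / 2\<close>.\<close>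
  have "(\<Sum>b<h. catalan b / 4 ^ Suc b) * catalan (i + h) \<le> (\<Sum>b<h. catalan (n - b) * catalan b)"
    unfolding sum_distrib_right
  proof (intro sum_mono)
    fix b assume "b \<in> {..<h}"
    then have "n - b + Suc b = i + h" using n by auto
    then have "catalan (i + h) \<le> 4 ^ Suc b * catalan (n - b)" using catalan_add_le[of "n - b" "Suc b"] by simp
    then have "catalan (i + h) / 4 ^ Suc b \<le> catalan (n - b)" by (simp add: field_simps)
    from mult_right_mono[OF this, of "catalan b"] show "catalan b / 4 ^ Suc b * catalan (i + h) \<le> catalan (n - b) * catalan b"
      using catalan_pos[of b] by (simp add: mult.commute)
  qed
  then have "(1 - central_ratio h) / 2 * catalan (i + h) \<le> (\<Sum>b<h. catalan (n - b) * catalan b)"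
    by (simp only: sum_catalan_over_powers)
  then show ?thesis using eq by (simp add: algebra_simps)
qed

text \<open>The loss \<open>4 ^ (2 * h)\<close> is harmless, because the terms bounded here carry a
  factor \<open>q\<close> that is chosen after \<open>h\<close>.\<close>

lemma catalan_shift_shift_convolution:
  "(\<Sum>a\<le>m. catalan (a + h) * catalan (m - a + h)) \<le> 4 ^ (2 * h) * catalan (Suc m)"
proof -
  have "(\<Sum>a\<le>m. catalan (a + h) * catalan (m - a + h)) \<le> (\<Sum>a\<le>m. (4 ^ h * catalan a) * (4 ^ h * catalan (m - a)))"
    by (intro sum_mono mult_mono catalan_add_le) (auto simp: catalan_pos less_imp_le)
  also have "\<dots> = 4 ^ (2 * h) * (\<Sum>a\<le>m. catalan a * catalan (m - a))"
  proof -
    have "(4::real) ^ (2 * h) = 4 ^ h * 4 ^ h" by (simp add: mult_2 power_add)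
    then show ?thesis by (simp only: sum_distrib_left mult_ac)
  qed
  finally show ?thesis by (simp only: catalan_convolution)
qed

subsection \<open>Moments of matrices satisfying a Wick inequality\<close>

text \<open>Expectation under the uniform distribution on a finite set; the comparison matrices live
  on such spaces, where integrability is no issue.\<close>

definition avg :: "'w set \<Rightarrow> ('w \<Rightarrow> real) \<Rightarrow> real" where
  "avg \<Omega> f = (\<Sum>\<omega>\<in>\<Omega>. f \<omega>) / real (card \<Omega>)"

lemma avg_add: "avg \<Omega> (\<lambda>\<omega>. f \<omega> + g \<omega>) = avg \<Omega> f + avg \<Omega> g"
  by (simp add: avg_def sum.distrib add_divide_distrib)

lemma avg_sum: "avg \<Omega> (\<lambda>\<omega>. \<Sum>a\<in>A. f a \<omega>) = (\<Sum>a\<in>A. avg \<Omega> (f a))"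
  unfolding avg_def by (subst sum.swap) (simp add: sum_divide_distrib)

lemma avg_cmult: "avg \<Omega> (\<lambda>\<omega>. c * f \<omega>) = c * avg \<Omega> f"
  by (simp add: avg_def sum_distrib_left)

lemma avg_mono: "(\<And>\<omega>. \<omega> \<in> \<Omega> \<Longrightarrow> f \<omega> \<le> g \<omega>) \<Longrightarrow> avg \<Omega> f \<le> avg \<Omega> g"
  unfolding avg_def by (intro divide_right_mono sum_mono) auto

lemma avg_cong: "(\<And>\<omega>. \<omega> \<in> \<Omega> \<Longrightarrow> f \<omega> = g \<omega>) \<Longrightarrow> avg \<Omega> f = avg \<Omega> g"
  unfolding avg_def by (metis sum.cong)

lemma avg_const: "finite \<Omega> \<Longrightarrow> \<Omega> \<noteq> {} \<Longrightarrow> avg \<Omega> (\<lambda>_. c) = c"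
  by (simp add: avg_def)

text \<open>The derivative of the entry \<open>(x, y)\<close> in the variable of the unordered pair
  \<open>{i, j}\<close>, counted twice on the diagonal as for the Gaussian orthogonal ensemble. The
  double count gives one trace formula for all \<open>i\<close> and \<open>j\<close> and only
  enlarges an upper bound.\<close>

definition edge_delta :: "nat \<Rightarrow> nat \<Rightarrow> nat \<Rightarrow> nat \<Rightarrow> real" where
  "edge_delta i j x y = (if x = i \<and> y = j then 1 else 0) + (if x = j \<and> y = i then 1 else 0)"

definition monomial :: "(nat \<Rightarrow> nat \<Rightarrow> real) \<Rightarrow> (nat \<times> nat) list \<Rightarrow> real" where
  "monomial A ws = (\<Prod>(x, y)\<leftarrow>ws. A x y)"

fun monomial_deriv :: "(nat \<Rightarrow> nat \<Rightarrow> real) \<Rightarrow> nat \<Rightarrow> nat \<Rightarrow> (nat \<times> nat) list \<Rightarrow> real" where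
  "monomial_deriv A i j [] = 0"
| "monomial_deriv A i j ((x, y) # ws) = edge_delta i j x y * monomial A ws + A x y * monomial_deriv A i j ws"

lemma monomial_simps [simp]: "monomial A [] = 1" "monomial A ((x, y) # ws) = A x y * monomial A ws"
  "monomial A (ws @ vs) = monomial A ws * monomial A vs"
  by (simp_all add: monomial_def)

lemma monomial_deriv_append: "monomial_deriv A i j (ws @ vs) = monomial_deriv A i j ws * monomial A vs + monomial A ws * monomial_deriv A i j vs"
  by (induction ws) (auto simp: algebra_simps)

text \<open>Gaussian integration by parts, weakened to an upper bound for the expectation of
  monomials. In this form symmetric signs satisfy it as well.\<close>

locale wick =
  fixes \<Omega> :: "'w set" and r :: nat and G :: "'w \<Rightarrow> nat \<Rightarrow> nat \<Rightarrow> real"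
  assumes fin: "finite \<Omega>" and nonempty: "\<Omega> \<noteq> {}" and r_pos: "0 < r"
    and sym: "\<omega> \<in> \<Omega> \<Longrightarrow> sym_mat r (G \<omega>)"
    and wick: "i < r \<Longrightarrow> j < r \<Longrightarrow> set ws \<subseteq> {..<r} \<times> {..<r} \<Longrightarrow>
      avg \<Omega> (\<lambda>\<omega>. G \<omega> i j * monomial (G \<omega>) ws) \<le> avg \<Omega> (\<lambda>\<omega>. monomial_deriv (G \<omega>) i j ws)"
begin

text \<open>\<open>R i j f f'\<close>: the function \<open>f\<close> is a polynomial with non-negative coefficients in the entries, and
  \<open>f'\<close> is its formal derivative in the entry \<open>(i, j)\<close>.\<close>

inductive R :: "nat \<Rightarrow> nat \<Rightarrow> ('w \<Rightarrow> real) \<Rightarrow> ('w \<Rightarrow> real) \<Rightarrow> bool" for i j where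
  zero: "R i j (\<lambda>_. 0) (\<lambda>_. 0)"
| cons: "R i j f f' \<Longrightarrow> set ws \<subseteq> {..<r} \<times> {..<r} \<Longrightarrow>
    R i j (\<lambda>\<omega>. monomial (G \<omega>) ws + f \<omega>) (\<lambda>\<omega>. monomial_deriv (G \<omega>) i j ws + f' \<omega>)"

lemma R_ineq:
  assumes "R i j f f'" "i < r" "j < r"
  shows "avg \<Omega> (\<lambda>\<omega>. G \<omega> i j * f \<omega>) \<le> avg \<Omega> f'"
  using assms(1)
proof induction
  case zero
  then show ?case by simp
next
  case (cons f f' ws)
  then show ?case using wick[OF assms(2,3), of ws] by (simp add: distrib_left avg_add)
qed

lemma R_cong: "R i j f f' \<Longrightarrow> (\<And>\<omega>. g \<omega> = f \<omega>) \<Longrightarrow> (\<And>\<omega>. g' \<omega> = f' \<omega>) \<Longrightarrow> R i j g g'"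
  by presburger

lemma R_add:
  assumes "R i j f f'" "R i j h h'"
  shows "R i j (\<lambda>\<omega>. f \<omega> + h \<omega>) (\<lambda>\<omega>. f' \<omega> + h' \<omega>)"
  using assms(1)
proof induction
  case (cons f f' ws)
  from R.cons[OF cons.IH cons.hyps(2)] show ?case by (simp add: add.assoc)
qed (simp add: assms)

lemma R_word_mult:
  assumes "R i j f f'" "set ws \<subseteq> {..<r} \<times> {..<r}"
  shows "R i j (\<lambda>\<omega>. monomial (G \<omega>) ws * f \<omega>) (\<lambda>\<omega>. monomial_deriv (G \<omega>) i j ws * f \<omega> + monomial (G \<omega>) ws * f' \<omega>)"
  using assms(1)
proof induction
  case zero
  show ?case using R.zero by simp
next
  case (cons f f' vs)
  have "set (ws @ vs) \<subseteq> {..<r} \<times> {..<r}" using cons assms by auto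
  from R.cons[OF cons.IH this] show ?case by (rule R_cong) (simp_all add: monomial_deriv_append algebra_simps)
qed

lemma R_mult:
  assumes "R i j f f'" "R i j h h'"
  shows "R i j (\<lambda>\<omega>. f \<omega> * h \<omega>) (\<lambda>\<omega>. f' \<omega> * h \<omega> + f \<omega> * h' \<omega>)"
  using assms(1)
proof induction
  case zero
  show ?case using R.zero by simp
next
  case (cons f f' ws)
  from R_add[OF R_word_mult[OF assms(2) cons.hyps(2)] cons.IH] show ?case
    by (rule R_cong) (simp_all add: algebra_simps)
qed

lemma R_const1: "R i j (\<lambda>_. 1) (\<lambda>_. 0)"
  using R.cons[OF R.zero, of "[]"] by simp

lemma R_entry: "x < r \<Longrightarrow> y < r \<Longrightarrow> R i j (\<lambda>\<omega>. G \<omega> x y) (\<lambda>_. edge_delta i j x y)"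
  using R.cons[OF R.zero, of "[(x, y)]"] by simp

lemma R_sum:
  assumes "finite B" "\<And>a. a \<in> B \<Longrightarrow> R i j (f a) (f' a)"
  shows "R i j (\<lambda>\<omega>. \<Sum>a\<in>B. f a \<omega>) (\<lambda>\<omega>. \<Sum>a\<in>B. f' a \<omega>)"
  using assms by (induction B) (auto simp: R.zero R_add)

text \<open>Product rule: the differentiated factor sits at position \<open>s\<close> and leaves
  powers \<open>s\<close> and \<open>L - 1 - s\<close>; the two summands are the two orientations of
  the edge.\<close>

lemma R_mat_pow:
  assumes "i < r" "j < r" "x < r" "y < r"
  shows "R i j (\<lambda>\<omega>. mat_pow r (G \<omega>) L x y)
    (\<lambda>\<omega>. \<Sum>s<L. mat_pow r (G \<omega>) s x i * mat_pow r (G \<omega>) (L - 1 - s) j y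
              + mat_pow r (G \<omega>) s x j * mat_pow r (G \<omega>) (L - 1 - s) i y)"
  using assms(3)
proof (induction L arbitrary: x)
  case 0
  show ?case using R_const1 R.zero by simp
next
  case (Suc L)
  let ?D = "\<lambda>\<omega> x L. \<Sum>s<L. mat_pow r (G \<omega>) s x i * mat_pow r (G \<omega>) (L - 1 - s) j y
              + mat_pow r (G \<omega>) s x j * mat_pow r (G \<omega>) (L - 1 - s) i y"
  have "R i j (\<lambda>\<omega>. \<Sum>l<r. G \<omega> x l * mat_pow r (G \<omega>) L l y)
    (\<lambda>\<omega>. \<Sum>l<r. edge_delta i j x l * mat_pow r (G \<omega>) L l y + G \<omega> x l * ?D \<omega> l L)"
    using Suc by (intro R_sum R_mult R_entry) auto
  then show ?case
  proof (rule R_cong)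
    fix \<omega>
    have 1: "(\<Sum>l<r. edge_delta i j x l * mat_pow r (G \<omega>) L l y)
       = (if x = i then 1 else 0) * mat_pow r (G \<omega>) L j y + (if x = j then 1 else 0) * mat_pow r (G \<omega>) L i y"
    proof -
      have "(\<Sum>l<r. edge_delta i j x l * mat_pow r (G \<omega>) L l y)
        = (\<Sum>l<r. if l = j then (if x = i then 1 else 0) * mat_pow r (G \<omega>) L l y else 0)
        + (\<Sum>l<r. if l = i then (if x = j then 1 else 0) * mat_pow r (G \<omega>) L l y else 0)"
        unfolding sum.distrib[symmetric] by (intro sum.cong) (auto simp: edge_delta_def)
      then show ?thesis using assms by simp
    qed
    have 2: "(\<Sum>l<r. G \<omega> x l * ?D \<omega> l L)
      = (\<Sum>s<L. mat_pow r (G \<omega>) (Suc s) x i * mat_pow r (G \<omega>) (L - 1 - s) j y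
              + mat_pow r (G \<omega>) (Suc s) x j * mat_pow r (G \<omega>) (L - 1 - s) i y)"
      by (simp add: sum_distrib_left sum_distrib_right sum.distrib distrib_left mult.assoc)
        (simp only: sum.swap[where A = "{..<r}" and B = "{..<L}"])
    show "?D \<omega> x (Suc L) = (\<Sum>l<r. edge_delta i j x l * mat_pow r (G \<omega>) L l y + G \<omega> x l * ?D \<omega> l L)"
      unfolding sum.distrib[of _ _ "{..<r}"] 1 2 sum.lessThan_Suc_shift
      by (simp del: mat_pow.simps(2))
  qed simp
qed

text \<open>Cyclicity of the trace makes all \<open>M\<close> positions equal, and symmetry both
  orientations. Symmetry of \<open>G\<close> is known on \<open>\<Omega>\<close> only, so the closed
  form is claimed there and the derivative itself stays existential.\<close>

lemma R_trace_pow: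
  assumes "i < r" "j < r"
  shows "\<exists>f'. R i j (\<lambda>\<omega>. trace_pow r (G \<omega>) M) f' \<and> (\<forall>\<omega>\<in>\<Omega>. f' \<omega> = 2 * real M * mat_pow r (G \<omega>) (M - 1) i j)"
proof (intro exI conjI ballI)
  let ?D = "\<lambda>\<omega> x. \<Sum>s<M. mat_pow r (G \<omega>) s x i * mat_pow r (G \<omega>) (M - 1 - s) j x
              + mat_pow r (G \<omega>) s x j * mat_pow r (G \<omega>) (M - 1 - s) i x"
  show "R i j (\<lambda>\<omega>. trace_pow r (G \<omega>) M) (\<lambda>\<omega>. \<Sum>x<r. ?D \<omega> x)"
    unfolding trace_pow_def using assms by (intro R_sum R_mat_pow) auto
  fix \<omega> assume w: "\<omega> \<in> \<Omega>"
  note s = mat_pow_sym[OF sym[OF w]]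
  have "(\<Sum>x<r. ?D \<omega> x) = (\<Sum>s<M. (\<Sum>x<r. mat_pow r (G \<omega>) (M - 1 - s) j x * mat_pow r (G \<omega>) s x i)
      + (\<Sum>x<r. mat_pow r (G \<omega>) (M - 1 - s) i x * mat_pow r (G \<omega>) s x j))"
    by (subst sum.swap) (simp add: sum.distrib mult.commute)
  also have "\<dots> = (\<Sum>s<M. mat_pow r (G \<omega>) (M - 1 - s + s) j i + mat_pow r (G \<omega>) (M - 1 - s + s) i j)"
    using assms by (simp only: mat_pow_add)
  also have "\<dots> = (\<Sum>s<M. 2 * mat_pow r (G \<omega>) (M - 1) i j)"
    using s[OF assms] by (intro sum.cong refl) auto
  finally show "(\<Sum>x<r. ?D \<omega> x) = 2 * real M * mat_pow r (G \<omega>) (M - 1) i j" by simp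
qed

definition trace_prod :: "nat list \<Rightarrow> 'w \<Rightarrow> real" where
  "trace_prod Ls \<omega> = (\<Prod>L\<leftarrow>Ls. trace_pow r (G \<omega>) L)"

lemma trace_prod_simps [simp]: "trace_prod [] \<omega> = 1" "trace_prod (L # Ls) \<omega> = trace_pow r (G \<omega>) L * trace_prod Ls \<omega>"
  by (simp_all add: trace_prod_def)

fun trace_prod_deriv :: "nat \<Rightarrow> nat \<Rightarrow> nat list \<Rightarrow> 'w \<Rightarrow> real" where
  "trace_prod_deriv i j [] \<omega> = 0"
| "trace_prod_deriv i j (M # Ms) \<omega> = 2 * real M * mat_pow r (G \<omega>) (M - 1) i j * trace_prod Ms \<omega> + trace_pow r (G \<omega>) M * trace_prod_deriv i j Ms \<omega>"

text \<open>A factor of the opened trace is matched with one in another trace of exponent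
  \<open>M\<close>: there are \<open>M\<close> positions and two orientations, and the two cycles
  fuse into one of exponent \<open>L + M - 1\<close>.\<close>

fun merge :: "nat \<Rightarrow> nat list \<Rightarrow> 'w \<Rightarrow> real" where
  "merge L [] \<omega> = 0"
| "merge L (M # Ms) \<omega> = 2 * real M * trace_pow r (G \<omega>) (L + (M - 1)) * trace_prod Ms \<omega> + trace_pow r (G \<omega>) M * merge L Ms \<omega>"

lemma R_trace_prod:
  assumes "i < r" "j < r"
  shows "\<exists>f'. R i j (trace_prod Ls) f' \<and> (\<forall>\<omega>\<in>\<Omega>. f' \<omega> = trace_prod_deriv i j Ls \<omega>)"
proof (induction Ls)
  case Nil
  show ?case using R_const1 by (auto simp: fun_eq_iff intro!: exI[of _ "\<lambda>_. 0"] R_cong[OF R_const1])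
next
  case (Cons M Ms)
  then obtain f' where f': "R i j (trace_prod Ms) f'" "\<forall>\<omega>\<in>\<Omega>. f' \<omega> = trace_prod_deriv i j Ms \<omega>" by blast
  obtain g' where g': "R i j (\<lambda>\<omega>. trace_pow r (G \<omega>) M) g'" "\<forall>\<omega>\<in>\<Omega>. g' \<omega> = 2 * real M * mat_pow r (G \<omega>) (M - 1) i j"
    using R_trace_pow[OF assms] by blast
  from R_mult[OF g'(1) f'(1)] have "R i j (trace_prod (M # Ms)) (\<lambda>\<omega>. g' \<omega> * trace_prod Ms \<omega> + trace_pow r (G \<omega>) M * f' \<omega>)"
    by (rule R_cong) simp_all
  moreover have "\<forall>\<omega>\<in>\<Omega>. g' \<omega> * trace_prod Ms \<omega> + trace_pow r (G \<omega>) M * f' \<omega> = trace_prod_deriv i j (M # Ms) \<omega>"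
    using f'(2) g'(2) by simp
  ultimately show ?case by blast
qed

lemma sum_mat_pow_trace_prod_deriv:
  assumes "\<omega> \<in> \<Omega>"
  shows "(\<Sum>i<r. \<Sum>j<r. mat_pow r (G \<omega>) L j i * trace_prod_deriv i j Ls \<omega>) = merge L Ls \<omega>"
proof (induction Ls)
  case (Cons M Ms)
  note s = mat_pow_sym[OF sym[OF assms]]
  have tt: "trace_pow r (G \<omega>) (L + (M - 1)) = (\<Sum>i<r. \<Sum>j<r. mat_pow r (G \<omega>) L j i * mat_pow r (G \<omega>) (M - 1) i j)"
    unfolding trace_pow_add[OF sym[OF assms]] using s by (intro sum.cong refl) auto
  have "2 * real M * trace_pow r (G \<omega>) (L + (M - 1)) * trace_prod Ms \<omega>
     = (\<Sum>i<r. \<Sum>j<r. mat_pow r (G \<omega>) L j i * (2 * real M * mat_pow r (G \<omega>) (M - 1) i j * trace_prod Ms \<omega>))"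
    unfolding tt by (simp add: sum_distrib_left sum_distrib_right mult_ac)
  moreover have "trace_pow r (G \<omega>) M * merge L Ms \<omega> = (\<Sum>i<r. \<Sum>j<r. mat_pow r (G \<omega>) L j i * (trace_pow r (G \<omega>) M * trace_prod_deriv i j Ms \<omega>))"
    by (simp add: sum_distrib_left mult_ac flip: Cons.IH)
  ultimately show ?case by (simp add: distrib_left sum.distrib)
qed simp

text \<open>The loop equation of the Gaussian orthogonal ensemble, as an inequality. One factor of
  the first trace is integrated by parts: a match inside the same trace splits the cycle or, with
  reversed orientation, leaves the exponent \<open>L - 1\<close>; a match in another trace gives
  \<open>merge\<close>.\<close>

lemma trace_recursion:
  "avg \<Omega> (trace_prod (Suc L # Ls)) \<le> avg \<Omega> (\<lambda>\<omega>. (\<Sum>s<L. trace_pow r (G \<omega>) s * trace_pow r (G \<omega>) (L - 1 - s) + trace_pow r (G \<omega>) (L - 1)) * trace_prod Ls \<omega>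
      + merge L Ls \<omega>)"
proof -
  let ?D = "\<lambda>\<omega> i j. \<Sum>s<L. mat_pow r (G \<omega>) s j i * mat_pow r (G \<omega>) (L - 1 - s) j i
              + mat_pow r (G \<omega>) s j j * mat_pow r (G \<omega>) (L - 1 - s) i i"
  have step: "avg \<Omega> (\<lambda>\<omega>. G \<omega> i j * (mat_pow r (G \<omega>) L j i * trace_prod Ls \<omega>))
      \<le> avg \<Omega> (\<lambda>\<omega>. ?D \<omega> i j * trace_prod Ls \<omega> + mat_pow r (G \<omega>) L j i * trace_prod_deriv i j Ls \<omega>)" if ij: "i < r" "j < r" for i j
  proof -
    obtain f' where f': "R i j (trace_prod Ls) f'" "\<forall>\<omega>\<in>\<Omega>. f' \<omega> = trace_prod_deriv i j Ls \<omega>" using R_trace_prod[OF ij] by blast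
    have "avg \<Omega> (\<lambda>\<omega>. G \<omega> i j * (mat_pow r (G \<omega>) L j i * trace_prod Ls \<omega>))
        \<le> avg \<Omega> (\<lambda>\<omega>. ?D \<omega> i j * trace_prod Ls \<omega> + mat_pow r (G \<omega>) L j i * f' \<omega>)"
      by (rule R_ineq[OF R_mult[OF R_mat_pow f'(1)]]) (use ij in auto)
    also have "\<dots> = avg \<Omega> (\<lambda>\<omega>. ?D \<omega> i j * trace_prod Ls \<omega> + mat_pow r (G \<omega>) L j i * trace_prod_deriv i j Ls \<omega>)"
      using f'(2) by (intro avg_cong) auto
    finally show ?thesis .
  qed
  have "avg \<Omega> (trace_prod (Suc L # Ls)) = (\<Sum>i<r. \<Sum>j<r. avg \<Omega> (\<lambda>\<omega>. G \<omega> i j * (mat_pow r (G \<omega>) L j i * trace_prod Ls \<omega>)))"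
    unfolding avg_sum[symmetric] by (intro avg_cong) (simp add: trace_pow_def sum_distrib_right mult.assoc)
  also have "\<dots> \<le> (\<Sum>i<r. \<Sum>j<r. avg \<Omega> (\<lambda>\<omega>. ?D \<omega> i j * trace_prod Ls \<omega> + mat_pow r (G \<omega>) L j i * trace_prod_deriv i j Ls \<omega>))"
    by (intro sum_mono step) auto
  also have "\<dots> = avg \<Omega> (\<lambda>\<omega>. \<Sum>i<r. \<Sum>j<r. ?D \<omega> i j * trace_prod Ls \<omega> + mat_pow r (G \<omega>) L j i * trace_prod_deriv i j Ls \<omega>)"
    by (simp only: avg_sum)
  also have "\<dots> = avg \<Omega> (\<lambda>\<omega>. (\<Sum>s<L. trace_pow r (G \<omega>) s * trace_pow r (G \<omega>) (L - 1 - s) + trace_pow r (G \<omega>) (L - 1)) * trace_prod Ls \<omega>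
      + merge L Ls \<omega>)"
  proof (rule avg_cong)
    fix \<omega> assume w: "\<omega> \<in> \<Omega>"
    have "(\<Sum>i<r. \<Sum>j<r. ?D \<omega> i j) = (\<Sum>i<r. \<Sum>s<L. \<Sum>j<r. mat_pow r (G \<omega>) s j i * mat_pow r (G \<omega>) (L - 1 - s) j i
              + mat_pow r (G \<omega>) s j j * mat_pow r (G \<omega>) (L - 1 - s) i i)"
      by (intro sum.cong refl sum.swap)
    also have "\<dots> = (\<Sum>s<L. \<Sum>i<r. \<Sum>j<r. mat_pow r (G \<omega>) s j i * mat_pow r (G \<omega>) (L - 1 - s) j i
              + mat_pow r (G \<omega>) s j j * mat_pow r (G \<omega>) (L - 1 - s) i i)"
      by (rule sum.swap)
    also have "\<dots> = (\<Sum>s<L. trace_pow r (G \<omega>) s * trace_pow r (G \<omega>) (L - 1 - s) + trace_pow r (G \<omega>) (L - 1))"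
    proof (intro sum.cong refl)
      fix s assume "s \<in> {..<L}"
      then have "L - 1 = s + (L - 1 - s)" by auto
      then have "trace_pow r (G \<omega>) (L - 1) = (\<Sum>i<r. \<Sum>j<r. mat_pow r (G \<omega>) s i j * mat_pow r (G \<omega>) (L - 1 - s) i j)"
        using trace_pow_add[OF sym[OF w]] by metis
      also have "\<dots> = (\<Sum>i<r. \<Sum>j<r. mat_pow r (G \<omega>) s j i * mat_pow r (G \<omega>) (L - 1 - s) j i)"
        by (rule sum.swap)
      finally have 1: "trace_pow r (G \<omega>) (L - 1) = \<dots>" .
      have 2: "trace_pow r (G \<omega>) s * trace_pow r (G \<omega>) (L - 1 - s) = (\<Sum>i<r. \<Sum>j<r. mat_pow r (G \<omega>) s j j * mat_pow r (G \<omega>) (L - 1 - s) i i)"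
        unfolding trace_pow_def sum_product by (rule sum.swap)
      show "(\<Sum>i<r. \<Sum>j<r. mat_pow r (G \<omega>) s j i * mat_pow r (G \<omega>) (L - 1 - s) j i
              + mat_pow r (G \<omega>) s j j * mat_pow r (G \<omega>) (L - 1 - s) i i)
          = trace_pow r (G \<omega>) s * trace_pow r (G \<omega>) (L - 1 - s) + trace_pow r (G \<omega>) (L - 1)"
        unfolding 1 2 sum.distrib by simp
    qed
    finally have D: "(\<Sum>i<r. \<Sum>j<r. ?D \<omega> i j) = \<dots>" .
    have "(\<Sum>i<r. \<Sum>j<r. f i j * t + h i j) = (\<Sum>i<r. \<Sum>j<r. f i j) * t + (\<Sum>i<r. \<Sum>j<r. h i j)"
      for f h :: "nat \<Rightarrow> nat \<Rightarrow> real" and t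
      by (simp add: sum.distrib sum_distrib_right)
    from this[of "?D \<omega>" "trace_prod Ls \<omega>" "\<lambda>i j. mat_pow r (G \<omega>) L j i * trace_prod_deriv i j Ls \<omega>"]
    have "(\<Sum>i<r. \<Sum>j<r. ?D \<omega> i j * trace_prod Ls \<omega> + mat_pow r (G \<omega>) L j i * trace_prod_deriv i j Ls \<omega>)
      = (\<Sum>i<r. \<Sum>j<r. ?D \<omega> i j) * trace_prod Ls \<omega> + merge L Ls \<omega>"
      by (simp only: sum_mat_pow_trace_prod_deriv[OF w])
    then show "(\<Sum>i<r. \<Sum>j<r. ?D \<omega> i j * trace_prod Ls \<omega> + mat_pow r (G \<omega>) L j i * trace_prod_deriv i j Ls \<omega>)
      = (\<Sum>s<L. trace_pow r (G \<omega>) s * trace_pow r (G \<omega>) (L - 1 - s) + trace_pow r (G \<omega>) (L - 1)) * trace_prod Ls \<omega> + merge L Ls \<omega>"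
      unfolding D .
  qed
  finally show ?thesis .
qed

end

section \<open>Bounding products of traces by Catalan numbers\<close>

lemma sum_split_odd: "(\<Sum>s<2*k+1. h s) = (\<Sum>a\<le>k. h (2*a)) + (\<Sum>a<k. h (2*a+1 :: nat))"
  for h :: "nat \<Rightarrow> real"
  by (induction k) (auto simp: algebra_simps)

lemma sum_split_even: "(\<Sum>s<2*k. h s) = (\<Sum>a<k. h (2*a)) + (\<Sum>a<k. h (2*a+1 :: nat))"
  for h :: "nat \<Rightarrow> real"
  by (induction k) (auto simp: algebra_simps)

context wick
begin

definition even_trace_prod :: "nat list \<Rightarrow> 'w \<Rightarrow> real" where
  "even_trace_prod ks \<omega> = trace_prod (map ((*) 2) ks) \<omega>"

lemma even_trace_prod_simps [simp]: "even_trace_prod [] \<omega> = 1" "even_trace_prod (k # ks) \<omega> = trace_pow r (G \<omega>) (2 * k) * even_trace_prod ks \<omega>"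
  "even_trace_prod (ks @ ls) \<omega> = even_trace_prod ks \<omega> * even_trace_prod ls \<omega>"
  by (simp_all add: even_trace_prod_def trace_prod_def)

lemma even_trace_prod_nonneg: "\<omega> \<in> \<Omega> \<Longrightarrow> 0 \<le> even_trace_prod ks \<omega>"
  by (induction ks) (auto intro!: mult_nonneg_nonneg trace_pow_even_nonneg sym)

definition even_bound :: "real \<Rightarrow> nat list \<Rightarrow> real" where
  "even_bound \<rho> ks = (\<Prod>k\<leftarrow>ks. real r * \<rho> ^ k * catalan k)"

lemma even_bound_simps [simp]: "even_bound \<rho> [] = 1" "even_bound \<rho> (k # ks) = real r * \<rho> ^ k * catalan k * even_bound \<rho> ks"
  "even_bound \<rho> (ks @ ls) = even_bound \<rho> ks * even_bound \<rho> ls"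
  by (simp_all add: even_bound_def)

lemma even_bound_nonneg: "0 \<le> \<rho> \<Longrightarrow> 0 \<le> even_bound \<rho> ks"
  by (induction ks) (auto intro!: mult_nonneg_nonneg simp: catalan_pos less_imp_le)

text \<open>A merged exponent \<open>2*k + 2*m\<close> is even and can be split again, so merging
  costs the factor \<open>4 * sum_list ks\<close> but creates no new kind of product.\<close>

lemma merge_even_le:
  assumes "\<omega> \<in> \<Omega>"
  shows "merge (2*k+1) (map ((*) 2) ks) \<omega> \<le> 4 * real (sum_list ks) * (trace_pow r (G \<omega>) (2*k) * even_trace_prod ks \<omega>)"
proof (induction ks)
  case (Cons m ms)
  let ?t = "trace_pow r (G \<omega>)"
  have "real m * ?t (2*k+1 + (2*m-1)) \<le> real m * (?t (2*k) * ?t (2*m))"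
  proof (cases "m = 0")
    case False
    then have "2*k+1 + (2*m-1) = 2*k + 2*m" by auto
    then show ?thesis using trace_pow_even_mult[OF sym[OF assms]] by (simp add: mult_left_mono)
  qed simp
  from mult_right_mono[OF this even_trace_prod_nonneg[OF assms, of ms]]
  have 1: "2 * real (2*m) * ?t (2*k+1 + (2*m-1)) * even_trace_prod ms \<omega> \<le> 4 * real m * (?t (2*k) * ?t (2*m) * even_trace_prod ms \<omega>)"
    by (simp add: mult_ac)
  have 2: "?t (2*m) * merge (2*k+1) (map ((*) 2) ms) \<omega>
      \<le> ?t (2*m) * (4 * real (sum_list ms) * (?t (2*k) * even_trace_prod ms \<omega>))"
    by (intro mult_left_mono Cons.IH trace_pow_even_nonneg sym assms) simp
  have "merge (2*k+1) (map ((*) 2) (m # ms)) \<omega>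
     = 2 * real (2*m) * ?t (2*k+1 + (2*m-1)) * even_trace_prod ms \<omega> + ?t (2*m) * merge (2*k+1) (map ((*) 2) ms) \<omega>"
    by (simp add: even_trace_prod_def)
  also have "\<dots> \<le> 4 * real m * (?t (2*k) * ?t (2*m) * even_trace_prod ms \<omega>) + ?t (2*m) * (4 * real (sum_list ms) * (?t (2*k) * even_trace_prod ms \<omega>))"
    using 1 2 by (rule add_mono)
  also have "\<dots> = 4 * real (sum_list (m # ms)) * (?t (2*k) * even_trace_prod (m # ms) \<omega>)"
    by (simp add: algebra_simps)
  finally show ?case .
qed simp

lemma odd_merge_pointwise:
  assumes "\<omega> \<in> \<Omega>" "0 < m"
  shows "trace_pow r (G \<omega>) (2*j+1) * trace_pow r (G \<omega>) (2*i + (2*m-1))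
    \<le> (even_trace_prod [i, m-1, j+1] \<omega> + even_trace_prod [i, m, j] \<omega>) / 2"
proof -
  let ?t = "trace_pow r (G \<omega>)"
  note s = sym[OF assms(1)]
  have nn: "0 \<le> ?t (2*l)" for l by (intro trace_pow_even_nonneg s) simp
  have e: "2*i + (2*m-1) = 2*(i+(m-1)) + 1" "2*(i+(m-1)) = 2*i + 2*(m-1)" "2*(i+(m-1)) + 2 = 2*i + 2*m"
    using assms(2) by auto
  have "?t (2*j+1) * ?t (2*i + (2*m-1)) \<le> \<bar>?t (2*(i+(m-1))+1) * ?t (2*j+1)\<bar>"
    unfolding e(1) by (simp add: mult.commute)
  also have "\<dots> \<le> (?t (2*(i+(m-1))) * ?t (2*j+2) + ?t (2*(i+(m-1))+2) * ?t (2*j)) / 2"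
    by (rule trace_pow_odd_pair[OF s])
  also have "\<dots> \<le> ((?t (2*i) * ?t (2*(m-1))) * ?t (2*j+2) + (?t (2*i) * ?t (2*m)) * ?t (2*j)) / 2"
    unfolding e(3) unfolding e(2) using nn[of "j+1"] nn[of j]
    by (intro divide_right_mono add_mono mult_right_mono trace_pow_even_mult s) auto
  finally show ?thesis by (simp add: mult_ac)
qed

text \<open>Each merged term is a product of two odd traces, handled by
  \<open>odd_merge_pointwise\<close>. The resulting even products have half total exponent below
  \<open>N\<close>, so \<open>IH\<close> applies. \<open>ps\<close> collects the traces already
  passed in the induction over \<open>ms\<close>.\<close>

lemma merge_odd_le:
  assumes IH: "\<And>ks. sum_list ks < N \<Longrightarrow> avg \<Omega> (even_trace_prod ks) \<le> even_bound \<rho> ks" and \<rho>: "0 \<le> \<rho>"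
    and N: "i + j + sum_list ps + sum_list ms < N"
  shows "avg \<Omega> (\<lambda>\<omega>. trace_pow r (G \<omega>) (2*j+1) * even_trace_prod ps \<omega> * merge (2*i) (map ((*) 2) ms) \<omega>)
    \<le> 10 * real (sum_list ms) * ((real r)\<^sup>2 * \<rho> ^ (i+j) * catalan i * catalan j * even_bound \<rho> (ps @ ms))"
  using N
proof (induction ms arbitrary: ps)
  case Nil
  then show ?case by (simp add: avg_def)
next
  case (Cons m ms)
  let ?X = "(real r)\<^sup>2 * \<rho> ^ (i+j) * catalan i * catalan j"
  have X: "0 \<le> ?X" using \<rho> by (intro mult_nonneg_nonneg) (auto simp: catalan_pos less_imp_le)
  have a: "avg \<Omega> (\<lambda>\<omega>. 4 * real m * (trace_pow r (G \<omega>) (2*j+1) * trace_pow r (G \<omega>) (2*i+(2*m-1)) * even_trace_prod (ps @ ms) \<omega>))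
    \<le> 10 * real m * (?X * even_bound \<rho> (ps @ m # ms))"
  proof (cases "m = 0")
    case True
    then show ?thesis by (simp add: avg_def)
  next
    case False
    then have m: "0 < m" by simp
    have "avg \<Omega> (\<lambda>\<omega>. 4 * real m * (trace_pow r (G \<omega>) (2*j+1) * trace_pow r (G \<omega>) (2*i+(2*m-1)) * even_trace_prod (ps @ ms) \<omega>))
      \<le> avg \<Omega> (\<lambda>\<omega>. 4 * real m * ((even_trace_prod [i, m-1, j+1] \<omega> + even_trace_prod [i, m, j] \<omega>) / 2 * even_trace_prod (ps @ ms) \<omega>))"
      by (intro avg_mono mult_left_mono mult_right_mono odd_merge_pointwise even_trace_prod_nonneg m) auto
    also have "\<dots> = avg \<Omega> (\<lambda>\<omega>. 2 * real m * (even_trace_prod ([i, m-1, j+1] @ ps @ ms) \<omega> + even_trace_prod ([i, m, j] @ ps @ ms) \<omega>))"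
      by (intro avg_cong) (simp add: algebra_simps)
    also have "\<dots> = 2 * real m * (avg \<Omega> (even_trace_prod ([i, m-1, j+1] @ ps @ ms)) + avg \<Omega> (even_trace_prod ([i, m, j] @ ps @ ms)))"
      unfolding avg_cmult avg_add ..
    also have "\<dots> \<le> 2 * real m * (even_bound \<rho> ([i, m-1, j+1] @ ps @ ms) + even_bound \<rho> ([i, m, j] @ ps @ ms))"
      using Cons.prems m by (intro mult_left_mono add_mono IH) auto
    \<comment> \<open>Trading \<open>m - 1, j + 1\<close> for \<open>m, j\<close> costs at most 4,
      the growth ratio of Catalan numbers. With the second product this gives
      \<open>2 * (4 + 1) = 10\<close>.\<close>
    also have "\<dots> \<le> 2 * real m * (4 * even_bound \<rho> ([i, m, j] @ ps @ ms) + even_bound \<rho> ([i, m, j] @ ps @ ms))"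
    proof (intro mult_left_mono add_mono order_refl)
      have "catalan (m-1) * catalan (j+1) \<le> catalan m * (4 * catalan j)"
        using m catalan_le_Suc[of "m-1"] catalan_Suc_le[of j] by (intro mult_mono) (auto simp: catalan_pos less_imp_le)
      moreover have "\<rho> ^ (m-1) * \<rho> ^ (j+1) = \<rho> ^ m * \<rho> ^ j"
        using m by (cases m) simp_all
      ultimately have "(\<rho> ^ (m-1) * \<rho> ^ (j+1)) * (catalan (m-1) * catalan (j+1)) \<le> (\<rho> ^ m * \<rho> ^ j) * (catalan m * (4 * catalan j))"
        using \<rho> by (simp only:) (intro mult_left_mono, auto)
      from mult_left_mono[OF this, of "real r ^ 3 * \<rho> ^ i * catalan i * even_bound \<rho> (ps @ ms)"]
      show "even_bound \<rho> ([i, m-1, j+1] @ ps @ ms) \<le> 4 * even_bound \<rho> ([i, m, j] @ ps @ ms)"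
        using \<rho> even_bound_nonneg[OF \<rho>, of ps] even_bound_nonneg[OF \<rho>, of ms] catalan_pos[of i]
        by (simp add: mult_ac power3_eq_cube)
    qed auto
    also have "\<dots> = 10 * real m * (?X * even_bound \<rho> (ps @ m # ms))"
      by (simp add: power2_eq_square power_add mult_ac)
    finally show ?thesis .
  qed
  have b: "avg \<Omega> (\<lambda>\<omega>. trace_pow r (G \<omega>) (2*j+1) * even_trace_prod (ps @ [m]) \<omega> * merge (2*i) (map ((*) 2) ms) \<omega>)
    \<le> 10 * real (sum_list ms) * (?X * even_bound \<rho> ((ps @ [m]) @ ms))"
    using Cons.prems by (intro Cons.IH) auto
  have merge: "merge (2*i) (map ((*) 2) (m # ms)) \<omega> = 2 * real (2*m) * trace_pow r (G \<omega>) (2*i+(2*m-1)) * even_trace_prod ms \<omega>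
      + trace_pow r (G \<omega>) (2*m) * merge (2*i) (map ((*) 2) ms) \<omega>" for \<omega>
    by (simp add: even_trace_prod_def)
  have "avg \<Omega> (\<lambda>\<omega>. trace_pow r (G \<omega>) (2*j+1) * even_trace_prod ps \<omega> * merge (2*i) (map ((*) 2) (m # ms)) \<omega>)
    = avg \<Omega> (\<lambda>\<omega>. 4 * real m * (trace_pow r (G \<omega>) (2*j+1) * trace_pow r (G \<omega>) (2*i+(2*m-1)) * even_trace_prod (ps @ ms) \<omega>)
      + trace_pow r (G \<omega>) (2*j+1) * even_trace_prod (ps @ [m]) \<omega> * merge (2*i) (map ((*) 2) ms) \<omega>)"
    unfolding merge by (intro avg_cong) (simp add: algebra_simps)
  also have "\<dots> \<le> 10 * real m * (?X * even_bound \<rho> (ps @ m # ms)) + 10 * real (sum_list ms) * (?X * even_bound \<rho> ((ps @ [m]) @ ms))"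
    unfolding avg_add using a b by (rule add_mono)
  also have "\<dots> = 10 * real (sum_list (m # ms)) * (?X * even_bound \<rho> (ps @ m # ms))"
    by (simp add: algebra_simps)
  finally show ?case .
qed

text \<open>Splitting an even trace also produces pairs of odd traces, so both kinds of product are
  bounded in one induction on half the total exponent. For odd pairs the natural ansatz without
  shift fails: splitting yields \<open>2 * catalan i\<close> where \<open>catalan i\<close> is
  wanted. The shift by \<open>h\<close> lowers the factor 2 to \<open>1 + central_ratio h\<close>.
  The weight \<open>q\<close> must be small for \<open>c1\<close>, where odd pairs feed into even
  products, and not too small for \<open>c2\<close>, where the merged terms are divided by
  it.\<close>

lemma trace_product_bounds:
  fixes \<kappa> q :: real and h P :: nat
  defines "\<rho> \<equiv> \<kappa> * real r"
  assumes q: "0 < q" "q \<le> 1" and \<kappa>: "0 \<le> \<kappa>"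
    and c1: "1 + q * 4 ^ (2*h) + 4 * real P / real r \<le> \<kappa>"
    and c2: "1 + central_ratio h + 10 * real P / (real r * q) \<le> \<kappa>"
    and N: "N \<le> P"
  shows "(\<forall>ks. sum_list ks = N \<longrightarrow> avg \<Omega> (even_trace_prod ks) \<le> even_bound \<rho> ks) \<and>
    (\<forall>i j ks. i + j + 1 + sum_list ks = N \<longrightarrow>
      avg \<Omega> (\<lambda>\<omega>. trace_pow r (G \<omega>) (2*i+1) * trace_pow r (G \<omega>) (2*j+1) * even_trace_prod ks \<omega>)
      \<le> q * (real r)\<^sup>2 * \<rho> ^ (i+j+1) * catalan (i+h) * catalan (j+h) * even_bound \<rho> ks)"
  using N
proof (induction N rule: less_induct)
  case (less N)
  have rr: "0 < real r" using r_pos by simp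
  have \<rho>: "0 \<le> \<rho>" using \<kappa> by (simp add: \<rho>_def)
  note PEn = even_bound_nonneg[OF \<rho>]
  note cn = less_imp_le[OF catalan_pos]
  have IHA: "avg \<Omega> (even_trace_prod ks) \<le> even_bound \<rho> ks" if "sum_list ks < N" for ks
    using less.IH[of "sum_list ks"] less.prems that by simp
  have IHB: "avg \<Omega> (\<lambda>\<omega>. trace_pow r (G \<omega>) (2*i+1) * trace_pow r (G \<omega>) (2*j+1) * even_trace_prod ks \<omega>)
      \<le> q * (real r)\<^sup>2 * \<rho> ^ (i+j+1) * catalan (i+h) * catalan (j+h) * even_bound \<rho> ks" if "i + j + 1 + sum_list ks < N" for i j ks
    using less.IH[of "i + j + 1 + sum_list ks"] less.prems that by simp
  have NP: "real N \<le> real P" using less.prems by simp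
  have A: "avg \<Omega> (even_trace_prod ks) \<le> even_bound \<rho> ks" if "sum_list ks = N" for ks
    using that
  proof (induction ks)
    case Nil
    then show ?case using avg_const[OF fin nonempty, of 1] by (simp add: even_trace_prod_def)
  next
    case (Cons k ks)
    show ?case
    proof (cases k)
      \<comment> \<open>A trace of exponent 0 equals \<open>r\<close> and leaves \<open>N\<close>
        unchanged, hence the inner induction on the list.\<close>
      case 0
      have "avg \<Omega> (even_trace_prod (k # ks)) = real r * avg \<Omega> (even_trace_prod ks)" unfolding 0 avg_cmult[symmetric] by (intro avg_cong) simp
      also have "\<dots> \<le> real r * even_bound \<rho> ks" using Cons 0 by (intro mult_left_mono) auto
      finally show ?thesis by (simp add: 0 del: even_trace_prod_simps)
    next
      case (Suc m)
      let ?c = "real (2*m+1) + 4 * real (sum_list ks)"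
      have N: "m + sum_list ks < N" "Suc m + sum_list ks = N" using Cons.prems Suc by auto
      have "avg \<Omega> (even_trace_prod (k # ks)) = avg \<Omega> (trace_prod (Suc (2*m+1) # map ((*) 2) ks))"
        by (intro avg_cong) (simp add: Suc even_trace_prod_def)
      also have "\<dots> \<le> avg \<Omega> (\<lambda>\<omega>. (\<Sum>s<2*m+1. trace_pow r (G \<omega>) s * trace_pow r (G \<omega>) (2*m - s) + trace_pow r (G \<omega>) (2*m)) * even_trace_prod ks \<omega>
          + merge (2*m+1) (map ((*) 2) ks) \<omega>)"
        using trace_recursion[of "2*m+1" "map ((*) 2) ks"] by (simp add: even_trace_prod_def)
      also have "\<dots> \<le> avg \<Omega> (\<lambda>\<omega>. (\<Sum>a\<le>m. even_trace_prod (a # (m-a) # ks) \<omega>)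
          + ((\<Sum>a<m. trace_pow r (G \<omega>) (2*a+1) * trace_pow r (G \<omega>) (2*(m-1-a)+1) * even_trace_prod ks \<omega>) + ?c * even_trace_prod (m # ks) \<omega>))"
      proof (rule avg_mono)
        fix \<omega> assume w: "\<omega> \<in> \<Omega>"
        let ?t = "trace_pow r (G \<omega>)"
        have 1: "(\<Sum>s<2*m+1. ?t s * ?t (2*m - s)) = (\<Sum>a\<le>m. ?t (2*a) * ?t (2*(m-a))) + (\<Sum>a<m. ?t (2*a+1) * ?t (2*(m-1-a)+1))"
        proof -
          have "2*m - (2*a+1) = 2*(m-1-a)+1" if "a < m" for a using that by auto
          then show ?thesis unfolding sum_split_odd
            by (intro arg_cong2[of _ _ _ _ "(+)"] sum.cong refl) (auto simp: right_diff_distrib')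
        qed
        have "(\<Sum>s<2*m+1. ?t s * ?t (2*m - s) + ?t (2*m)) * even_trace_prod ks \<omega>
          = (\<Sum>a\<le>m. ?t (2*a) * ?t (2*(m-a)) * even_trace_prod ks \<omega>) + (\<Sum>a<m. ?t (2*a+1) * ?t (2*(m-1-a)+1) * even_trace_prod ks \<omega>)
            + real (2*m+1) * (?t (2*m) * even_trace_prod ks \<omega>)"
          unfolding sum.distrib 1 distrib_right sum_distrib_right by simp
        moreover have "merge (2*m+1) (map ((*) 2) ks) \<omega> \<le> 4 * real (sum_list ks) * (?t (2*m) * even_trace_prod ks \<omega>)"
          by (rule merge_even_le[OF w])
        ultimately show "(\<Sum>s<2*m+1. ?t s * ?t (2*m - s) + ?t (2*m)) * even_trace_prod ks \<omega> + merge (2*m+1) (map ((*) 2) ks) \<omega>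
          \<le> (\<Sum>a\<le>m. even_trace_prod (a # (m-a) # ks) \<omega>)
          + ((\<Sum>a<m. ?t (2*a+1) * ?t (2*(m-1-a)+1) * even_trace_prod ks \<omega>) + ?c * even_trace_prod (m # ks) \<omega>)"
          by (simp add: distrib_right mult.assoc)
      qed
      also have "\<dots> = (\<Sum>a\<le>m. avg \<Omega> (even_trace_prod (a # (m-a) # ks)))
          + ((\<Sum>a<m. avg \<Omega> (\<lambda>\<omega>. trace_pow r (G \<omega>) (2*a+1) * trace_pow r (G \<omega>) (2*(m-1-a)+1) * even_trace_prod ks \<omega>)) + ?c * avg \<Omega> (even_trace_prod (m # ks)))"
        unfolding avg_add avg_sum avg_cmult ..
      also have "\<dots> \<le> (\<Sum>a\<le>m. even_bound \<rho> (a # (m-a) # ks))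
          + ((\<Sum>a<m. q * (real r)\<^sup>2 * \<rho> ^ (a+(m-1-a)+1) * catalan (a+h) * catalan (m-1-a+h) * even_bound \<rho> ks) + ?c * even_bound \<rho> (m # ks))"
        using N by (intro add_mono sum_mono IHA IHB mult_left_mono) auto
      also have "(\<Sum>a\<le>m. even_bound \<rho> (a # (m-a) # ks)) = (real r)\<^sup>2 * \<rho> ^ m * even_bound \<rho> ks * (\<Sum>a\<le>m. catalan a * catalan (m-a))"
        unfolding sum_distrib_left
      proof (intro sum.cong refl)
        fix a assume "a \<in> {..m}"
        then have "\<rho> ^ m = \<rho> ^ a * \<rho> ^ (m-a)" by (simp flip: power_add)
        then show "even_bound \<rho> (a # (m-a) # ks) = (real r)\<^sup>2 * \<rho> ^ m * even_bound \<rho> ks * (catalan a * catalan (m-a))"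
          by (simp add: power2_eq_square)
      qed
      also have "(\<Sum>a\<le>m. catalan a * catalan (m-a)) = catalan (Suc m)" by (rule catalan_convolution)
      also have "(\<Sum>a<m. q * (real r)\<^sup>2 * \<rho> ^ (a+(m-1-a)+1) * catalan (a+h) * catalan (m-1-a+h) * even_bound \<rho> ks)
          = (real r)\<^sup>2 * \<rho> ^ m * even_bound \<rho> ks * (q * (\<Sum>a<m. catalan (a+h) * catalan (m-1-a+h)))"
        unfolding sum_distrib_left by (intro sum.cong refl) (auto simp: mult_ac)
      also have "(\<Sum>a<m. catalan (a+h) * catalan (m-1-a+h)) \<le> 4 ^ (2*h) * catalan (Suc m)"
      proof (cases m)
        case (Suc l)
        have "(\<Sum>a<m. catalan (a+h) * catalan (m-1-a+h)) \<le> 4 ^ (2*h) * catalan m"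
          using catalan_shift_shift_convolution[of h l] by (simp only: Suc lessThan_Suc_atMost) simp
        also have "\<dots> \<le> 4 ^ (2*h) * catalan (Suc m)" by (intro mult_left_mono catalan_le_Suc) simp
        finally show ?thesis .
      qed (simp add: cn)
      also have "?c * even_bound \<rho> (m # ks) \<le> (real r)\<^sup>2 * \<rho> ^ m * even_bound \<rho> ks * (4 * real P / real r * catalan (Suc m))"
      proof -
        have "?c \<le> 4 * real P" using NP N by simp
        then have "?c * catalan m \<le> 4 * real P * catalan (Suc m)" by (intro mult_mono catalan_le_Suc) (auto simp: cn)
        then have "(real r * \<rho> ^ m * even_bound \<rho> ks) * (?c * catalan m) \<le> (real r * \<rho> ^ m * even_bound \<rho> ks) * (4 * real P * catalan (Suc m))"
          using \<rho> PEn by (intro mult_left_mono) auto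
        then show ?thesis using rr by (simp add: power2_eq_square mult_ac)
      qed
      finally have "avg \<Omega> (even_trace_prod (k # ks)) \<le> (real r)\<^sup>2 * \<rho> ^ m * even_bound \<rho> ks * catalan (Suc m)
          + ((real r)\<^sup>2 * \<rho> ^ m * even_bound \<rho> ks * (q * (4 ^ (2*h) * catalan (Suc m)))
             + (real r)\<^sup>2 * \<rho> ^ m * even_bound \<rho> ks * (4 * real P / real r * catalan (Suc m)))"
        using \<rho> PEn q by (simp add: mult_left_mono del: even_trace_prod_simps)
      also have "\<dots> = (real r)\<^sup>2 * \<rho> ^ m * even_bound \<rho> ks * catalan (Suc m) * (1 + q * 4 ^ (2*h) + 4 * real P / real r)"
        by (simp add: algebra_simps)
      also have "\<dots> \<le> (real r)\<^sup>2 * \<rho> ^ m * even_bound \<rho> ks * catalan (Suc m) * \<kappa>"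
        using \<rho> PEn cn by (intro mult_left_mono c1 mult_nonneg_nonneg) auto
      also have "\<dots> = even_bound \<rho> (k # ks)" by (simp add: Suc \<rho>_def power2_eq_square mult_ac)
      finally show ?thesis .
    qed
  qed
  have B: "avg \<Omega> (\<lambda>\<omega>. trace_pow r (G \<omega>) (2*i+1) * trace_pow r (G \<omega>) (2*j+1) * even_trace_prod ks \<omega>)
      \<le> q * (real r)\<^sup>2 * \<rho> ^ (i+j+1) * catalan (i+h) * catalan (j+h) * even_bound \<rho> ks" if N: "i + j + 1 + sum_list ks = N" for i j ks
  proof -
    let ?Y = "(real r)\<^sup>2 * \<rho> ^ (i+j) * even_bound \<rho> ks * (catalan (i+h) * catalan (j+h))"
    have Y: "0 \<le> ?Y" using \<rho> PEn cn by (intro mult_nonneg_nonneg) auto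
    have "avg \<Omega> (\<lambda>\<omega>. trace_pow r (G \<omega>) (2*i+1) * trace_pow r (G \<omega>) (2*j+1) * even_trace_prod ks \<omega>)
        = avg \<Omega> (trace_prod (Suc (2*i) # (2*j+1) # map ((*) 2) ks))"
      by (intro avg_cong) (simp add: even_trace_prod_def mult.assoc)
    also have "\<dots> \<le> avg \<Omega> (\<lambda>\<omega>. (\<Sum>s<2*i. trace_pow r (G \<omega>) s * trace_pow r (G \<omega>) (2*i - 1 - s) + trace_pow r (G \<omega>) (2*i - 1))
          * (trace_pow r (G \<omega>) (2*j+1) * even_trace_prod ks \<omega>) + merge (2*i) ((2*j+1) # map ((*) 2) ks) \<omega>)"
      using trace_recursion[of "2*i" "(2*j+1) # map ((*) 2) ks"] by (simp add: even_trace_prod_def)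
    also have "\<dots> \<le> avg \<Omega> (\<lambda>\<omega>. 2 * (\<Sum>a<i. trace_pow r (G \<omega>) (2*(i-1-a)+1) * trace_pow r (G \<omega>) (2*j+1) * even_trace_prod (a # ks) \<omega>)
          + (real (2*i) * (trace_pow r (G \<omega>) (2*i-1) * trace_pow r (G \<omega>) (2*j+1) * even_trace_prod ks \<omega>)
          + (real (4*j+2) * even_trace_prod (i # j # ks) \<omega> + trace_pow r (G \<omega>) (2*j+1) * even_trace_prod [] \<omega> * merge (2*i) (map ((*) 2) ks) \<omega>)))"
    proof (rule avg_mono)
      fix \<omega> assume w: "\<omega> \<in> \<Omega>"
      let ?t = "trace_pow r (G \<omega>)"
      have 1: "(\<Sum>s<2*i. ?t s * ?t (2*i - 1 - s)) = 2 * (\<Sum>a<i. ?t (2*a) * ?t (2*(i-1-a)+1))"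
      proof -
        have "(\<Sum>a<i. ?t (2*a+1) * ?t (2*i - 1 - (2*a+1))) = (\<Sum>a<i. ?t (2*a) * ?t (2*(i-1-a)+1))"
          by (rule sum.reindex_bij_witness[where i = "\<lambda>a. i-1-a" and j = "\<lambda>a. i-1-a"])
            (auto simp: mult.commute right_diff_distrib' intro!: arg_cong2[of _ _ _ _ "(*)"] arg_cong[of _ _ ?t])
        moreover have "(\<Sum>a<i. ?t (2*a) * ?t (2*i - 1 - 2*a)) = (\<Sum>a<i. ?t (2*a) * ?t (2*(i-1-a)+1))"
          by (intro sum.cong refl arg_cong2[of _ _ _ _ "(*)"] arg_cong[of _ _ ?t]) auto
        ultimately show ?thesis unfolding sum_split_even by simp
      qed
      have "?t (2*i + 2*j) * even_trace_prod ks \<omega> \<le> ?t (2*i) * ?t (2*j) * even_trace_prod ks \<omega>"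
        by (intro mult_right_mono trace_pow_even_mult sym w even_trace_prod_nonneg)
      then have 2: "2 * real (2*j+1) * ?t (2*i + 2*j) * even_trace_prod ks \<omega> \<le> real (4*j+2) * even_trace_prod (i # j # ks) \<omega>"
        using mult_left_mono[of "?t (2*i + 2*j) * even_trace_prod ks \<omega>" "?t (2*i) * ?t (2*j) * even_trace_prod ks \<omega>" "real (4*j+2)"]
        by (simp add: mult_ac)
      have "(\<Sum>s<2*i. ?t s * ?t (2*i - 1 - s) + ?t (2*i - 1)) * (?t (2*j+1) * even_trace_prod ks \<omega>)
        = 2 * (\<Sum>a<i. ?t (2*(i-1-a)+1) * ?t (2*j+1) * even_trace_prod (a # ks) \<omega>) + real (2*i) * (?t (2*i-1) * ?t (2*j+1) * even_trace_prod ks \<omega>)"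
        unfolding sum.distrib 1 by (simp add: sum_distrib_right sum_distrib_left algebra_simps)
      moreover have "merge (2*i) ((2*j+1) # map ((*) 2) ks) \<omega>
         = 2 * real (2*j+1) * ?t (2*i + 2*j) * even_trace_prod ks \<omega> + ?t (2*j+1) * even_trace_prod [] \<omega> * merge (2*i) (map ((*) 2) ks) \<omega>"
        by (simp add: even_trace_prod_def)
      ultimately show "(\<Sum>s<2*i. ?t s * ?t (2*i - 1 - s) + ?t (2*i - 1))
          * (?t (2*j+1) * even_trace_prod ks \<omega>) + merge (2*i) ((2*j+1) # map ((*) 2) ks) \<omega>
        \<le> 2 * (\<Sum>a<i. ?t (2*(i-1-a)+1) * ?t (2*j+1) * even_trace_prod (a # ks) \<omega>)
          + (real (2*i) * (?t (2*i-1) * ?t (2*j+1) * even_trace_prod ks \<omega>)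
          + (real (4*j+2) * even_trace_prod (i # j # ks) \<omega> + ?t (2*j+1) * even_trace_prod [] \<omega> * merge (2*i) (map ((*) 2) ks) \<omega>))"
        using 2 by linarith
    qed
    also have "\<dots> = 2 * (\<Sum>a<i. avg \<Omega> (\<lambda>\<omega>. trace_pow r (G \<omega>) (2*(i-1-a)+1) * trace_pow r (G \<omega>) (2*j+1) * even_trace_prod (a # ks) \<omega>))
          + (real (2*i) * avg \<Omega> (\<lambda>\<omega>. trace_pow r (G \<omega>) (2*i-1) * trace_pow r (G \<omega>) (2*j+1) * even_trace_prod ks \<omega>)
          + (real (4*j+2) * avg \<Omega> (even_trace_prod (i # j # ks)) + avg \<Omega> (\<lambda>\<omega>. trace_pow r (G \<omega>) (2*j+1) * even_trace_prod [] \<omega> * merge (2*i) (map ((*) 2) ks) \<omega>)))"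
      unfolding avg_add avg_sum avg_cmult ..
    also have "\<dots> \<le> q * (real r) * ?Y * (1 + central_ratio h) + (real (2*i) * (q * ?Y)
       + (real (4*j+2) * ?Y + 10 * real (sum_list ks) * ?Y))"
    proof (intro add_mono)
      have "2 * (\<Sum>a<i. avg \<Omega> (\<lambda>\<omega>. trace_pow r (G \<omega>) (2*(i-1-a)+1) * trace_pow r (G \<omega>) (2*j+1) * even_trace_prod (a # ks) \<omega>))
         \<le> 2 * (\<Sum>a<i. q * (real r)\<^sup>2 * \<rho> ^ (i-1-a+j+1) * catalan (i-1-a+h) * catalan (j+h) * even_bound \<rho> (a # ks))"
        using N by (intro mult_left_mono sum_mono IHB) auto
      also have "(\<Sum>a<i. q * (real r)\<^sup>2 * \<rho> ^ (i-1-a+j+1) * catalan (i-1-a+h) * catalan (j+h) * even_bound \<rho> (a # ks))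
         = (\<Sum>a<i. q * (real r * (real r)\<^sup>2) * \<rho> ^ (i+j) * catalan (j+h) * even_bound \<rho> ks * (catalan a * catalan (i-1-a+h)))"
      proof (intro sum.cong refl)
        fix a assume "a \<in> {..<i}"
        then have "i + j = (i-1-a+j+1) + a" by auto
        then have "\<rho> ^ (i+j) = \<rho> ^ (i-1-a+j+1) * \<rho> ^ a" by (metis power_add)
        then show "q * (real r)\<^sup>2 * \<rho> ^ (i-1-a+j+1) * catalan (i-1-a+h) * catalan (j+h) * even_bound \<rho> (a # ks)
          = q * (real r * (real r)\<^sup>2) * \<rho> ^ (i+j) * catalan (j+h) * even_bound \<rho> ks * (catalan a * catalan (i-1-a+h))"
          by (simp only: even_bound_simps mult_ac)
      qed
      also have "2 * \<dots> = q * (real r * (real r)\<^sup>2) * \<rho> ^ (i+j) * catalan (j+h) * even_bound \<rho> ks * (2 * (\<Sum>a<i. catalan a * catalan (i-1-a+h)))"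
        by (simp only: sum_distrib_left mult_ac)
      also have "\<dots> \<le> q * (real r * (real r)\<^sup>2) * \<rho> ^ (i+j) * catalan (j+h) * even_bound \<rho> ks * ((1 + central_ratio h) * catalan (i+h))"
        using q \<rho> PEn cn by (intro mult_left_mono catalan_shift_convolution mult_nonneg_nonneg) auto
      finally show "2 * (\<Sum>a<i. avg \<Omega> (\<lambda>\<omega>. trace_pow r (G \<omega>) (2*(i-1-a)+1) * trace_pow r (G \<omega>) (2*j+1) * even_trace_prod (a # ks) \<omega>))
         \<le> q * (real r) * ?Y * (1 + central_ratio h)" by (simp only: mult_ac)
    next
      show "real (2*i) * avg \<Omega> (\<lambda>\<omega>. trace_pow r (G \<omega>) (2*i-1) * trace_pow r (G \<omega>) (2*j+1) * even_trace_prod ks \<omega>) \<le> real (2*i) * (q * ?Y)"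
      \<comment> \<open>For \<open>i = 0\<close> the exponent \<open>2*i - 1\<close> is truncated,
        but the term carries the factor \<open>2*i\<close>.\<close>
      proof (cases i)
        case (Suc l)
        have "avg \<Omega> (\<lambda>\<omega>. trace_pow r (G \<omega>) (2*l+1) * trace_pow r (G \<omega>) (2*j+1) * even_trace_prod ks \<omega>)
          \<le> q * (real r)\<^sup>2 * \<rho> ^ (l+j+1) * catalan (l+h) * catalan (j+h) * even_bound \<rho> ks"
          using N Suc by (intro IHB) auto
        also have "\<dots> = (q * (real r)\<^sup>2 * \<rho> ^ (i+j) * catalan (j+h) * even_bound \<rho> ks) * catalan (l+h)"
          by (simp add: Suc)
        also have "\<dots> \<le> (q * (real r)\<^sup>2 * \<rho> ^ (i+j) * catalan (j+h) * even_bound \<rho> ks) * catalan (i+h)"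
          using q \<rho> PEn cn Suc by (intro mult_left_mono catalan_mono mult_nonneg_nonneg) auto
        finally show ?thesis using Suc by (intro mult_left_mono) (auto simp: mult_ac)
      qed simp
    next
      have cc: "(real r)\<^sup>2 * \<rho> ^ (i+j) * even_bound \<rho> ks * (catalan i * catalan j) \<le> ?Y"
        using \<rho> PEn cn by (intro mult_left_mono mult_mono catalan_mono mult_nonneg_nonneg) auto
      have "avg \<Omega> (even_trace_prod (i # j # ks)) \<le> even_bound \<rho> (i # j # ks)" using N by (intro IHA) auto
      also have "\<dots> = (real r)\<^sup>2 * \<rho> ^ (i+j) * even_bound \<rho> ks * (catalan i * catalan j)"
        by (simp add: power2_eq_square power_add mult_ac)
      finally have "avg \<Omega> (even_trace_prod (i # j # ks)) \<le> ?Y" using cc by linarith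
      then show "real (4*j+2) * avg \<Omega> (even_trace_prod (i # j # ks)) \<le> real (4*j+2) * ?Y"
        by (intro mult_left_mono) auto
      have "avg \<Omega> (\<lambda>\<omega>. trace_pow r (G \<omega>) (2*j+1) * even_trace_prod [] \<omega> * merge (2*i) (map ((*) 2) ks) \<omega>)
        \<le> 10 * real (sum_list ks) * ((real r)\<^sup>2 * \<rho> ^ (i+j) * catalan i * catalan j * even_bound \<rho> ([] @ ks))"
        using N by (intro merge_odd_le[OF IHA \<rho>]) auto
      also have "\<dots> = 10 * real (sum_list ks) * ((real r)\<^sup>2 * \<rho> ^ (i+j) * even_bound \<rho> ks * (catalan i * catalan j))"
        by (simp add: mult_ac)
      also have "\<dots> \<le> 10 * real (sum_list ks) * ?Y" by (rule mult_left_mono[OF cc]) simp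
      finally show "avg \<Omega> (\<lambda>\<omega>. trace_pow r (G \<omega>) (2*j+1) * even_trace_prod [] \<omega> * merge (2*i) (map ((*) 2) ks) \<omega>) \<le> 10 * real (sum_list ks) * ?Y" .
    qed
    also have "\<dots> = ?Y * (q * real r * (1 + central_ratio h) + real (2*i) * q + (real (4*j+2) + 10 * real (sum_list ks)))"
      by (simp add: algebra_simps)
    also have "\<dots> \<le> ?Y * (q * real r * \<kappa>)"
    proof (rule mult_left_mono[OF _ Y])
      have "real (2*i) * q \<le> real (2*i) * 1" using q by (intro mult_left_mono) auto
      then have "real (2*i) * q + (real (4*j+2) + 10 * real (sum_list ks)) \<le> 10 * real P"
        using N less.prems by simp
      moreover have "(real r * q) * (1 + central_ratio h + 10 * real P / (real r * q)) \<le> (real r * q) * \<kappa>"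
        using c2 rr q by (intro mult_left_mono) auto
      moreover have "(real r * q) * (1 + central_ratio h + 10 * real P / (real r * q)) = q * real r * (1 + central_ratio h) + 10 * real P"
        using rr q by (simp add: field_simps)
      ultimately show "q * real r * (1 + central_ratio h) + real (2*i) * q + (real (4*j+2) + 10 * real (sum_list ks)) \<le> q * real r * \<kappa>"
        by (simp add: mult_ac)
    qed
    also have "\<dots> = q * (real r)\<^sup>2 * \<rho> ^ (i+j+1) * catalan (i+h) * catalan (j+h) * even_bound \<rho> ks"
      by (simp add: \<rho>_def mult_ac)
    finally show ?thesis .
  qed
  from A B show ?case by blast
qed

text \<open>The constants only depend on \<open>\<kappa>\<close>: first \<open>h\<close> is chosen so that \<open>central_ratio h\<close> is small, then \<open>q\<close>, then \<open>c\<close>.\<close>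

lemma even_trace_bound:
  fixes \<kappa> q :: real and h P :: nat
  assumes "0 < q" "q \<le> 1" "0 \<le> \<kappa>"
    and "1 + q * 4 ^ (2*h) + 4 * real P / real r \<le> \<kappa>"
    and "1 + central_ratio h + 10 * real P / (real r * q) \<le> \<kappa>"
  shows "avg \<Omega> (\<lambda>\<omega>. trace_pow r (G \<omega>) (2 * P)) \<le> real r * (4 * \<kappa> * real r) ^ P"
proof -
  have "avg \<Omega> (\<lambda>\<omega>. trace_pow r (G \<omega>) (2 * P)) = avg \<Omega> (even_trace_prod [P])" by (intro avg_cong) simp
  also have "\<dots> \<le> even_bound (\<kappa> * real r) [P]"
    using conjunct1[OF trace_product_bounds[OF assms order_refl], rule_format, of "[P]"] by (simp del: even_trace_prod_simps)
  also have "\<dots> \<le> real r * (\<kappa> * real r) ^ P * 4 ^ P"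
    using assms(3) catalan_le_power[of P] by (simp add: mult_left_mono)
  finally show ?thesis by (simp add: power_mult_distrib mult_ac)
qed

end

lemma wick_trace_bound:
  fixes \<kappa> :: real
  assumes "1 < \<kappa>"
  obtains c where "0 < c" "\<And>\<Omega> r (G :: 'w \<Rightarrow> nat \<Rightarrow> nat \<Rightarrow> real) P. wick \<Omega> r G \<Longrightarrow> real P \<le> c * real r \<Longrightarrow>
     avg \<Omega> (\<lambda>\<omega>. trace_pow r (G \<omega>) (2 * P)) \<le> real r * (4 * \<kappa> * real r) ^ P"
proof -
  define e where "e = (\<kappa> - 1) / 2"
  have e: "0 < e" using assms by (simp add: e_def)
  obtain h where h: "central_ratio h < e"
    using order_tendstoD(2)[OF central_ratio_tendsto_0 e] by (auto simp: eventually_sequentially)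
  define q where "q = min 1 (e / 4 ^ (2*h))"
  have q: "0 < q" "q \<le> 1" "q * 4 ^ (2*h) \<le> e" using e by (auto simp: q_def min_def field_simps)
  \<comment> \<open>With \<open>real P <= c * real r\<close> this makes
    \<open>10 * P / (r * q)\<close> at most \<open>e\<close>, and \<open>4 * P / r\<close> is no
    larger.\<close>
  define c where "c = q * e / 10"
  have c: "0 < c" using q e by (simp add: c_def)
  show thesis
  proof (rule that[OF c])
    fix \<Omega> :: "'w set" and r G P assume w: "wick \<Omega> r G" and P: "real P \<le> c * real r"
    interpret wick \<Omega> r G by (rule w)
    have r: "0 < real r" using r_pos by simp
    have "10 * real P / (real r * q) \<le> e" using P r q(1) by (simp add: c_def field_simps)
    moreover have "4 * real P / real r \<le> 10 * real P / (real r * q)"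
      using r q by (intro frac_le mult_mono) (auto simp: mult_left_le)
    moreover have "\<kappa> = 1 + 2 * e" by (simp add: e_def field_simps)
    ultimately show "avg \<Omega> (\<lambda>\<omega>. trace_pow r (G \<omega>) (2 * P)) \<le> real r * (4 * \<kappa> * real r) ^ P"
      using q h e by (intro even_trace_bound[of q _ h]) linarith+
  qed
qed

subsection \<open>Random symmetric matrices with independent entries on a finite sample space\<close>

definition edges :: "nat \<Rightarrow> (nat \<times> nat) set" where
  "edges r = {(i, j). i \<le> j \<and> j < r}"

definition sort_pair :: "nat \<times> nat \<Rightarrow> nat \<times> nat" where
  "sort_pair e = (min (fst e) (snd e), max (fst e) (snd e))"

definition samples :: "nat \<Rightarrow> 'o set \<Rightarrow> (nat \<times> nat \<Rightarrow> 'o) set" where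
  "samples r S = PiE (edges r) (\<lambda>_. S)"

definition rmat :: "('o \<Rightarrow> real) \<Rightarrow> (nat \<times> nat \<Rightarrow> 'o) \<Rightarrow> nat \<Rightarrow> nat \<Rightarrow> real" where
  "rmat g \<omega> i j = g (\<omega> (sort_pair (i, j)))"

lemma finite_edges [simp]: "finite (edges r)"
  by (rule finite_subset[of _ "{..<r} \<times> {..<r}"]) (auto simp: edges_def)

lemma sort_pair_eqD: "sort_pair (x, y) = sort_pair (i, j) \<Longrightarrow> (x = i \<and> y = j) \<or> (x = j \<and> y = i)"
  by (cases "x \<le> y"; cases "i \<le> j") (simp_all add: sort_pair_def)

lemma edge_delta_ge_1: "sort_pair (x, y) = sort_pair (i, j) \<Longrightarrow> 1 \<le> edge_delta i j x y"
  by (drule sort_pair_eqD) (elim disjE, simp_all add: edge_delta_def)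

lemma edge_delta_nonneg: "0 \<le> edge_delta i j x y"
  unfolding edge_delta_def by (intro add_nonneg_nonneg) simp_all

lemma sort_pair_in_edges: "i < r \<Longrightarrow> j < r \<Longrightarrow> sort_pair (i, j) \<in> edges r"
  by (auto simp: sort_pair_def edges_def)

lemma sort_pair_set: "set ws \<subseteq> {..<r} \<times> {..<r} \<Longrightarrow> set (map sort_pair ws) \<subseteq> edges r"
  by (force simp: sort_pair_in_edges)

lemma sym_mat_rmat: "sym_mat r (rmat g \<omega>)"
  by (simp add: sym_mat_def rmat_def sort_pair_def min.commute max.commute)

lemma finite_samples: "finite S \<Longrightarrow> finite (samples r S)"
  unfolding samples_def by (intro finite_PiE) auto

lemma samples_nonempty: "S \<noteq> {} \<Longrightarrow> samples r S \<noteq> {}"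
  unfolding samples_def by (simp add: PiE_eq_empty_iff)

lemma avg_prod:
  assumes "finite S"
  shows "avg (samples r S) (\<lambda>\<omega>. \<Prod>e\<in>edges r. F e (\<omega> e)) = (\<Prod>e\<in>edges r. avg S (F e))"
proof -
  have "(\<Sum>\<omega>\<in>samples r S. \<Prod>e\<in>edges r. F e (\<omega> e)) = (\<Prod>e\<in>edges r. \<Sum>x\<in>S. F e x)"
    unfolding samples_def by (rule prod_sum_PiE[symmetric]) (use assms in auto)
  moreover have "real (card (samples r S)) = (\<Prod>e\<in>edges r. real (card S))"
    unfolding samples_def by (simp add: card_PiE)
  ultimately show ?thesis unfolding avg_def by (simp add: prod_dividef)
qed

lemma prod_list_count:
  fixes f :: "'b \<Rightarrow> real"
  assumes "set es \<subseteq> E" "finite E"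
  shows "(\<Prod>e\<leftarrow>es. f e) = (\<Prod>e\<in>E. f e ^ count_list es e)"
  using assms(1)
proof (induction es)
  case (Cons a es)
  have "(\<Prod>e\<in>E. f e ^ count_list (a # es) e) = (\<Prod>e\<in>E. (if e = a then f a else 1) * f e ^ count_list es e)"
    by (intro prod.cong) auto
  then show ?case using Cons assms(2) by (simp add: prod.distrib)
qed simp

lemma monomial_rmat: "monomial (rmat g \<omega>) ws = (\<Prod>e\<leftarrow>map sort_pair ws. g (\<omega> e))"
  by (induction ws) (auto simp: monomial_def rmat_def)

definition moment_prod :: "nat \<Rightarrow> (nat \<Rightarrow> real) \<Rightarrow> (nat \<times> nat) list \<Rightarrow> real" where
  "moment_prod r m es = (\<Prod>e\<in>edges r. m (count_list es e))"

lemma avg_monomial_rmat: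
  assumes "finite S" "set ws \<subseteq> {..<r} \<times> {..<r}"
  shows "avg (samples r S) (\<lambda>\<omega>. monomial (rmat g \<omega>) ws) = moment_prod r (\<lambda>k. avg S (\<lambda>x. g x ^ k)) (map sort_pair ws)"
proof -
  have "avg (samples r S) (\<lambda>\<omega>. monomial (rmat g \<omega>) ws)
    = avg (samples r S) (\<lambda>\<omega>. \<Prod>e\<in>edges r. (\<lambda>e x. g x ^ count_list (map sort_pair ws) e) e (\<omega> e))"
    unfolding monomial_rmat using prod_list_count[OF sort_pair_set[OF assms(2)] finite_edges] by (intro avg_cong) simp
  also have "\<dots> = moment_prod r (\<lambda>k. avg S (\<lambda>x. g x ^ k)) (map sort_pair ws)"
    unfolding moment_prod_def by (rule avg_prod[OF assms(1)])
  finally show ?thesis .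
qed

text \<open>By independence the matrix inequality reduces to \<open>m (k+1) <= k * m (k-1)\<close>
  for the moments of a single entry, which is an equality for a standard Gaussian. Non-negative
  moments allow the factors of the other entries to be carried along.\<close>

lemma wick_rmat:
  fixes g :: "'o \<Rightarrow> real" and S :: "'o set"
  defines "m \<equiv> \<lambda>k. avg S (\<lambda>x. g x ^ k)"
  assumes S: "finite S" "S \<noteq> {}" and r: "0 < r"
    and m: "\<And>k. m (Suc k) \<le> real k * m (k - 1)" and m0: "\<And>k. 0 \<le> m k"
  shows "wick (samples r S) r (rmat g)"
proof
  fix i j ws assume ij: "i < r" "j < r" and ws: "set ws \<subseteq> {..<r} \<times> {..<r}"
  define e0 where "e0 = sort_pair (i, j)"
  \<comment> \<open>The expectation of the word after one occurrence of \<open>e0\<close> has been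
    deleted; where the subtraction truncates, \<open>Q\<close> enters with the factor 0.\<close>
  define Q where "Q es = m (count_list es e0 - 1) * (\<Prod>e\<in>edges r - {e0}. m (count_list es e))" for es
  have e0: "e0 \<in> edges r" unfolding e0_def by (rule sort_pair_in_edges[OF ij])
  have Q0: "0 \<le> Q es" for es unfolding Q_def by (intro mult_nonneg_nonneg prod_nonneg m0)
  have moment_prod_rem: "moment_prod r m es = m (count_list es e0) * (\<Prod>e\<in>edges r - {e0}. m (count_list es e))" for es
    unfolding moment_prod_def using e0 by (simp add: prod.remove)
  \<comment> \<open>Each occurrence of \<open>e0\<close> contributes a summand of the derivative
    whose expectation is at least \<open>Q\<close>; \<open>vs\<close> is the prefix already passed
    by the product rule.\<close>
  have d: "real (count_list (map sort_pair ws) e0) * Q (map sort_pair (vs @ ws))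
       \<le> avg (samples r S) (\<lambda>\<omega>. monomial (rmat g \<omega>) vs * monomial_deriv (rmat g \<omega>) i j ws)"
    if "set vs \<subseteq> {..<r} \<times> {..<r}" "set ws \<subseteq> {..<r} \<times> {..<r}" for vs ws
    using that
  proof (induction ws arbitrary: vs)
    case Nil
    then show ?case by (simp add: avg_def)
  next
    case (Cons w ws)
    obtain x y where w: "w = (x, y)" by force
    have sets: "set (vs @ [w]) \<subseteq> {..<r} \<times> {..<r}" "set (vs @ ws) \<subseteq> {..<r} \<times> {..<r}" "set ws \<subseteq> {..<r} \<times> {..<r}"
      using Cons.prems by auto
    have 1: "(if sort_pair w = e0 then Q (map sort_pair (vs @ w # ws)) else 0) \<le> edge_delta i j x y * avg (samples r S) (\<lambda>\<omega>. monomial (rmat g \<omega>) (vs @ ws))"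
    proof (cases "sort_pair w = e0")
      case True
      then have edge_delta: "1 \<le> edge_delta i j x y" unfolding w e0_def by (rule edge_delta_ge_1)
      have c: "count_list (map sort_pair (vs @ w # ws)) e = (if e = e0 then Suc (count_list (map sort_pair (vs @ ws)) e) else count_list (map sort_pair (vs @ ws)) e)" for e
        using True by auto
      have "Q (map sort_pair (vs @ w # ws)) = moment_prod r m (map sort_pair (vs @ ws))"
        unfolding Q_def moment_prod_rem c by simp
      also have "\<dots> = avg (samples r S) (\<lambda>\<omega>. monomial (rmat g \<omega>) (vs @ ws))"
        unfolding m_def by (rule avg_monomial_rmat[OF S(1) sets(2), symmetric])
      finally have eq: "Q (map sort_pair (vs @ w # ws)) = avg (samples r S) (\<lambda>\<omega>. monomial (rmat g \<omega>) (vs @ ws))" .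
      show ?thesis using mult_right_mono[OF edge_delta Q0[of "map sort_pair (vs @ w # ws)"]] True unfolding eq by simp
    next
      case False
      have "0 \<le> avg (samples r S) (\<lambda>\<omega>. monomial (rmat g \<omega>) (vs @ ws))"
        unfolding avg_monomial_rmat[OF S(1) sets(2)] m_def[symmetric] moment_prod_def by (intro prod_nonneg m0)
      then show ?thesis using False edge_delta_nonneg[of i j x y] by (simp add: mult_nonneg_nonneg)
    qed
    have 2: "real (count_list (map sort_pair ws) e0) * Q (map sort_pair (vs @ w # ws))
       \<le> avg (samples r S) (\<lambda>\<omega>. monomial (rmat g \<omega>) (vs @ [w]) * monomial_deriv (rmat g \<omega>) i j ws)"
      using Cons.IH[OF sets(1,3)] by simp
    have "real (count_list (map sort_pair (w # ws)) e0) * Q (map sort_pair (vs @ w # ws))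
       = (if sort_pair w = e0 then Q (map sort_pair (vs @ w # ws)) else 0) + real (count_list (map sort_pair ws) e0) * Q (map sort_pair (vs @ w # ws))"
      by (simp add: algebra_simps)
    also have "\<dots> \<le> edge_delta i j x y * avg (samples r S) (\<lambda>\<omega>. monomial (rmat g \<omega>) (vs @ ws))
       + avg (samples r S) (\<lambda>\<omega>. monomial (rmat g \<omega>) (vs @ [w]) * monomial_deriv (rmat g \<omega>) i j ws)"
      by (intro add_mono 1 2)
    also have "\<dots> = avg (samples r S) (\<lambda>\<omega>. monomial (rmat g \<omega>) vs * monomial_deriv (rmat g \<omega>) i j (w # ws))"
      unfolding avg_cmult[symmetric] avg_add[symmetric] by (intro avg_cong) (simp add: w algebra_simps)
    finally show ?case .
  qed
  have "avg (samples r S) (\<lambda>\<omega>. rmat g \<omega> i j * monomial (rmat g \<omega>) ws) = avg (samples r S) (\<lambda>\<omega>. monomial (rmat g \<omega>) ((i, j) # ws))"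
    by simp
  also have "\<dots> = moment_prod r m (map sort_pair ((i, j) # ws))"
    unfolding m_def using ij ws by (intro avg_monomial_rmat S) auto
  also have "\<dots> = m (Suc (count_list (map sort_pair ws) e0)) * (\<Prod>e\<in>edges r - {e0}. m (count_list (map sort_pair ws) e))"
    unfolding moment_prod_rem list.map e0_def[symmetric]
    by (intro arg_cong2[of _ _ _ _ "(*)"] prod.cong refl) auto
  also have "\<dots> \<le> real (count_list (map sort_pair ws) e0) * m (count_list (map sort_pair ws) e0 - 1) * (\<Prod>e\<in>edges r - {e0}. m (count_list (map sort_pair ws) e))"
    by (intro mult_right_mono m prod_nonneg m0)
  also have "\<dots> = real (count_list (map sort_pair ws) e0) * Q (map sort_pair ([] @ ws))"
    by (simp add: Q_def)
  also have "\<dots> \<le> avg (samples r S) (\<lambda>\<omega>. monomial (rmat g \<omega>) [] * monomial_deriv (rmat g \<omega>) i j ws)"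
    by (rule d) (use ws in auto)
  finally show "avg (samples r S) (\<lambda>\<omega>. rmat g \<omega> i j * monomial (rmat g \<omega>) ws) \<le> avg (samples r S) (\<lambda>\<omega>. monomial_deriv (rmat g \<omega>) i j ws)"
    by simp
qed (use finite_samples[OF S(1)] samples_nonempty[OF S(2)] sym_mat_rmat r in auto)

subsection \<open>The comparison variable\<close>

lemma avg_Times: "avg (A \<times> B) (\<lambda>z. f (fst z) * h (snd z)) = avg A f * avg B h"
proof -
  have "(\<Sum>z\<in>A \<times> B. f (fst z) * h (snd z)) = (\<Sum>x\<in>A. \<Sum>y\<in>B. f x * h y)"
    by (simp add: sum.cartesian_product case_prod_beta)
  then show ?thesis unfolding avg_def by (simp add: card_cartesian_product sum_product)
qed

lemma avg_image: "inj_on f A \<Longrightarrow> avg (f ` A) h = avg A (\<lambda>x. h (f x))"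
  unfolding avg_def by (simp add: sum.reindex card_image)

abbreviation pm :: "real set" where "pm \<equiv> {-1, 1}"

definition sign_lists :: "nat \<Rightarrow> real list set" where
  "sign_lists N = {xs. set xs \<subseteq> pm \<and> length xs = N}"

definition sign_sum_moment :: "nat \<Rightarrow> nat \<Rightarrow> real" where
  "sign_sum_moment N k = avg (sign_lists N) (\<lambda>xs. sum_list xs ^ k)"

definition sign_moment :: "nat \<Rightarrow> real" where
  "sign_moment k = (if even k then 1 else 0)"

lemma avg_pm: "avg pm (\<lambda>x. x ^ k) = sign_moment k"
  by (auto simp: avg_def sign_moment_def)

lemma finite_sign_lists: "finite (sign_lists N)" unfolding sign_lists_def by (rule finite_lists_length_eq) simp

lemma sign_lists_nonempty: "sign_lists N \<noteq> {}"
proof -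
  have "replicate N 1 \<in> sign_lists N" by (auto simp: sign_lists_def)
  then show ?thesis by blast
qed

lemma binomial_expectation:
  "avg (A \<times> B) (\<lambda>z. (f (fst z) + h (snd z)) ^ k)
    = (\<Sum>j\<le>k. real (k choose j) * (avg A (\<lambda>x. f x ^ j) * avg B (\<lambda>y. h y ^ (k - j))))"
  unfolding binomial_ring avg_sum
  by (intro sum.cong refl) (simp add: mult.assoc avg_cmult avg_Times[of A B "\<lambda>x. f x ^ _" "\<lambda>y. h y ^ _"])

lemma sign_sum_moment_Suc: "sign_sum_moment (Suc N) k = (\<Sum>j\<le>k. real (k choose j) * (sign_sum_moment N j * sign_moment (k - j)))"
proof -
  have inj: "inj_on (\<lambda>(xs, n). n # xs) (sign_lists N \<times> pm)" by (auto simp: inj_on_def)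
  have "sign_lists (Suc N) = (\<lambda>(xs, n). n # xs) ` (sign_lists N \<times> pm)"
    unfolding sign_lists_def by (rule lists_length_Suc_eq)
  then have "sign_sum_moment (Suc N) k = avg (sign_lists N \<times> pm) (\<lambda>z. (sum_list (fst z) + snd z) ^ k)"
    unfolding sign_sum_moment_def by (simp only: avg_image[OF inj]) (simp add: case_prod_beta add.commute)
  then show ?thesis
    unfolding binomial_expectation[of _ _ sum_list "\<lambda>x. x"] avg_pm sign_sum_moment_def .
qed

lemma sign_sum_moment_0: "sign_sum_moment 0 k = (if k = 0 then 1 else 0)"
  by (auto simp: sign_sum_moment_def sign_lists_def avg_def power_0_left)

lemma sign_sum_moment_nonneg: "0 \<le> sign_sum_moment N k"
proof (induction N arbitrary: k)
  case (Suc N)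
  then show ?case unfolding sign_sum_moment_Suc by (intro sum_nonneg mult_nonneg_nonneg) (auto simp: sign_moment_def)
qed (simp add: sign_sum_moment_0)

text \<open>The inequality \<open>E x\<^sup>k\<^sup>+\<^sup>1 \<le> v k E x\<^sup>k\<^sup>-\<^sup>1\<close> is additive in \<open>v\<close> under independent sums.\<close>

lemma binomial_moment_step:
  fixes m m' :: "nat \<Rightarrow> real"
  assumes m: "\<And>j. m (Suc j) \<le> v * real j * m (j - 1)" and m': "\<And>j. 0 \<le> m' j"
  shows "(\<Sum>j\<le>k. real (k choose j) * (m (Suc j) * m' (k - j)))
    \<le> v * real k * (\<Sum>j\<le>k-1. real ((k-1) choose j) * (m j * m' (k - 1 - j)))"
proof (cases k)
  case 0
  then show ?thesis using m[of 0] m'[of 0] by (simp add: mult_nonpos_nonneg)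
next
  case (Suc l)
  have "(\<Sum>j\<le>k. real (k choose j) * (m (Suc j) * m' (k - j)))
    \<le> (\<Sum>j\<le>k. real (k choose j) * (v * real j * m (j - 1) * m' (k - j)))"
    by (intro sum_mono mult_left_mono mult_right_mono m m') auto
  also have "\<dots> = (\<Sum>j\<le>l. real (k choose Suc j) * (v * real (Suc j) * m j * m' (l - j)))"
    unfolding Suc by (subst sum.atMost_Suc_shift) simp
  also have "\<dots> = (\<Sum>j\<le>l. v * real k * (real (l choose j) * (m j * m' (l - j))))"
  proof (intro sum.cong refl)
    fix j
    have "real (k choose Suc j) * real (Suc j) = real k * real (l choose j)"
      using Suc_times_binomial_eq[of l j] Suc by (metis of_nat_mult)
    then show "real (k choose Suc j) * (v * real (Suc j) * m j * m' (l - j))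
      = v * real k * (real (l choose j) * (m j * m' (l - j)))"
      by (metis (no_types, lifting) mult.assoc mult.commute)
  qed
  finally show ?thesis by (simp add: Suc sum_distrib_left)
qed

lemma binomial_Suc_expansion:
  fixes m m' :: "nat \<Rightarrow> real"
  shows "(\<Sum>j\<le>Suc k. real (Suc k choose j) * (m j * m' (Suc k - j)))
    = (\<Sum>j\<le>k. real (k choose j) * (m (Suc j) * m' (k - j))) + (\<Sum>j\<le>k. real (k choose j) * (m j * m' (Suc (k - j))))"
proof -
  have "(\<Sum>j\<le>Suc k. real (Suc k choose j) * (m j * m' (Suc k - j)))
    = m 0 * m' (Suc k) + (\<Sum>j\<le>k. real (k choose Suc j) * (m (Suc j) * m' (k - j)))
      + (\<Sum>j\<le>k. real (k choose j) * (m (Suc j) * m' (k - j)))"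
    by (subst sum.atMost_Suc_shift) (simp add: distrib_right sum.distrib)
  moreover have "m 0 * m' (Suc k) + (\<Sum>j\<le>k. real (k choose Suc j) * (m (Suc j) * m' (k - j)))
     = (\<Sum>j\<le>Suc k. real (k choose j) * (m j * m' (Suc k - j)))"
    by (subst sum.atMost_Suc_shift) simp
  moreover have "(\<Sum>j\<le>Suc k. real (k choose j) * (m j * m' (Suc k - j))) = (\<Sum>j\<le>k. real (k choose j) * (m j * m' (Suc (k - j))))"
    by (simp add: Suc_diff_le)
  ultimately show ?thesis by simp
qed

lemma binomial_sum_flip:
  fixes f g :: "nat \<Rightarrow> real"
  shows "(\<Sum>j\<le>l. real (l choose j) * (f j * g (l - j))) = (\<Sum>j\<le>l. real (l choose j) * (g j * f (l - j)))"
  by (rule sum.reindex_bij_witness[where i = "\<lambda>j. l - j" and j = "\<lambda>j. l - j"])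
    (auto simp: binomial_symmetric[symmetric] mult.commute)

lemma sign_moment_Suc_le: "sign_moment (Suc j) \<le> 1 * real j * sign_moment (j - 1)"
  by (cases j) (auto simp: sign_moment_def)

lemma sign_sum_moment_Suc_le: "sign_sum_moment N (Suc k) \<le> real N * real k * sign_sum_moment N (k - 1)"
proof (induction N arbitrary: k)
  case 0
  then show ?case by (simp add: sign_sum_moment_0)
next
  case (Suc N)
  have p0: "0 \<le> sign_moment j" for j by (simp add: sign_moment_def)
  have 2: "(\<Sum>j\<le>k. real (k choose j) * (sign_sum_moment N j * sign_moment (Suc (k - j)))) \<le> 1 * real k * sign_sum_moment (Suc N) (k - 1)"
  proof -
    have "(\<Sum>j\<le>k. real (k choose j) * (sign_sum_moment N j * sign_moment (Suc (k - j))))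
       = (\<Sum>j\<le>k. real (k choose j) * (sign_moment (Suc j) * sign_sum_moment N (k - j)))"
      using binomial_sum_flip[of k "sign_sum_moment N" "\<lambda>j. sign_moment (Suc j)"] by simp
    also have "\<dots> \<le> 1 * real k * (\<Sum>j\<le>k-1. real ((k-1) choose j) * (sign_moment j * sign_sum_moment N (k - 1 - j)))"
      by (rule binomial_moment_step) (use sign_moment_Suc_le sign_sum_moment_nonneg in auto)
    also have "(\<Sum>j\<le>k-1. real ((k-1) choose j) * (sign_moment j * sign_sum_moment N (k - 1 - j))) = sign_sum_moment (Suc N) (k - 1)"
      unfolding sign_sum_moment_Suc by (rule binomial_sum_flip)
    finally show ?thesis .
  qed
  have 1: "(\<Sum>j\<le>k. real (k choose j) * (sign_sum_moment N (Suc j) * sign_moment (k - j))) \<le> real N * real k * sign_sum_moment (Suc N) (k - 1)"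
    unfolding sign_sum_moment_Suc by (rule binomial_moment_step) (use Suc p0 in auto)
  show ?case
    unfolding sign_sum_moment_Suc[of N "Suc k"] binomial_Suc_expansion using 1 2 by (simp add: algebra_simps)
qed

text \<open>The moment counts the words of length \<open>2*j\<close> over \<open>N\<close> letters
  in which every letter has even multiplicity. The left-hand side counts those with \<open>j\<close>
  different letters, each occurring twice.\<close>

lemma sign_sum_moment_ge: "real (N choose j) * fact (2*j) / 2 ^ j \<le> sign_sum_moment N (2*j)"
proof (induction N arbitrary: j)
  case 0
  show ?case by (cases j) (auto simp: sign_sum_moment_0)
next
  case (Suc N)
  show ?case
  proof (cases j)
    case 0
    have "real (N choose 0) * fact (2*0) / 2 ^ 0 \<le> sign_sum_moment N (2*0)" by (rule Suc)
    then show ?thesis unfolding sign_sum_moment_Suc using 0 by (simp add: sign_moment_def)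
  next
    case (Suc i)
    have 0: "real (2*j choose 2) * fact (2*i) = fact (2*j) / 2"
    proof -
      have "real (2*j choose 2) = fact (2*j) / (fact 2 * fact (2*j - 2))"
        using Suc by (intro binomial_fact) auto
      moreover have "2*j - 2 = 2*i" using Suc by simp
      ultimately show ?thesis by simp
    qed
    have "real (Suc N choose j) * fact (2*j) / 2 ^ j
      = real (N choose j) * fact (2*j) / 2 ^ j + real (N choose i) * (fact (2*j) / 2) / 2 ^ i"
      by (simp add: Suc field_simps)
    also have "\<dots> = real (N choose j) * fact (2*j) / 2 ^ j + real (2*j choose 2) * (real (N choose i) * fact (2*i) / 2 ^ i)"
      by (simp flip: 0)
    also have "\<dots> \<le> sign_sum_moment N (2*j) + real (2*j choose 2) * sign_sum_moment N (2*i)"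
      by (intro add_mono mult_left_mono Suc.IH) auto
    also have "\<dots> = (\<Sum>l\<in>{2*i, 2*j}. real (2*j choose l) * (sign_sum_moment N l * sign_moment (2*j - l)))"
    proof -
      have "(2*j choose 2) = (2*j choose (2*i))" using binomial_symmetric[of 2 "2*j"] Suc by simp
      then show ?thesis using Suc by (simp add: sign_moment_def)
    qed
    also have "\<dots> \<le> sign_sum_moment (Suc N) (2*j)"
      unfolding sign_sum_moment_Suc using Suc
      by (intro sum_mono2) (auto intro!: mult_nonneg_nonneg sign_sum_moment_nonneg simp: sign_moment_def)
    finally show ?thesis .
  qed
qed

definition comparison_space :: "nat \<Rightarrow> (real list \<times> real \<times> real) set" where
  "comparison_space N = sign_lists N \<times> (pm \<times> pm)"

definition gvar :: "nat \<Rightarrow> real list \<times> real \<times> real \<Rightarrow> real" where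
  "gvar N s = sum_list (fst s) / sqrt (real N)"

text \<open>With independent signs \<open>e\<close> and \<open>e'\<close>, the variable
  \<open>e + e' + e e'\<close> is 3 with probability 1/4 and -1 otherwise: centred, with third
  moment 6 and no negative moment. It fails the Wick inequality, but each of its three summands is a
  symmetric sign and satisfies it.\<close>

definition yvar :: "nat \<Rightarrow> real \<Rightarrow> real list \<times> real \<times> real \<Rightarrow> real" where
  "yvar N th s = gvar N s + th * (fst (snd s) + snd (snd s) + fst (snd s) * snd (snd s))"

definition yvar_moment :: "nat \<Rightarrow> real \<Rightarrow> nat \<Rightarrow> real" where
  "yvar_moment N th k = avg (comparison_space N) (\<lambda>s. yvar N th s ^ k)"

lemma finite_comparison_space: "finite (comparison_space N)" by (simp add: comparison_space_def finite_sign_lists)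

lemma comparison_space_nonempty: "comparison_space N \<noteq> {}" by (simp add: comparison_space_def sign_lists_nonempty)

lemma avg_pm1: "avg (pm \<times> pm) (\<lambda>z. fst z ^ k) = sign_moment k"
proof -
  have "avg (pm \<times> pm) (\<lambda>z. fst z ^ k * (\<lambda>y. 1) (snd z)) = avg pm (\<lambda>x. x ^ k) * avg pm (\<lambda>_. 1)"
    by (rule avg_Times)
  then show ?thesis using avg_pm[of k] avg_pm[of 0] by (simp add: sign_moment_def)
qed

lemma avg_pm2: "avg (pm \<times> pm) (\<lambda>z. snd z ^ k) = sign_moment k"
proof -
  have "avg (pm \<times> pm) (\<lambda>z. (\<lambda>y. 1) (fst z) * snd z ^ k) = avg pm (\<lambda>_. 1) * avg pm (\<lambda>x. x ^ k)"
    by (rule avg_Times)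
  then show ?thesis using avg_pm[of k] avg_pm[of 0] by (simp add: sign_moment_def)
qed

lemma avg_pm12: "avg (pm \<times> pm) (\<lambda>z. (fst z * snd z) ^ k) = sign_moment k"
  using avg_Times[of pm pm "\<lambda>x. x ^ k" "\<lambda>x. x ^ k"] by (simp add: power_mult_distrib avg_pm sign_moment_def)

lemma avg_comparison_space_snd: "avg (comparison_space N) (\<lambda>s. f (snd s)) = avg (pm \<times> pm) f"
  using avg_Times[of "sign_lists N" "pm \<times> pm" "\<lambda>_. 1" f] avg_const[OF finite_sign_lists sign_lists_nonempty, of N 1]
  by (simp add: comparison_space_def)

lemma avg_sign_lists_power: "avg (sign_lists N) (\<lambda>xs. (sum_list xs / sqrt (real N)) ^ k) = sign_sum_moment N k / sqrt (real N) ^ k"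
  using avg_cmult[of "sign_lists N" "1 / sqrt (real N) ^ k" "\<lambda>xs. sum_list xs ^ k"]
  by (simp add: sign_sum_moment_def power_divide)

lemma avg_gvar: "avg (comparison_space N) (\<lambda>s. gvar N s ^ k) = sign_sum_moment N k / sqrt (real N) ^ k"
  using avg_Times[of "sign_lists N" "pm \<times> pm" "\<lambda>xs. (sum_list xs / sqrt (real N)) ^ k" "\<lambda>_. 1"] avg_sign_lists_power[of N k]
    avg_const[of "pm \<times> pm" 1]
  by (simp add: comparison_space_def gvar_def)

lemma wick_gvar:
  assumes "0 < r" "0 < N"
  shows "wick (samples r (comparison_space N)) r (rmat (gvar N))"
proof (rule wick_rmat[OF finite_comparison_space comparison_space_nonempty assms(1)])
  fix k
  show "0 \<le> avg (comparison_space N) (\<lambda>s. gvar N s ^ k)" by (simp add: avg_gvar sign_sum_moment_nonneg)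
  show "avg (comparison_space N) (\<lambda>s. gvar N s ^ Suc k) \<le> real k * avg (comparison_space N) (\<lambda>s. gvar N s ^ (k - 1))"
  proof (cases k)
    case 0
    then show ?thesis using sign_sum_moment_Suc_le[of N 0] unfolding avg_gvar by (simp add: divide_nonpos_nonneg)
  next
    case (Suc l)
    have "sign_sum_moment N (Suc k) / sqrt (real N) ^ Suc k \<le> real N * real k * sign_sum_moment N (k - 1) / sqrt (real N) ^ Suc k"
      by (intro divide_right_mono sign_sum_moment_Suc_le) simp
    also have "real N * real k * sign_sum_moment N (k - 1) / sqrt (real N) ^ Suc k = real k * (sign_sum_moment N (k - 1) / sqrt (real N) ^ (k - 1))"
    proof -
      have "sqrt (real N) ^ Suc k = real N * sqrt (real N) ^ (k - 1)"
        using Suc by (simp add: mult.assoc[symmetric])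
      then show ?thesis using assms(2) by simp
    qed
    finally show ?thesis unfolding avg_gvar .
  qed
qed

lemma wick_sign:
  assumes "0 < r" "\<And>k. avg (comparison_space N) (\<lambda>s. f s ^ k) = sign_moment k"
  shows "wick (samples r (comparison_space N)) r (rmat f)"
proof (rule wick_rmat[OF finite_comparison_space comparison_space_nonempty assms(1)])
  fix k
  show "0 \<le> avg (comparison_space N) (\<lambda>s. f s ^ k)" unfolding assms(2) by (simp add: sign_moment_def)
  show "avg (comparison_space N) (\<lambda>s. f s ^ Suc k) \<le> real k * avg (comparison_space N) (\<lambda>s. f s ^ (k - 1))"
    unfolding assms(2) using sign_moment_Suc_le[of k] by simp
qed

lemma yvar_moment_expansion:
  "yvar_moment N th k = (\<Sum>j\<le>k. real (k choose j) * (sign_sum_moment N j / sqrt (real N) ^ j * (th ^ (k - j) * (3 ^ (k - j) + 3 * (-1) ^ (k - j)) / 4)))"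
proof -
  have z: "avg (pm \<times> pm) (\<lambda>z. (th * (fst z + snd z + fst z * snd z)) ^ l) = th ^ l * (3 ^ l + 3 * (-1) ^ l) / 4" for l
  proof -
    have "pm \<times> pm = {(-1,-1), (-1,1), (1,-1), (1,1)}" by auto
    then have "avg (pm \<times> pm) (\<lambda>z. (th * (fst z + snd z + fst z * snd z)) ^ l)
      = ((th * (-1)) ^ l + ((th * (-1)) ^ l + ((th * (-1)) ^ l + (th * 3) ^ l))) / 4"
      by (simp add: avg_def)
    also have "\<dots> = th ^ l * (3 ^ l + 3 * (-1) ^ l) / 4" unfolding power_mult_distrib by (simp add: algebra_simps)
    finally show ?thesis .
  qed
  have "yvar_moment N th k = avg (sign_lists N \<times> (pm \<times> pm)) (\<lambda>s. (sum_list (fst s) / sqrt (real N)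
      + (\<lambda>z. th * (fst z + snd z + fst z * snd z)) (snd s)) ^ k)"
    by (simp add: yvar_moment_def comparison_space_def yvar_def gvar_def)
  then show ?thesis
    unfolding binomial_expectation[of _ _ "\<lambda>xs. sum_list xs / sqrt (real N)" "\<lambda>z. th * (fst z + snd z + fst z * snd z)"] z avg_sign_lists_power .
qed

lemma z_moment_nonneg: "0 \<le> (3 :: real) ^ l + 3 * (-1) ^ l"
proof (cases l)
  case (Suc m)
  have "(1::real) \<le> 3 ^ m" by simp
  then show ?thesis using Suc by (cases "even m") auto
qed simp

lemma yvar_moment_term_le:
  assumes "0 \<le> th" "j \<le> k"
  shows "real (k choose j) * (sign_sum_moment N j / sqrt (real N) ^ j * (th ^ (k - j) * (3 ^ (k - j) + 3 * (-1) ^ (k - j)) / 4)) \<le> yvar_moment N th k"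
  unfolding yvar_moment_expansion using assms
  by (intro member_le_sum) (auto intro!: mult_nonneg_nonneg divide_nonneg_nonneg sign_sum_moment_nonneg z_moment_nonneg)

lemma yvar_moment_nonneg:
  assumes "0 \<le> th"
  shows "0 \<le> yvar_moment N th k"
  unfolding yvar_moment_expansion using assms
  by (intro sum_nonneg mult_nonneg_nonneg divide_nonneg_nonneg sign_sum_moment_nonneg z_moment_nonneg) auto

lemma fact_add_ge: "fact n * real n ^ m \<le> fact (n + m)"
proof (induction m)
  case (Suc m)
  have "fact n * real n ^ Suc m = real n * (fact n * real n ^ m)" by simp
  also have "\<dots> \<le> real (n + Suc m) * fact (n + m)" using Suc by (intro mult_mono) auto
  finally show ?case by simp
qed simp

text \<open>Already \<open>j\<close> signs give the moment of order \<open>2*j\<close> the Gaussian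
  growth \<open>fact j\<close> up to an exponential factor. Exponential factors are absorbed by the
  constant \<open>K\<close> of \<open>moment_domination\<close>.\<close>

lemma gmom_ge:
  assumes "j \<le> N" "0 < N"
  shows "fact j / 2 ^ j \<le> sign_sum_moment N (2*j) / sqrt (real N) ^ (2*j)"
proof -
  have e: "sqrt (real N) ^ (2*j) = real N ^ j" by (simp add: power_mult)
  have 1: "real N ^ j \<le> real (N choose j) * real j ^ j"
  proof (cases "j = 0")
    case False
    have "(real N / real j) ^ j \<le> real (N choose j)" by (rule binomial_ge_n_over_k_pow_k[OF assms(1)])
    then show ?thesis using False by (simp add: power_divide field_simps)
  qed simp
  have "fact j / 2 ^ j * real N ^ j \<le> fact j / 2 ^ j * (real (N choose j) * real j ^ j)"
    by (intro mult_left_mono 1) simp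
  also have "\<dots> = real (N choose j) * (fact j * real j ^ j) / 2 ^ j" by simp
  also have "\<dots> \<le> real (N choose j) * fact (2*j) / 2 ^ j"
    using fact_add_ge[of j j] by (intro divide_right_mono mult_left_mono) (auto simp: mult_2)
  also have "\<dots> \<le> sign_sum_moment N (2*j)" by (rule sign_sum_moment_ge)
  finally show ?thesis unfolding e using assms(2) by (simp add: pos_le_divide_eq)
qed

lemma yvar_moment_even_ge:
  assumes "0 \<le> th" "j \<le> N" "0 < N"
  shows "fact j / 2 ^ j \<le> yvar_moment N th (2*j)"
  using yvar_moment_term_le[OF assms(1), of "2*j" "2*j" N] gmom_ge[OF assms(2,3)] by simp

text \<open>Expand the power and keep one term: the third moment 6 of the skewed part times an even
  moment of the sign sum.\<close>

lemma yvar_moment_odd_ge: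
  assumes "0 \<le> th" "j \<le> N" "0 < N"
  shows "6 * th ^ 3 * (fact j / 2 ^ j) \<le> yvar_moment N th (2*j+3)"
proof -
  have "1 \<le> ((2*j+3) choose (2*j))" using zero_less_binomial[of "2*j" "2*j+3"] by linarith
  then have c: "1 \<le> real ((2*j+3) choose (2*j))" by linarith
  have "6 * th ^ 3 * (fact j / 2 ^ j) \<le> 1 * (sign_sum_moment N (2*j) / sqrt (real N) ^ (2*j) * (th ^ 3 * 6))"
    using mult_left_mono[OF gmom_ge[OF assms(2,3)], of "6 * th ^ 3"] assms(1) by (simp add: mult_ac)
  also have "\<dots> \<le> real ((2*j+3) choose (2*j)) * (sign_sum_moment N (2*j) / sqrt (real N) ^ (2*j) * (th ^ 3 * 6))"
    using c assms(1) by (intro mult_right_mono mult_nonneg_nonneg divide_nonneg_nonneg sign_sum_moment_nonneg) auto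
  also have "\<dots> \<le> yvar_moment N th (2*j+3)"
    using yvar_moment_term_le[OF assms(1), of "2*j" "2*j+3" N] by (simp add: mult_ac)
  finally show ?thesis .
qed

lemma yvar_moment_0: "yvar_moment N th 0 = 1"
  using avg_const[OF finite_comparison_space comparison_space_nonempty, of N 1] by (simp add: yvar_moment_def)

text \<open>The triangle inequality splits the matrix into four that satisfy the Wick inequality.
  Passing from traces to norms and back costs one factor \<open>r\<close>, the Wick bound another,
  and the four matrices the factor 4; for \<open>r\<close> proportional to \<open>P\<close> none of
  this affects the exponential rate.\<close>

lemma Y_trace_bound:
  fixes \<kappa> :: real
  assumes "1 < \<kappa>"
  obtains c where "0 < c" "\<And>r N P th. 0 < r \<Longrightarrow> 0 < N \<Longrightarrow> 0 \<le> th \<Longrightarrow> real P \<le> c * real r \<Longrightarrow>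
     avg (samples r (comparison_space N)) (\<lambda>\<omega>. trace_pow r (rmat (yvar N th) \<omega>) (2 * P)) \<le> 4 * (real r)\<^sup>2 * ((1 + 3 * th)\<^sup>2 * (4 * \<kappa> * real r)) ^ P"
proof -
  obtain c where c: "0 < c" and b: "\<And>\<Omega> r (G :: (nat \<times> nat \<Rightarrow> real list \<times> real \<times> real) \<Rightarrow> nat \<Rightarrow> nat \<Rightarrow> real) P. wick \<Omega> r G \<Longrightarrow> real P \<le> c * real r \<Longrightarrow>
     avg \<Omega> (\<lambda>\<omega>. trace_pow r (G \<omega>) (2 * P)) \<le> real r * (4 * \<kappa> * real r) ^ P"
    using wick_trace_bound[OF assms] by blast
  show thesis
  proof (rule that[OF c])
    fix r N P :: nat and th :: real
    assume r: "0 < r" and N: "0 < N" and th: "0 \<le> th" and P: "real P \<le> c * real r"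
    define f1 f2 f3 :: "real list \<times> real \<times> real \<Rightarrow> real" where "f1 s = fst (snd s)" and "f2 s = snd (snd s)"
      and "f3 s = fst (snd s) * snd (snd s)" for s
    have w: "wick (samples r (comparison_space N)) r (rmat f1)" "wick (samples r (comparison_space N)) r (rmat f2)" "wick (samples r (comparison_space N)) r (rmat f3)"
      unfolding f1_def f2_def f3_def
      by (rule wick_sign[OF r], rule trans[OF avg_comparison_space_snd], rule avg_pm1 avg_pm2 avg_pm12)+
    let ?B = "real r * (4 * \<kappa> * real r) ^ P"
    have pt: "trace_pow r (rmat (yvar N th) \<omega>) (2 * P) \<le> real r * (1 + 3 * th) ^ (2 * P) *
      (trace_pow r (rmat (gvar N) \<omega>) (2*P) + (trace_pow r (rmat f1 \<omega>) (2*P) + (trace_pow r (rmat f2 \<omega>) (2*P) + trace_pow r (rmat f3 \<omega>) (2*P))))" for \<omega>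
    proof -
      define x a b d where "x = spec_norm r (rmat (gvar N) \<omega>)" and "a = spec_norm r (rmat f1 \<omega>)"
        and "b = spec_norm r (rmat f2 \<omega>)" and "d = spec_norm r (rmat f3 \<omega>)"
      have nn: "0 \<le> x" "0 \<le> a" "0 \<le> b" "0 \<le> d"
        unfolding x_def a_def b_def d_def by (auto intro: spec_norm_nonneg[OF r])
      \<comment> \<open>The norm is at most \<open>(1 + 3 * th) * m\<close>, and a power of the
        maximum is at most the sum of the powers.\<close>
      define m where "m = max x (max a (max b d))"
      have m: "x \<le> m" "a \<le> m" "b \<le> m" "d \<le> m" "0 \<le> m" using nn by (auto simp: m_def)
      have "m = x \<or> m = a \<or> m = b \<or> m = d" by (auto simp: m_def max_def)
      then have mp: "m ^ (2*P) \<le> x ^ (2*P) + (a ^ (2*P) + (b ^ (2*P) + d ^ (2*P)))"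
        using nn by (elim disjE) (simp_all add: add_nonneg_nonneg add_increasing add_increasing2)
      have Y: "rmat (yvar N th) \<omega> = (\<lambda>i j. rmat (gvar N) \<omega> i j + th * ((rmat f1 \<omega> i j + rmat f2 \<omega> i j) + rmat f3 \<omega> i j))"
        by (simp add: fun_eq_iff rmat_def yvar_def f1_def f2_def f3_def)
      have "spec_norm r (rmat (yvar N th) \<omega>) \<le> x + spec_norm r (\<lambda>i j. th * ((rmat f1 \<omega> i j + rmat f2 \<omega> i j) + rmat f3 \<omega> i j))"
        unfolding Y x_def by (rule spec_norm_triangle[OF r])
      also have "\<dots> \<le> x + th * spec_norm r (\<lambda>i j. (rmat f1 \<omega> i j + rmat f2 \<omega> i j) + rmat f3 \<omega> i j)"
        by (intro add_left_mono spec_norm_scale r th)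
      also have "\<dots> \<le> x + th * ((a + b) + d)"
      proof -
        have "spec_norm r (\<lambda>i j. (rmat f1 \<omega> i j + rmat f2 \<omega> i j) + rmat f3 \<omega> i j) \<le> spec_norm r (\<lambda>i j. rmat f1 \<omega> i j + rmat f2 \<omega> i j) + d"
          unfolding d_def by (rule spec_norm_triangle[OF r])
        moreover have "spec_norm r (\<lambda>i j. rmat f1 \<omega> i j + rmat f2 \<omega> i j) \<le> a + b"
          unfolding a_def b_def by (rule spec_norm_triangle[OF r])
        ultimately show ?thesis using th by (intro add_left_mono mult_left_mono) auto
      qed
      also have "\<dots> \<le> m + th * ((m + m) + m)" using m th by (intro add_mono mult_left_mono) auto
      also have "\<dots> = (1 + 3 * th) * m" by (simp add: algebra_simps)
      finally have "spec_norm r (rmat (yvar N th) \<omega>) ^ (2*P) \<le> ((1 + 3 * th) * m) ^ (2*P)"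
        by (intro power_mono spec_norm_nonneg r)
      also have "\<dots> = (1 + 3 * th) ^ (2*P) * m ^ (2*P)" by (rule power_mult_distrib)
      also have "\<dots> \<le> (1 + 3 * th) ^ (2*P) * (x ^ (2*P) + (a ^ (2*P) + (b ^ (2*P) + d ^ (2*P))))"
        using th by (intro mult_left_mono mp) auto
      also have "\<dots> \<le> (1 + 3 * th) ^ (2*P) * (trace_pow r (rmat (gvar N) \<omega>) (2*P) + (trace_pow r (rmat f1 \<omega>) (2*P) + (trace_pow r (rmat f2 \<omega>) (2*P) + trace_pow r (rmat f3 \<omega>) (2*P))))"
        unfolding x_def a_def b_def d_def using th
        by (intro mult_left_mono add_mono spec_norm_power_le_trace_pow sym_mat_rmat r) auto
      finally have "real r * spec_norm r (rmat (yvar N th) \<omega>) ^ (2*P) \<le> real r * \<dots>" by (intro mult_left_mono) auto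
      moreover have "trace_pow r (rmat (yvar N th) \<omega>) (2 * P) \<le> real r * spec_norm r (rmat (yvar N th) \<omega>) ^ (2*P)"
        by (intro trace_pow_le_spec_norm sym_mat_rmat r)
      ultimately show ?thesis by (simp add: mult.assoc)
    qed
    have "avg (samples r (comparison_space N)) (\<lambda>\<omega>. trace_pow r (rmat (yvar N th) \<omega>) (2 * P)) \<le> real r * (1 + 3 * th) ^ (2 * P) *
      (avg (samples r (comparison_space N)) (\<lambda>\<omega>. trace_pow r (rmat (gvar N) \<omega>) (2*P)) + (avg (samples r (comparison_space N)) (\<lambda>\<omega>. trace_pow r (rmat f1 \<omega>) (2*P))
       + (avg (samples r (comparison_space N)) (\<lambda>\<omega>. trace_pow r (rmat f2 \<omega>) (2*P)) + avg (samples r (comparison_space N)) (\<lambda>\<omega>. trace_pow r (rmat f3 \<omega>) (2*P)))))"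
      unfolding avg_add[symmetric] avg_cmult[symmetric] by (intro avg_mono pt)
    also have "\<dots> \<le> real r * (1 + 3 * th) ^ (2 * P) * (?B + (?B + (?B + ?B)))"
      using th by (intro mult_left_mono add_mono b wick_gvar w P r N) auto
    also have "\<dots> = 4 * (real r)\<^sup>2 * ((1 + 3 * th)\<^sup>2 * (4 * \<kappa> * real r)) ^ P"
    proof -
      have "real r * u * (real r * v + (real r * v + (real r * v + real r * v))) = 4 * (real r)\<^sup>2 * (u * v)" for u v :: real
        by (simp add: power2_eq_square algebra_simps)
      from this[of "((1 + 3 * th)\<^sup>2) ^ P" "(4 * \<kappa> * real r) ^ P"] show ?thesis
        by (simp only: power_mult power_mult_distrib[of "(1 + 3 * th)\<^sup>2" "4 * \<kappa> * real r" P])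
    qed
    finally show "avg (samples r (comparison_space N)) (\<lambda>\<omega>. trace_pow r (rmat (yvar N th) \<omega>) (2 * P)) \<le> 4 * (real r)\<^sup>2 * ((1 + 3 * th)\<^sup>2 * (4 * \<kappa> * real r)) ^ P" .
  qed
qed

subsection \<open>Walks and their patterns\<close>

text \<open>Walks are lists of vertices in reverse order: the head is the current vertex, the last element the
  starting point.\<close>

fun steps :: "'v list \<Rightarrow> ('v \<times> 'v) list" where
  "steps (y # x # u) = (x, y) # steps (x # u)"
| "steps u = []"

primrec walks :: "nat \<Rightarrow> nat \<Rightarrow> nat \<Rightarrow> nat list set" where
  "walks n i 0 = {[i]}"
| "walks n i (Suc L) = (\<lambda>(y, u). y # u) ` ({..<n} \<times> walks n i L)"

lemma finite_walks [simp]: "finite (walks n i L)"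
  by (induction L) auto

lemma walks_length: "u \<in> walks n i L \<Longrightarrow> length u = Suc L"
  by (induction L arbitrary: u) auto

lemma walks_nonempty: "u \<in> walks n i L \<Longrightarrow> u \<noteq> []"
  using walks_length by fastforce

lemma walks_set:
  assumes "i < n"
  shows "u \<in> walks n i L \<Longrightarrow> set u \<subseteq> {..<n}"
proof (induction L arbitrary: u)
  case (Suc L)
  then obtain y v where "u = y # v" "y < n" "v \<in> walks n i L" by auto
  then show ?case using Suc.IH[of v] by auto
qed (use assms in auto)

lemma walks_last: "u \<in> walks n i L \<Longrightarrow> last u = i"
  by (induction L arbitrary: u) (auto dest: walks_nonempty)

lemma sum_walks_Suc: "(\<Sum>u\<in>walks n i (Suc L). f u) = (\<Sum>u\<in>walks n i L. \<Sum>y<n. f (y # u))"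
proof -
  have "(\<Sum>u\<in>walks n i (Suc L). f u) = (\<Sum>z\<in>{..<n} \<times> walks n i L. f (fst z # snd z))"
    by (simp, subst sum.reindex) (auto simp: inj_on_def case_prod_beta)
  also have "\<dots> = (\<Sum>y<n. \<Sum>u\<in>walks n i L. f (y # u))"
    by (simp add: sum.cartesian_product case_prod_beta)
  also have "\<dots> = (\<Sum>u\<in>walks n i L. \<Sum>y<n. f (y # u))" by (rule sum.swap)
  finally show ?thesis .
qed

lemma steps_Cons: "u \<noteq> [] \<Longrightarrow> steps (y # u) = (hd u, y) # steps u"
  by (cases u) auto

lemma steps_set: "set (steps u) \<subseteq> set u \<times> set u"
  by (induction u rule: steps.induct) auto

lemma length_steps: "length (steps u) = length u - 1"
  by (induction u rule: steps.induct) auto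

text \<open>\<open>f\<close> is arbitrary because walks grow at the head: the last step is absorbed
  into a new function of the previous vertex.\<close>

lemma mat_pow_walks:
  assumes "i < n"
  shows "(\<Sum>u\<in>walks n i L. monomial A (steps u) * f (hd u)) = (\<Sum>j<n. mat_pow n A L i j * f j)"
proof (induction L arbitrary: f)
  case 0
  have "(\<Sum>j<n. (if i = j then 1 else 0) * f j) = (\<Sum>j<n. if i = j then f j else 0)"
    by (intro sum.cong) auto
  then show ?case using assms by simp
next
  case (Suc L)
  have "(\<Sum>u\<in>walks n i (Suc L). monomial A (steps u) * f (hd u))
    = (\<Sum>u\<in>walks n i L. monomial A (steps u) * (\<Sum>y<n. A (hd u) y * f y))"
    unfolding sum_walks_Suc using walks_nonempty by (intro sum.cong refl) (auto simp: steps_Cons sum_distrib_left mult_ac)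
  also have "\<dots> = (\<Sum>j<n. mat_pow n A L i j * (\<Sum>y<n. A j y * f y))" by (rule Suc)
  also have "\<dots> = (\<Sum>y<n. \<Sum>j<n. mat_pow n A L i j * A j y * f y)"
    unfolding sum_distrib_left mult.assoc by (rule sum.swap)
  also have "\<dots> = (\<Sum>y<n. mat_pow n A (L + Suc 0) i y * f y)"
    using assms by (intro sum.cong refl) (simp only: mat_pow_add, simp add: mat_pow_1 sum_distrib_right del: mat_pow.simps)
  finally show ?case by simp
qed

lemma trace_pow_walks:
  "trace_pow n A L = (\<Sum>i<n. \<Sum>u\<in>walks n i L. monomial A (steps u) * (if hd u = i then 1 else 0))"
  unfolding trace_pow_def
proof (intro sum.cong refl)
  fix i assume "i \<in> {..<n}"
  then have "(\<Sum>u\<in>walks n i L. monomial A (steps u) * (if hd u = i then 1 else 0)) = (\<Sum>j<n. mat_pow n A L i j * (if j = i then 1 else 0))"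
    using mat_pow_walks[of i n A "\<lambda>j. if j = i then 1 else 0" L] by simp
  also have "\<dots> = (\<Sum>j<n. if j = i then mat_pow n A L i j else 0)" by (intro sum.cong) auto
  finally show "mat_pow n A L i i = (\<Sum>u\<in>walks n i L. monomial A (steps u) * (if hd u = i then 1 else 0))"
    using \<open>i \<in> {..<n}\<close> by simp
qed

text \<open>The label of a vertex is the time of its first visit; \<open>pattern u\<close> relabels the walk \<open>u\<close> accordingly.\<close>

fun label :: "'v list \<Rightarrow> 'v \<Rightarrow> nat" where
  "label [] x = 0"
| "label (y # u) x = (if x \<in> set u then label u x else if x = y then length u else Suc (length u))"

fun pattern :: "'v list \<Rightarrow> nat list" where
  "pattern [] = []"
| "pattern (y # u) = label u y # pattern u"

lemma label_less_iff: "label u x < length u \<longleftrightarrow> x \<in> set u"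
  by (induction u) auto

lemma label_notin: "x \<notin> set u \<Longrightarrow> label u x = length u"
  by (induction u) auto

lemma label_inj: "inj_on (label u) (set u)"
proof (induction u)
  case (Cons y u)
  show ?case
  proof (cases "y \<in> set u")
    case True
    then have eq: "set (y # u) = set u" by auto
    show ?thesis unfolding eq using Cons by (simp add: inj_on_def)
  next
    case False
    have "inj_on (label (y # u)) (set u)" using Cons by (simp add: inj_on_def)
    moreover have "label (y # u) y \<noteq> label (y # u) x" if "x \<in> set u" for x
      using False that label_less_iff[of u x] by simp
    ultimately show ?thesis unfolding list.set(2) inj_on_insert by (auto simp del: label.simps)
  qed
qed simp

lemma pattern_map: "pattern u = map (label u) u"
proof (induction u)
  case (Cons y u)
  have "label (y # u) y = label u y" using label_notin[of y u] by auto
  moreover have "map (label (y # u)) u = map (label u) u" by (rule map_cong) auto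
  ultimately show ?case using Cons by simp
qed simp

lemma length_pattern: "length (pattern u) = length u"
  by (simp add: pattern_map)

lemma set_pattern: "set (pattern u) = label u ` set u"
  by (simp add: pattern_map)

lemma card_set_pattern: "card (set (pattern u)) = card (set u)"
  unfolding set_pattern by (rule card_image[OF label_inj])

primrec patterns :: "nat \<Rightarrow> nat list set" where
  "patterns 0 = {[0]}"
| "patterns (Suc L) = (\<Union>c\<in>patterns L. (\<lambda>a. a # c) ` (insert (Suc L) (set c)))"

lemma finite_patterns [simp]: "finite (patterns L)"
  by (induction L) auto

lemma patterns_set: "c \<in> patterns L \<Longrightarrow> set c \<subseteq> {..L}"
proof (induction L arbitrary: c)
  case (Suc L)
  then obtain a d where "c = a # d" "d \<in> patterns L" "a = Suc L \<or> a \<in> set d" by auto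
  then show ?case using Suc.IH[of d] by fastforce
qed auto

lemma patterns_nonempty: "c \<in> patterns L \<Longrightarrow> c \<noteq> []"
  by (cases L) auto

lemma sum_patterns_Suc: "(\<Sum>c\<in>patterns (Suc L). F c) = (\<Sum>c\<in>patterns L. (\<Sum>a\<in>set c. F (a # c)) + F (Suc L # c))"
proof -
  have "(\<Sum>c\<in>patterns (Suc L). F c) = (\<Sum>c\<in>patterns L. \<Sum>d\<in>(\<lambda>a. a # c) ` (insert (Suc L) (set c)). F d)"
    unfolding patterns.simps by (rule sum.UNION_disjoint) auto
  also have "\<dots> = (\<Sum>c\<in>patterns L. (\<Sum>a\<in>set c. F (a # c)) + F (Suc L # c))"
  proof (intro sum.cong refl)
    fix c assume "c \<in> patterns L"
    then have "Suc L \<notin> set c" using patterns_set by fastforce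
    then show "(\<Sum>d\<in>(\<lambda>a. a # c) ` (insert (Suc L) (set c)). F d) = (\<Sum>a\<in>set c. F (a # c)) + F (Suc L # c)"
      by (subst sum.reindex) (auto simp: inj_on_def add.commute)
  qed
  finally show ?thesis .
qed

lemma sum_labels: "(\<Sum>y\<in>set u. F (label u y)) = (\<Sum>a\<in>set (pattern u). F a)"
  unfolding set_pattern by (simp add: sum.reindex[OF label_inj])

text \<open>The next vertex is either an old one, identified by its label, or new, and all new
  vertices receive the same label \<open>length u\<close>.\<close>

lemma sum_next_vertex:
  fixes F :: "nat \<Rightarrow> real" and n :: nat
  assumes "set u \<subseteq> {..<n}"
  shows "(\<Sum>y<n. g y * F (label u y)) = (\<Sum>y\<in>set u. g y * F (label u y)) + (\<Sum>y\<in>{..<n} - set u. g y) * F (length u)"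
proof -
  have "(\<Sum>y<n. g y * F (label u y)) = (\<Sum>y\<in>set u. g y * F (label u y)) + (\<Sum>y\<in>{..<n} - set u. g y * F (label u y))"
    using sum.subset_diff[OF assms finite_lessThan, of "\<lambda>y. g y * F (label u y)"] by simp
  also have "(\<Sum>y\<in>{..<n} - set u. g y * F (label u y)) = (\<Sum>y\<in>{..<n} - set u. g y * F (length u))"
    by (intro sum.cong refl) (auto simp: label_notin)
  finally show ?thesis by (simp add: sum_distrib_right)
qed

text \<open>The edges along which a walk discovers a new vertex; they form a spanning tree of its graph.\<close>

fun tree_edges :: "nat list \<Rightarrow> (nat \<times> nat) list" where
  "tree_edges (y # x # u) = (if y \<in> set (x # u) then tree_edges (x # u) else sort_pair (x, y) # tree_edges (x # u))"
| "tree_edges u = []"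

definition tree_weight :: "(nat \<Rightarrow> nat \<Rightarrow> real) \<Rightarrow> nat list \<Rightarrow> real" where
  "tree_weight \<sigma> u = (\<Prod>e\<leftarrow>tree_edges u. (\<sigma> (fst e) (snd e))\<^sup>2)"

definition num_new :: "'v list \<Rightarrow> nat" where
  "num_new u = card (set u) - 1"

lemma tree_edges_Cons: "u \<noteq> [] \<Longrightarrow> tree_edges (y # u) = (if y \<in> set u then tree_edges u else sort_pair (hd u, y) # tree_edges u)"
  by (cases u) auto

lemma tree_weight_nonneg: "0 \<le> tree_weight \<sigma> u"
  unfolding tree_weight_def by (rule prod_list_nonneg) auto

lemma sigma_sort_pair:
  "sym_mat n \<sigma> \<Longrightarrow> x < n \<Longrightarrow> y < n \<Longrightarrow> \<sigma> (fst (sort_pair (x, y))) (snd (sort_pair (x, y))) = \<sigma> x y"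
  by (cases "x \<le> y") (auto simp: sort_pair_def sym_mat_def min_def max_def)

lemma tree_weight_Cons:
  assumes "sym_mat n \<sigma>" "u \<noteq> []" "set u \<subseteq> {..<n}" "y < n"
  shows "tree_weight \<sigma> (y # u) = (if y \<in> set u then 1 else (\<sigma> (hd u) y)\<^sup>2) * tree_weight \<sigma> u"
proof -
  have "hd u < n" using assms(2,3) by (cases u) auto
  then show ?thesis using assms by (simp add: tree_weight_def tree_edges_Cons sigma_sort_pair)
qed

lemma tree_edges_vertices: "e \<in> set (tree_edges u) \<Longrightarrow> fst e \<in> set u \<and> snd e \<in> set u"
  by (induction u rule: tree_edges.induct) (auto simp: sort_pair_def min_def max_def split: if_splits)

lemma tree_edges_distinct: "distinct (tree_edges u)"
proof (induction u rule: tree_edges.induct)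
  case (1 y x u)
  show ?case
  proof (cases "y \<in> set (x # u)")
    case False
    then have "sort_pair (x, y) \<notin> set (tree_edges (x # u))"
      using tree_edges_vertices[of "sort_pair (x, y)" "x # u"] by (cases "x \<le> y") (auto simp: sort_pair_def)
    then show ?thesis using 1 False by simp
  qed (use 1 in simp)
qed auto

lemma length_tree_edges: "length (tree_edges u) = num_new u"
proof (induction u rule: tree_edges.induct)
  case (1 y x u)
  have "0 < card (set (x # u))" by (simp add: card_gt_0_iff)
  then show ?case using 1 unfolding num_new_def
    by (cases "y \<in> set (x # u)") (auto simp: insert_absorb card_insert_if)
qed (auto simp: num_new_def)

lemma tree_edges_subset: "set (tree_edges u) \<subseteq> set (map sort_pair (steps u))"
  by (induction u rule: tree_edges.induct) auto

lemma prod_list_square: "(\<Prod>e\<leftarrow>R. f e) * (\<Prod>e\<leftarrow>R. f e) = (\<Prod>e\<leftarrow>R. (f e)\<^sup>2)" for f :: "'b \<Rightarrow> real"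
  by (induction R) (auto simp: power2_eq_square)

lemma prod_list_power_le:
  fixes f :: "'b \<Rightarrow> real"
  assumes "\<And>e. e \<in> set R \<Longrightarrow> 0 \<le> f e \<and> f e \<le> s"
  shows "(\<Prod>e\<leftarrow>R. f e) \<le> s ^ length R \<and> 0 \<le> (\<Prod>e\<leftarrow>R. f e)"
  using assms
proof (induction R)
  case (Cons a R)
  then have "0 \<le> f a" "f a \<le> s" "(\<Prod>e\<leftarrow>R. f e) \<le> s ^ length R" "0 \<le> (\<Prod>e\<leftarrow>R. f e)" by auto
  then show ?case by (simp add: mult_mono)
qed simp

text \<open>Every edge occurs at least twice and the discovery edges are distinct, so two copies of
  each can be removed from the multiset of edges. They form \<open>tree_weight\<close>, and each
  remaining step contributes at most \<open>s\<close>.\<close>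

lemma monomial_sigma_le:
  assumes sym: "sym_mat n \<sigma>" and u: "set u \<subseteq> {..<n}"
    and \<sigma>: "\<And>i j. i < n \<Longrightarrow> j < n \<Longrightarrow> 0 \<le> \<sigma> i j \<and> \<sigma> i j \<le> s"
    and c: "\<And>e. e \<in> set (map sort_pair (steps u)) \<Longrightarrow> 2 \<le> count_list (map sort_pair (steps u)) e"
  shows "2 * num_new u \<le> length (steps u)" "monomial \<sigma> (steps u) \<le> tree_weight \<sigma> u * s ^ (length (steps u) - 2 * num_new u)" "0 \<le> monomial \<sigma> (steps u)"
proof -
  let ?f = "\<lambda>e. \<sigma> (fst e) (snd e)"
  let ?E = "map sort_pair (steps u)"
  have ev: "x < n \<and> y < n" if "(x, y) \<in> set (steps u)" for x y using steps_set[of u] u that by auto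
  have monomial: "monomial \<sigma> (steps u) = (\<Prod>e\<leftarrow>?E. ?f e)"
  proof -
    have "map (\<lambda>(x, y). \<sigma> x y) (steps u) = map (\<lambda>e. ?f (sort_pair e)) (steps u)"
      using ev sigma_sort_pair[OF sym] by (intro map_cong) auto
    then show ?thesis by (simp only: monomial_def map_map comp_def)
  qed
  have "mset (tree_edges u) + mset (tree_edges u) \<subseteq># mset ?E"
  proof (rule mset_subset_eqI)
    fix e
    show "count (mset (tree_edges u) + mset (tree_edges u)) e \<le> count (mset ?E) e"
    proof (cases "e \<in> set (tree_edges u)")
      case True
      then have "e \<in> set ?E" using tree_edges_subset by auto
      then have "2 \<le> count (mset ?E) e" using c[of e] by (simp only: count_mset)
      moreover have "count (mset (tree_edges u)) e \<le> 1"
        using tree_edges_distinct[of u, unfolded distinct_count_atmost_1, rule_format, of e] by simp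
      ultimately show ?thesis by simp
    next
      case False
      then have c0: "count (mset (tree_edges u)) e = 0" by (simp add: count_eq_zero_iff)
      show ?thesis unfolding count_union c0 by simp
    qed
  qed
  then obtain R' where "mset ?E = (mset (tree_edges u) + mset (tree_edges u)) + R'" by (metis subset_mset.le_iff_add)
  then obtain R where R: "mset ?E = mset (tree_edges u) + mset (tree_edges u) + mset R" by (metis ex_mset)
  have len: "length (steps u) = 2 * num_new u + length R"
    using arg_cong[OF R, of size] by (simp add: length_tree_edges)
  then show "2 * num_new u \<le> length (steps u)" by simp
  have "(\<Prod>e\<leftarrow>?E. ?f e) = prod_mset (image_mset ?f (mset ?E))"
    unfolding prod_mset_prod_list[symmetric] mset_map ..
  also have "\<dots> = (\<Prod>e\<leftarrow>tree_edges u. ?f e) * (\<Prod>e\<leftarrow>tree_edges u. ?f e) * (\<Prod>e\<leftarrow>R. ?f e)"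
    unfolding R by (simp flip: prod_mset_prod_list)
  also have "(\<Prod>e\<leftarrow>tree_edges u. ?f e) * (\<Prod>e\<leftarrow>tree_edges u. ?f e) = tree_weight \<sigma> u"
    unfolding tree_weight_def by (rule prod_list_square)
  finally have m: "monomial \<sigma> (steps u) = tree_weight \<sigma> u * (\<Prod>e\<leftarrow>R. ?f e)" unfolding monomial .
  have "set R \<subseteq> set ?E" using arg_cong[OF R, of set_mset] unfolding set_mset_mset set_mset_union by blast
  have "0 \<le> ?f e \<and> ?f e \<le> s" if "e \<in> set R" for e
  proof -
    from that \<open>set R \<subseteq> set ?E\<close> have "e \<in> sort_pair ` set (steps u)" by auto
    then obtain x y where "(x, y) \<in> set (steps u)" "e = sort_pair (x, y)" by auto
    then show ?thesis using sigma_sort_pair[OF sym, of x y] ev[of x y] \<sigma>[of x y] by simp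
  qed
  then have "(\<Prod>e\<leftarrow>R. ?f e) \<le> s ^ length R \<and> 0 \<le> (\<Prod>e\<leftarrow>R. ?f e)" by (intro prod_list_power_le) auto
  then show "monomial \<sigma> (steps u) \<le> tree_weight \<sigma> u * s ^ (length (steps u) - 2 * num_new u)" "0 \<le> monomial \<sigma> (steps u)"
    using len tree_weight_nonneg[of \<sigma> u] unfolding m by (auto intro: mult_left_mono)
qed

text \<open>For a fixed pattern the walks from \<open>i\<close> have total tree weight at most one:
  a step to an old vertex leaves no choice, and a step to a new one sums \<open>\<sigma>^2\<close>
  over part of a row. Peeling off the last step turns \<open>F\<close> into another function of the
  shorter pattern, so the induction needs arbitrary \<open>F\<close>.\<close>

lemma sum_walks_le_sum_patterns:
  assumes sym: "sym_mat n \<sigma>" and rows: "\<And>i. i < n \<Longrightarrow> (\<Sum>j<n. (\<sigma> i j)\<^sup>2) \<le> 1"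
    and i: "i < n" and F: "\<And>c. 0 \<le> F c"
  shows "(\<Sum>u\<in>walks n i L. tree_weight \<sigma> u * F (pattern u)) \<le> (\<Sum>c\<in>patterns L. F c)"
  using F
proof (induction L arbitrary: F)
  case 0
  then show ?case by (simp add: tree_weight_def)
next
  case (Suc L)
  have "(\<Sum>u\<in>walks n i (Suc L). tree_weight \<sigma> u * F (pattern u))
    \<le> (\<Sum>u\<in>walks n i L. tree_weight \<sigma> u * ((\<Sum>a\<in>set (pattern u). F (a # pattern u)) + F (Suc L # pattern u)))"
    unfolding sum_walks_Suc
  proof (intro sum_mono)
    fix u assume u: "u \<in> walks n i L"
    note us = walks_set[OF i u] and un = walks_nonempty[OF u]
    have "(\<Sum>y<n. tree_weight \<sigma> (y # u) * F (pattern (y # u)))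
      = tree_weight \<sigma> u * (\<Sum>y<n. (if y \<in> set u then 1 else (\<sigma> (hd u) y)\<^sup>2) * F (label u y # pattern u))"
      unfolding sum_distrib_left using us un by (intro sum.cong refl) (simp add: tree_weight_Cons[OF sym] mult_ac)
    also have "(\<Sum>y<n. (if y \<in> set u then 1 else (\<sigma> (hd u) y)\<^sup>2) * F (label u y # pattern u))
      = (\<Sum>y\<in>set u. (if y \<in> set u then 1 else (\<sigma> (hd u) y)\<^sup>2) * F (label u y # pattern u))
        + (\<Sum>y\<in>{..<n} - set u. (if y \<in> set u then 1 else (\<sigma> (hd u) y)\<^sup>2)) * F (length u # pattern u)"
      by (rule sum_next_vertex[OF us, where F = "\<lambda>a. F (a # pattern u)"])
    also have "(\<Sum>y\<in>set u. (if y \<in> set u then 1 else (\<sigma> (hd u) y)\<^sup>2) * F (label u y # pattern u)) = (\<Sum>a\<in>set (pattern u). F (a # pattern u))"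
      by (simp add: sum_labels[where F = "\<lambda>a. F (a # pattern u)"])
    also have "(\<Sum>y\<in>{..<n} - set u. (if y \<in> set u then 1 else (\<sigma> (hd u) y)\<^sup>2)) * F (length u # pattern u) \<le> 1 * F (Suc L # pattern u)"
    proof -
      have "(\<Sum>y\<in>{..<n} - set u. (if y \<in> set u then 1 else (\<sigma> (hd u) y)\<^sup>2)) = (\<Sum>y\<in>{..<n} - set u. (\<sigma> (hd u) y)\<^sup>2)"
        by (intro sum.cong) auto
      also have "\<dots> \<le> (\<Sum>y<n. (\<sigma> (hd u) y)\<^sup>2)" by (intro sum_mono2) auto
      also have "\<dots> \<le> 1" using us un by (intro rows) (cases u, auto)
      finally show ?thesis unfolding walks_length[OF u] by (intro mult_right_mono Suc.prems)
    qed
    finally show "(\<Sum>y<n. tree_weight \<sigma> (y # u) * F (pattern (y # u))) \<le> tree_weight \<sigma> u * ((\<Sum>a\<in>set (pattern u). F (a # pattern u)) + F (Suc L # pattern u))"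
      by (simp add: mult_left_mono tree_weight_nonneg)
  qed
  also have "\<dots> \<le> (\<Sum>c\<in>patterns L. (\<Sum>a\<in>set c. F (a # c)) + F (Suc L # c))"
    using Suc.IH[of "\<lambda>c. (\<Sum>a\<in>set c. F (a # c)) + F (Suc L # c)"] Suc.prems by (simp add: sum_nonneg)
  finally show ?case by (simp only: sum_patterns_Suc)
qed

text \<open>The converse count for a matrix with constant profile: each new vertex can be chosen in
  at least \<open>r - p\<close> ways as long as at most \<open>p\<close> are discovered.\<close>

lemma sum_patterns_le_sum_walks:
  assumes i: "i < r" and pr: "p \<le> r" and F: "\<And>c. 0 \<le> F c"
  shows "(\<Sum>c\<in>patterns L. if num_new c \<le> p then (real r - real p) ^ num_new c * F c else 0) \<le> (\<Sum>u\<in>walks r i L. F (pattern u))"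
  using F
proof (induction L arbitrary: F)
  case 0
  then show ?case by (simp add: num_new_def)
next
  case (Suc L)
  define q where "q = real r - real p"
  have q: "0 \<le> q" using pr by (simp add: q_def)
  \<comment> \<open>\<open>max 0\<close> keeps this weight non-negative, as the induction hypothesis
    asks, when \<open>c\<close> has more than \<open>r\<close> labels.\<close>
  let ?G = "\<lambda>c. (\<Sum>a\<in>set c. F (a # c)) + max 0 (real r - real (card (set c))) * F (Suc L # c)"
  have "(\<Sum>c\<in>patterns (Suc L). if num_new c \<le> p then q ^ num_new c * F c else 0) \<le> (\<Sum>c\<in>patterns L. if num_new c \<le> p then q ^ num_new c * ?G c else 0)"
    unfolding sum_patterns_Suc
  proof (intro sum_mono)
    fix c assume c: "c \<in> patterns L"
    then have new: "Suc L \<notin> set c" using patterns_set by fastforce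
    have pos: "0 < card (set c)" using patterns_nonempty[OF c] by (simp add: card_gt_0_iff)
    have 1: "num_new (a # c) = num_new c" if "a \<in> set c" for a using that by (simp add: num_new_def insert_absorb)
    have 2: "num_new (Suc L # c) = Suc (num_new c)" "card (set c) = Suc (num_new c)" using new pos by (auto simp: num_new_def)
    have 3: "(\<Sum>a\<in>set c. if num_new (a # c) \<le> p then q ^ num_new (a # c) * F (a # c) else 0)
      = (if num_new c \<le> p then q ^ num_new c * (\<Sum>a\<in>set c. F (a # c)) else 0)"
      by (simp add: 1 sum_distrib_left)
    have 4: "(if num_new (Suc L # c) \<le> p then q ^ num_new (Suc L # c) * F (Suc L # c) else 0)
      \<le> (if num_new c \<le> p then q ^ num_new c * (max 0 (real r - real (card (set c))) * F (Suc L # c)) else 0)"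
    proof (cases "num_new (Suc L # c) \<le> p")
      case True
      then have "q \<le> max 0 (real r - real (card (set c)))" unfolding 2 q_def by simp
      then have "q ^ num_new c * (q * F (Suc L # c)) \<le> q ^ num_new c * (max 0 (real r - real (card (set c))) * F (Suc L # c))"
        using q Suc.prems by (intro mult_left_mono mult_right_mono) auto
      then show ?thesis using True unfolding 2 by (simp add: mult_ac)
    next
      case False
      then show ?thesis using q Suc.prems[of "Suc L # c"] by simp
    qed
    show "(\<Sum>a\<in>set c. if num_new (a # c) \<le> p then q ^ num_new (a # c) * F (a # c) else 0)
      + (if num_new (Suc L # c) \<le> p then q ^ num_new (Suc L # c) * F (Suc L # c) else 0)
      \<le> (if num_new c \<le> p then q ^ num_new c * ?G c else 0)"
    proof -
      have "(if num_new c \<le> p then q ^ num_new c * ?G c else 0) = (if num_new c \<le> p then q ^ num_new c * (\<Sum>a\<in>set c. F (a # c)) else 0)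
        + (if num_new c \<le> p then q ^ num_new c * (max 0 (real r - real (card (set c))) * F (Suc L # c)) else 0)"
        by (simp add: distrib_left)
      then show ?thesis unfolding 3 using 4 by linarith
    qed
  qed
  also have "\<dots> \<le> (\<Sum>u\<in>walks r i L. ?G (pattern u))"
    unfolding q_def by (rule Suc.IH) (auto intro!: add_nonneg_nonneg sum_nonneg mult_nonneg_nonneg Suc.prems)
  also have "\<dots> = (\<Sum>u\<in>walks r i (Suc L). F (pattern u))"
    unfolding sum_walks_Suc
  proof (intro sum.cong refl)
    fix u assume u: "u \<in> walks r i L"
    note us = walks_set[OF i u]
    have "card (set u) \<le> r" using card_mono[OF _ us] by simp
    then have "real (card ({..<r} - set u)) = max 0 (real r - real (card (set (pattern u))))"
      using us by (simp add: card_Diff_subset card_set_pattern of_nat_diff)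
    then show "?G (pattern u) = (\<Sum>y<r. F (pattern (y # u)))"
      using sum_next_vertex[OF us, where F = "\<lambda>a. F (a # pattern u)" and g = "\<lambda>_. 1"]
        sum_labels[where F = "\<lambda>a. F (a # pattern u)" and u = u]
      by (simp add: walks_length[OF u])
  qed
  finally show ?case unfolding q_def .
qed

subsection \<open>Comparison of walk sums\<close>

definition weight :: "(nat \<Rightarrow> real) \<Rightarrow> 'e list \<Rightarrow> real" where
  "weight m E = (\<Prod>e\<in>set E. m (count_list E e))"

definition repeated :: "'e list \<Rightarrow> bool" where
  "repeated E \<longleftrightarrow> (\<forall>e\<in>set E. 2 \<le> count_list E e)"

text \<open>Edges as sets of endpoints commute with every relabelling of the vertices, which sorted
  pairs do not; this transfers weights from a walk to its pattern.\<close>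

definition uedges :: "'v list \<Rightarrow> 'v set list" where
  "uedges u = map (\<lambda>(x, y). {x, y}) (steps u)"

lemma weight_map_inj: "inj_on h (set E) \<Longrightarrow> weight m (map h E) = weight m E"
  unfolding weight_def by (simp add: prod.reindex count_list_inj_map)

lemma repeated_map_inj: "inj_on h (set E) \<Longrightarrow> repeated (map h E) = repeated E"
  unfolding repeated_def by (simp add: count_list_inj_map)

lemma steps_map: "steps (map f u) = map (map_prod f f) (steps u)"
  by (induction u rule: steps.induct) auto

lemma uedges_map: "uedges (map f u) = map (image f) (uedges u)"
  unfolding uedges_def steps_map by auto

lemma uedges_subset: "e \<in> set (uedges u) \<Longrightarrow> e \<subseteq> set u"
  unfolding uedges_def using steps_set[of u] by fastforce

lemma inj_image_uedges: "inj_on (image (label u)) (set (uedges u))"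
  by (rule inj_on_subset[OF inj_on_image_Pow[OF label_inj[of u]]]) (use uedges_subset[of _ u] in auto)

lemma uedges_sort_pair: "uedges u = map (\<lambda>e. {fst e, snd e}) (map sort_pair (steps u))"
  unfolding uedges_def by (auto simp: sort_pair_def min_def max_def)

lemma inj_doubleton_sort_pair: "inj_on (\<lambda>e. {fst e, snd e}) (set (map sort_pair E))"
proof (rule inj_onI)
  fix a b assume "a \<in> set (map sort_pair E)" "b \<in> set (map sort_pair E)" and eq: "{fst a, snd a} = {fst b, snd b}"
  then have "fst a \<le> snd a" "fst b \<le> snd b" by (auto simp: sort_pair_def)
  with eq show "a = b" by (auto simp: doubleton_eq_iff prod_eq_iff)
qed

lemma weight_uedges: "weight m (uedges u) = weight m (map sort_pair (steps u))"
  unfolding uedges_sort_pair by (rule weight_map_inj[OF inj_doubleton_sort_pair])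

lemma repeated_uedges: "repeated (uedges u) = repeated (map sort_pair (steps u))"
  unfolding uedges_sort_pair by (rule repeated_map_inj[OF inj_doubleton_sort_pair])

lemma weight_pattern: "weight m (uedges (pattern u)) = weight m (uedges u)"
  unfolding pattern_map uedges_map by (rule weight_map_inj[OF inj_image_uedges])

lemma repeated_pattern: "repeated (uedges (pattern u)) = repeated (uedges u)"
  unfolding pattern_map uedges_map by (rule repeated_map_inj[OF inj_image_uedges])

lemma closed_pattern: "u \<noteq> [] \<Longrightarrow> hd (pattern u) = last (pattern u) \<longleftrightarrow> hd u = last u"
  unfolding pattern_map using label_inj[of u] by (simp add: hd_map last_map inj_on_eq_iff)

lemma num_new_pattern: "num_new (pattern u) = num_new u"
  by (simp add: num_new_def card_set_pattern)

lemma weight_not_repeated: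
  assumes "m 1 = 0" "\<not> repeated E"
  shows "weight m E = 0"
proof -
  obtain e where e: "e \<in> set E" "count_list E e < 2" using assms(2) by (auto simp: repeated_def not_le)
  then have "count_list E e = 1" using count_list_0_iff[of E e] by linarith
  then show ?thesis unfolding weight_def using e assms(1) by (intro prod_zero bexI[of _ e]) auto
qed

lemma weight_nonneg: "(\<And>k. 0 \<le> m k) \<Longrightarrow> 0 \<le> weight m E"
  unfolding weight_def by (intro prod_nonneg) auto

text \<open>Excess multiplicities add up: the sum of \<open>count_list E e - 2\<close> over the
  edges is \<open>length E - 2 * card (set E)\<close>. Edges used exactly twice cost no factor
  \<open>K\<close>.\<close>

lemma weight_le:
  fixes \<mu> \<beta> :: "nat \<Rightarrow> real"
  assumes repeated: "repeated E" and \<mu>: "\<And>k. 2 \<le> k \<Longrightarrow> k \<le> length E \<Longrightarrow> \<bar>\<mu> k\<bar> \<le> K ^ (k - 2) * \<beta> k"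
  shows "\<bar>weight \<mu> E\<bar> \<le> K ^ (length E - 2 * card (set E)) * weight \<beta> E"
proof -
  have c: "2 \<le> count_list E e" "count_list E e \<le> length E" if "e \<in> set E" for e
    using repeated that by (auto simp: repeated_def count_le_length)
  have "(\<Sum>e\<in>set E. count_list E e - 2) = (\<Sum>e\<in>set E. count_list E e) - (\<Sum>e\<in>set E. 2)"
    by (rule sum_subtractf_nat) (use c in auto)
  also have "\<dots> = length E - 2 * card (set E)" by (simp add: sum_count_set mult.commute)
  finally have s: "(\<Sum>e\<in>set E. count_list E e - 2) = length E - 2 * card (set E)" .
  have "\<bar>weight \<mu> E\<bar> = (\<Prod>e\<in>set E. \<bar>\<mu> (count_list E e)\<bar>)" by (simp add: weight_def abs_prod)
  also have "\<dots> \<le> (\<Prod>e\<in>set E. K ^ (count_list E e - 2) * \<beta> (count_list E e))"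
    using c \<mu> by (intro prod_mono) auto
  also have "\<dots> = K ^ (length E - 2 * card (set E)) * weight \<beta> E"
    by (simp add: prod.distrib weight_def flip: s power_sum)
  finally show ?thesis .
qed

lemma num_new_le_edges:
  fixes u :: "nat list"
  shows "num_new u \<le> card (set (uedges u))"
proof -
  have "num_new u = card (set (tree_edges u))" using distinct_card[OF tree_edges_distinct] length_tree_edges by metis
  also have "\<dots> \<le> card (set (map sort_pair (steps u)))" by (intro card_mono tree_edges_subset) simp
  also have "\<dots> = card (set (uedges u))"
    unfolding uedges_sort_pair set_map[of "\<lambda>e. {fst e, snd e}"] by (rule card_image[OF inj_doubleton_sort_pair, symmetric])
  finally show ?thesis .
qed

lemma length_uedges: "length (uedges u) = length u - 1"
  by (simp add: uedges_def length_steps)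

text \<open>The weight of all closed walks with a given pattern is at most \<open>n\<close> times \<open>pattern_bound\<close> of the pattern: the
  \<open>\<sigma>\<^sup>2\<close> on the discovery edges sum to one, every other step costs a factor \<open>s\<close>.\<close>

definition pattern_bound :: "(nat \<Rightarrow> real) \<Rightarrow> real \<Rightarrow> (nat \<Rightarrow> bool) \<Rightarrow> nat list \<Rightarrow> real" where
  "pattern_bound \<mu> s Q c = (if hd c = last c \<and> repeated (uedges c) \<and> Q (num_new c) \<and> 2 * num_new c \<le> length c - 1
     then s ^ (length c - 1 - 2 * num_new c) * \<bar>weight \<mu> (uedges c)\<bar> else 0)"

text \<open>\<open>Q\<close> selects walks by their number of discoveries: it is trivial in the
  upper bound and excludes the tree walks in the lower bound.\<close>

lemma closed_walks_le_patterns: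
  assumes sym: "sym_mat n \<sigma>" and rows: "\<And>i. i < n \<Longrightarrow> (\<Sum>j<n. (\<sigma> i j)\<^sup>2) \<le> 1"
    and \<sigma>: "\<And>i j. i < n \<Longrightarrow> j < n \<Longrightarrow> 0 \<le> \<sigma> i j \<and> \<sigma> i j \<le> s" and s: "0 \<le> s" and \<mu>1: "\<mu> 1 = 0"
  shows "(\<Sum>i<n. \<Sum>u\<in>walks n i L. if hd u = i \<and> Q (num_new u) then \<bar>monomial \<sigma> (steps u) * weight \<mu> (map sort_pair (steps u))\<bar> else 0)
    \<le> real n * (\<Sum>c\<in>patterns L. pattern_bound \<mu> s Q c)"
proof -
  have "(\<Sum>u\<in>walks n i L. if hd u = i \<and> Q (num_new u) then \<bar>monomial \<sigma> (steps u) * weight \<mu> (map sort_pair (steps u))\<bar> else 0)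
      \<le> (\<Sum>c\<in>patterns L. pattern_bound \<mu> s Q c)" if i: "i < n" for i
  proof -
    have "(\<Sum>u\<in>walks n i L. if hd u = i \<and> Q (num_new u) then \<bar>monomial \<sigma> (steps u) * weight \<mu> (map sort_pair (steps u))\<bar> else 0)
      \<le> (\<Sum>u\<in>walks n i L. tree_weight \<sigma> u * pattern_bound \<mu> s Q (pattern u))"
    proof (intro sum_mono)
      fix u assume u: "u \<in> walks n i L"
      have F0: "0 \<le> tree_weight \<sigma> u * pattern_bound \<mu> s Q (pattern u)" using s tree_weight_nonneg[of \<sigma> u] by (auto simp: pattern_bound_def)
      show "(if hd u = i \<and> Q (num_new u) then \<bar>monomial \<sigma> (steps u) * weight \<mu> (map sort_pair (steps u))\<bar> else 0) \<le> tree_weight \<sigma> u * pattern_bound \<mu> s Q (pattern u)"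
      proof (cases "hd u = i \<and> Q (num_new u) \<and> repeated (map sort_pair (steps u))")
        case True
        then have "\<And>e. e \<in> set (map sort_pair (steps u)) \<Longrightarrow> 2 \<le> count_list (map sort_pair (steps u)) e" by (auto simp: repeated_def)
        note ms = monomial_sigma_le[OF sym walks_set[OF i u] \<sigma> this]
        have f: "pattern_bound \<mu> s Q (pattern u) = s ^ (length (steps u) - 2 * num_new u) * \<bar>weight \<mu> (map sort_pair (steps u))\<bar>"
          unfolding pattern_bound_def num_new_pattern repeated_pattern closed_pattern[OF walks_nonempty[OF u]] weight_pattern length_pattern
          using True walks_last[OF u] ms(1) by (simp add: weight_uedges repeated_uedges length_steps)
        have "\<bar>monomial \<sigma> (steps u) * weight \<mu> (map sort_pair (steps u))\<bar> = monomial \<sigma> (steps u) * \<bar>weight \<mu> (map sort_pair (steps u))\<bar>"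
          using ms(3) by (simp add: abs_mult)
        also have "\<dots> \<le> tree_weight \<sigma> u * s ^ (length (steps u) - 2 * num_new u) * \<bar>weight \<mu> (map sort_pair (steps u))\<bar>"
          by (rule mult_right_mono[OF ms(2) abs_ge_zero])
        finally show ?thesis using True unfolding f by (simp add: mult.assoc)
      next
        case False
        then show ?thesis using weight_not_repeated[of \<mu> "map sort_pair (steps u)"] \<mu>1 F0 by auto
      qed
    qed
    also have "\<dots> \<le> (\<Sum>c\<in>patterns L. pattern_bound \<mu> s Q c)"
      by (rule sum_walks_le_sum_patterns[OF sym rows i]) (use s in \<open>auto simp: pattern_bound_def\<close>)
    finally show ?thesis .
  qed
  from sum_mono[of "{..<n}", OF this] show ?thesis by simp
qed

text \<open>Take a pattern with \<open>m\<close> discoveries. On the left its excess steps cost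
  \<open>(s * K) ^ (2*p - 2*m)\<close>; on the right it is realised by at least
  \<open>(r - p) ^ m\<close> walks, normalised by \<open>(r - p) ^ p\<close>. The condition
  \<open>sK\<close> makes the first quantity at most the second. The factors \<open>r\<close> and
  \<open>n\<close> count starting points.\<close>

lemma walk_sum_comparison:
  fixes \<mu> \<beta> :: "nat \<Rightarrow> real"
  assumes sym: "sym_mat n \<sigma>" and rows: "\<And>i. i < n \<Longrightarrow> (\<Sum>j<n. (\<sigma> i j)\<^sup>2) \<le> 1"
    and \<sigma>: "\<And>i j. i < n \<Longrightarrow> j < n \<Longrightarrow> 0 \<le> \<sigma> i j \<and> \<sigma> i j \<le> s" and s: "0 \<le> s" and \<mu>1: "\<mu> 1 = 0"
    and \<mu>: "\<And>k. 2 \<le> k \<Longrightarrow> k \<le> 2 * p \<Longrightarrow> \<bar>\<mu> k\<bar> \<le> K ^ (k - 2) * \<beta> k"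
    and \<beta>: "\<And>k. 0 \<le> \<beta> k" and K: "1 \<le> K" and pr: "p < r" and sK: "(s * K)\<^sup>2 * (real r - real p) \<le> 1"
  shows "real r * (\<Sum>i<n. \<Sum>u\<in>walks n i (2*p). if hd u = i then \<bar>monomial \<sigma> (steps u) * weight \<mu> (map sort_pair (steps u))\<bar> else 0)
    \<le> real n * ((1 / (real r - real p)) ^ p * (\<Sum>i<r. \<Sum>u\<in>walks r i (2*p). if hd u = i then weight \<beta> (map sort_pair (steps u)) else 0))"
proof -
  define q where "q = real r - real p"
  have q: "0 < q" using pr by (simp add: q_def)
  let ?Fy = "\<lambda>c :: nat list. if hd c = last c then weight \<beta> (uedges c) else 0"
  have pt: "pattern_bound \<mu> s (\<lambda>_. True) c \<le> (1 / q) ^ p * (if num_new c \<le> p then q ^ num_new c * ?Fy c else 0)" if c: "length c = Suc (2*p)" for c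
  proof (cases "hd c = last c \<and> repeated (uedges c) \<and> 2 * num_new c \<le> 2 * p")
    case True
    then have np: "num_new c \<le> p" by simp
    have "\<bar>weight \<mu> (uedges c)\<bar> \<le> K ^ (length (uedges c) - 2 * card (set (uedges c))) * weight \<beta> (uedges c)"
      using True \<mu> c by (intro weight_le) (auto simp: length_uedges)
    also have "\<dots> \<le> K ^ (2*p - 2 * num_new c) * weight \<beta> (uedges c)"
      using num_new_le_edges[of c] K c by (intro mult_right_mono power_increasing weight_nonneg \<beta>) (auto simp: length_uedges)
    finally have "s ^ (2*p - 2 * num_new c) * \<bar>weight \<mu> (uedges c)\<bar> \<le> s ^ (2*p - 2 * num_new c) * (K ^ (2*p - 2 * num_new c) * weight \<beta> (uedges c))"
      using s by (intro mult_left_mono) auto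
    also have "\<dots> = ((s * K)\<^sup>2) ^ (p - num_new c) * weight \<beta> (uedges c)"
      by (simp add: power_mult_distrib right_diff_distrib' flip: power_mult)
    also have "\<dots> \<le> (1 / q) ^ (p - num_new c) * weight \<beta> (uedges c)"
      using sK q by (intro mult_right_mono power_mono weight_nonneg \<beta>) (auto simp: q_def[symmetric] pos_le_divide_eq)
    also have "(1 / q) ^ (p - num_new c) = (1 / q) ^ p * q ^ num_new c"
      using np q by (simp add: power_diff power_one_over field_simps)
    finally show ?thesis using True c np by (simp add: pattern_bound_def)
  next
    case False
    have "0 \<le> (1 / q) ^ p * (if num_new c \<le> p then q ^ num_new c * ?Fy c else 0)"
      using q weight_nonneg[of \<beta> "uedges c"] \<beta> by auto
    then show ?thesis using False c by (auto simp: pattern_bound_def)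
  qed
  have len: "length c = Suc L" if "c \<in> patterns L" for c L
    using that by (induction L arbitrary: c) auto
  have P: "(\<Sum>c\<in>patterns (2*p). pattern_bound \<mu> s (\<lambda>_. True) c)
      \<le> (1 / q) ^ p * (\<Sum>u\<in>walks r i (2*p). if hd u = i then weight \<beta> (map sort_pair (steps u)) else 0)" if i: "i < r" for i
  proof -
    have "(\<Sum>c\<in>patterns (2*p). pattern_bound \<mu> s (\<lambda>_. True) c) \<le> (\<Sum>c\<in>patterns (2*p). (1 / q) ^ p * (if num_new c \<le> p then q ^ num_new c * ?Fy c else 0))"
      by (intro sum_mono pt len)
    also have "\<dots> = (1 / q) ^ p * (\<Sum>c\<in>patterns (2*p). if num_new c \<le> p then (real r - real p) ^ num_new c * ?Fy c else 0)"
      unfolding q_def by (rule sum_distrib_left[symmetric])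
    also have "\<dots> \<le> (1 / q) ^ p * (\<Sum>u\<in>walks r i (2*p). ?Fy (pattern u))"
      using q pr by (intro mult_left_mono sum_patterns_le_sum_walks i) (auto intro: weight_nonneg \<beta>)
    also have "(\<Sum>u\<in>walks r i (2*p). ?Fy (pattern u)) = (\<Sum>u\<in>walks r i (2*p). if hd u = i then weight \<beta> (map sort_pair (steps u)) else 0)"
      by (intro sum.cong refl) (simp add: closed_pattern[OF walks_nonempty] walks_last weight_pattern flip: weight_uedges)
    finally show ?thesis .
  qed
  have "real r * (\<Sum>i<n. \<Sum>u\<in>walks n i (2*p). if hd u = i then \<bar>monomial \<sigma> (steps u) * weight \<mu> (map sort_pair (steps u))\<bar> else 0)
    \<le> real r * (real n * (\<Sum>c\<in>patterns (2*p). pattern_bound \<mu> s (\<lambda>_. True) c))"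
    using closed_walks_le_patterns[where \<mu> = \<mu>, OF sym rows \<sigma> s \<mu>1, where L = "2*p" and Q = "\<lambda>_. True"]
    by (intro mult_left_mono) simp_all
  also have "\<dots> = real n * (\<Sum>i<r. \<Sum>c\<in>patterns (2*p). pattern_bound \<mu> s (\<lambda>_. True) c)" by simp
  also have "\<dots> \<le> real n * (\<Sum>i<r. (1 / q) ^ p * (\<Sum>u\<in>walks r i (2*p). if hd u = i then weight \<beta> (map sort_pair (steps u)) else 0))"
    by (intro mult_left_mono sum_mono P) auto
  finally show ?thesis unfolding q_def by (simp add: sum_distrib_left)
qed

subsection \<open>Moments of sub-Gaussian variables\<close>

lemma power_div_fact_le_exp:
  fixes t :: real
  assumes "0 \<le> t"
  shows "t ^ k / fact k \<le> exp t"
proof -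
  have "(\<Sum>n\<in>{k}. t ^ n /\<^sub>R fact n) \<le> (\<Sum>n. t ^ n /\<^sub>R fact n)"
    using assms by (intro sum_le_suminf summable_exp_generic) auto
  then show ?thesis by (simp add: exp_def divide_inverse mult.commute)
qed

lemma abs_power_le_exp: "\<bar>t\<bar> ^ k / fact k \<le> exp t + exp (- t)" for t :: real
proof -
  have "\<bar>t\<bar> ^ k / fact k \<le> exp \<bar>t\<bar>" by (rule power_div_fact_le_exp) simp
  also have "\<dots> \<le> exp t + exp (- t)" by (cases "0 \<le> t") auto
  finally show ?thesis .
qed

lemma fact_double_le: "fact (2 * j) \<le> (4 ^ j * fact j * fact j :: real)"
proof (induction j)
  case (Suc j)
  have "fact (2 * Suc j) = real (2 * j + 2) * real (2 * j + 1) * fact (2 * j)" by (simp add: algebra_simps)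
  also have "\<dots> \<le> real (2 * j + 2) * real (2 * j + 2) * (4 ^ j * fact j * fact j)"
    using Suc by (intro mult_mono) auto
  also have "\<dots> = 4 ^ Suc j * fact (Suc j) * fact (Suc j)" by (simp add: algebra_simps)
  finally show ?case .
qed simp

locale subg = prob_space M for M :: "'a measure" +
  fixes \<xi> :: "'a \<Rightarrow> real" and C :: real
  assumes rv: "\<xi> \<in> borel_measurable M" and C: "0 \<le> C"
    and exp_int: "integrable M (\<lambda>x. exp (l * \<xi> x))"
    and exp_le: "(\<integral>x. exp (l * \<xi> x) \<partial>M) \<le> exp (C * l\<^sup>2)"
    and mean0: "(\<integral>x. \<xi> x \<partial>M) = 0" and var1: "(\<integral>x. (\<xi> x)\<^sup>2 \<partial>M) = 1"
begin

definition mu :: "nat \<Rightarrow> real" where "mu k = (\<integral>x. \<xi> x ^ k \<partial>M)"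

lemma power_int: "integrable M (\<lambda>x. \<xi> x ^ k)"
proof (rule Bochner_Integration.integrable_bound)
  show "integrable M (\<lambda>x. fact k * (exp (1 * \<xi> x) + exp (-1 * \<xi> x)))"
    by (intro integrable_mult_right Bochner_Integration.integrable_add exp_int)
  show "(\<lambda>x. \<xi> x ^ k) \<in> borel_measurable M" using rv by measurable
  show "AE x in M. norm (\<xi> x ^ k) \<le> norm (fact k * (exp (1 * \<xi> x) + exp (- 1 * \<xi> x)))"
    using abs_power_le_exp[of _ k] by (auto simp: power_abs field_simps abs_mult abs_of_pos add_pos_pos)
qed

text \<open>The growth \<open>fact j\<close>, up to exponential factors, matches the lower bound
  \<open>gmom_ge\<close> for the sign sums.\<close>

lemma mu_even_le: "mu (2 * j) \<le> 2 * ((4 * exp C) ^ j * fact j)" and mu_even_nonneg: "0 \<le> mu (2 * j)"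
proof -
  show "0 \<le> mu (2 * j)" unfolding mu_def by (intro Bochner_Integration.integral_nonneg) simp
  show "mu (2 * j) \<le> 2 * ((4 * exp C) ^ j * fact j)"
  proof (cases "j = 0")
    case True
    then show ?thesis by (simp add: mu_def prob_space)
  next
    case False
    \<comment> \<open>This choice makes \<open>exp (C * l^2)\<close> exponential in
      \<open>j\<close>, while \<open>l ^ (2 * j) = j ^ j\<close> cancels one of the two factorials
      of \<open>fact_double_le\<close>.\<close>
    define l where "l = sqrt (real j)"
    have l2: "l ^ (2 * j) = real j ^ j" "l\<^sup>2 = real j" by (simp_all add: l_def power_mult)
    have pt: "real j ^ j / fact (2 * j) * \<xi> x ^ (2 * j) \<le> exp (l * \<xi> x) + exp (- l * \<xi> x)" for x
      using abs_power_le_exp[of "l * \<xi> x" "2 * j"] by (simp add: abs_mult power_mult_distrib power_even_abs l2)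
    have "real j ^ j / fact (2 * j) * mu (2 * j) = (\<integral>x. real j ^ j / fact (2 * j) * \<xi> x ^ (2 * j) \<partial>M)"
      by (simp add: mu_def)
    also have "\<dots> \<le> (\<integral>x. exp (l * \<xi> x) + exp (- l * \<xi> x) \<partial>M)"
      by (intro integral_mono integrable_mult_right power_int Bochner_Integration.integrable_add exp_int pt)
    also have "\<dots> = (\<integral>x. exp (l * \<xi> x) \<partial>M) + (\<integral>x. exp (- l * \<xi> x) \<partial>M)"
      by (intro Bochner_Integration.integral_add exp_int)
    also have "\<dots> \<le> exp (C * l\<^sup>2) + exp (C * (- l)\<^sup>2)" by (intro add_mono exp_le)
    also have "\<dots> = 2 * exp C ^ j" by (simp add: l2 exp_of_nat2_mult)
    finally have "mu (2 * j) * real j ^ j \<le> 2 * exp C ^ j * fact (2 * j)" by (simp add: field_simps)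
    also have "\<dots> \<le> 2 * exp C ^ j * (4 ^ j * fact j * fact j)" by (intro mult_left_mono fact_double_le) auto
    also have "\<dots> \<le> 2 * exp C ^ j * (4 ^ j * fact j * real j ^ j)"
      using fact_le_power[of j] by (intro mult_left_mono) (auto simp: fact_le_power)
    finally show ?thesis using False by (simp add: power_mult_distrib mult_ac)
  qed
qed

lemma mu_odd_le: "\<bar>mu (2 * j + 1)\<bar> \<le> 1 + 2 * ((4 * exp C) ^ Suc j * fact (Suc j))"
proof -
  have "\<bar>mu (2 * j + 1)\<bar> \<le> (\<integral>x. \<bar>\<xi> x ^ (2 * j + 1)\<bar> \<partial>M)" unfolding mu_def by (rule integral_abs_bound)
  also have "\<dots> \<le> (\<integral>x. 1 + \<xi> x ^ (2 * Suc j) \<partial>M)"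
  proof (intro integral_mono)
    fix x
    show "\<bar>\<xi> x ^ (2 * j + 1)\<bar> \<le> 1 + \<xi> x ^ (2 * Suc j)"
    proof (cases "\<bar>\<xi> x\<bar> \<le> 1")
      case True
      then have "\<bar>\<xi> x\<bar> ^ (2 * j + 1) \<le> 1" by (intro power_le_one) auto
      moreover have "0 \<le> \<xi> x ^ (2 * Suc j)" by (rule zero_le_even_power) simp
      ultimately show ?thesis by (simp only: power_abs)
    next
      case False
      then have "\<bar>\<xi> x\<bar> ^ (2 * j + 1) \<le> \<bar>\<xi> x\<bar> ^ (2 * Suc j)" by (intro power_increasing) auto
      then show ?thesis by (simp only: power_abs) (simp add: power_even_abs)
    qed
  qed (auto intro!: integrable_abs power_int simp del: power_Suc mult_Suc_right)
  also have "\<dots> = 1 + mu (2 * Suc j)"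
    using power_int[of "2 * Suc j"] by (simp add: mu_def prob_space del: power_Suc mult_Suc_right)
  finally show ?thesis using mu_even_le[of "Suc j"] by linarith
qed

lemma mu_0: "mu 0 = 1" and mu_1: "mu 1 = 0" and mu_2: "mu 2 = 1"
  using mean0 var1 by (simp_all add: mu_def prob_space)

lemma yvar_moment_2_ge:
  assumes "0 \<le> th" "0 < N"
  shows "1 \<le> yvar_moment N th 2"
proof -
  have "1 \<le> sign_sum_moment N 2 / sqrt (real N) ^ 2" using sign_sum_moment_ge[of N 1] assms(2) by (simp add: pos_le_divide_eq)
  also have "\<dots> \<le> yvar_moment N th 2" using yvar_moment_term_le[OF assms(1), of 2 2 N] by simp
  finally show ?thesis .
qed

text \<open>The exponent \<open>k - 2\<close> is essential: at \<open>k = 2\<close> nothing is lost,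
  so walks crossing each edge twice are compared without a constant and only higher multiplicities
  pay \<open>K\<close>. \<open>K\<close> depends on \<open>th\<close> but not on
  \<open>N\<close>.\<close>

lemma moment_domination:
  assumes th: "0 < th" "th \<le> 1"
  obtains K where "1 \<le> K" "\<And>N k. 0 < N \<Longrightarrow> 2 \<le> k \<Longrightarrow> k \<le> 2 * N \<Longrightarrow> \<bar>mu k\<bar> \<le> K ^ (k - 2) * yvar_moment N th k"
proof -
  define A where "A = 16 * exp C"
  have "1 \<le> exp C" using C by simp
  then have A: "1 \<le> A" "16 \<le> A" unfolding A_def by linarith+
  \<comment> \<open>Dividing by \<open>th ^ 3\<close> compensates the small third moment of the
    skewed part for odd \<open>k\<close>; there \<open>k - 2\<close> is at least 1, so one factor
    \<open>K\<close> is available.\<close>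
  define K where "K = (2 * A)\<^sup>2 / th ^ 3"
  have th3: "0 < th ^ 3" "th ^ 3 \<le> 1" using th by (auto simp: power_le_one)
  have KA: "(2 * A)\<^sup>2 \<le> K" unfolding K_def using th3 by (simp add: pos_le_divide_eq mult_left_le)
  have "A \<le> (2 * A)\<^sup>2" using A by (simp add: power2_eq_square)
  with KA A have K: "1 \<le> K" "A \<le> K" by auto
  show thesis
  proof (rule that[OF K(1)])
    fix N k :: nat assume N: "0 < N" and k: "2 \<le> k" "k \<le> 2 * N"
    have y0: "0 \<le> yvar_moment N th k" using th by (intro yvar_moment_nonneg) auto
    show "\<bar>mu k\<bar> \<le> K ^ (k - 2) * yvar_moment N th k"
    proof (cases "even k")
      case True
      then obtain j where j: "k = 2 * j" by auto
      show ?thesis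
      proof (cases "j = 1")
        case True
        then show ?thesis using j yvar_moment_2_ge[of th N] th N mu_2 by simp
      next
        case False
        then have j2: "2 \<le> j" using k j by auto
        have "\<bar>mu k\<bar> \<le> 2 * ((4 * exp C) ^ j * fact j)" using mu_even_le mu_even_nonneg j by simp
        also have "\<dots> = 2 * (8 * exp C) ^ j * (fact j / 2 ^ j)"
        proof -
          have "8 * exp C = 2 * (4 * exp C)" by simp
          then have p: "(8 * exp C) ^ j = 2 ^ j * (4 * exp C) ^ j" by (simp only: power_mult_distrib)
          have "2 * (x * z) = 2 * (y * x) * (z / y)" if "y \<noteq> 0" for x y z :: real using that by simp
          from this[of "2 ^ j" "(4 * exp C) ^ j" "fact j"] show ?thesis unfolding p by simp
        qed
        also have "\<dots> \<le> 2 * (8 * exp C) ^ j * yvar_moment N th k"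
          unfolding j using th k j N by (intro mult_left_mono yvar_moment_even_ge) auto
        also have "\<dots> \<le> A ^ j * yvar_moment N th k"
        proof (intro mult_right_mono y0)
          have "2 * (8 * exp C) ^ j \<le> 2 ^ j * (8 * exp C) ^ j"
            using j2 power_increasing[of 1 j "2::real"] by (intro mult_right_mono) auto
          moreover have "A = 2 * (8 * exp C)" by (simp add: A_def)
          ultimately show "2 * (8 * exp C) ^ j \<le> A ^ j" by (simp only: power_mult_distrib)
        qed
        also have "\<dots> \<le> K ^ (k - 2) * yvar_moment N th k"
        proof (intro mult_right_mono y0)
          have "A ^ j \<le> A ^ (k - 2)" using A j j2 by (intro power_increasing) auto
          also have "\<dots> \<le> K ^ (k - 2)" using A K by (intro power_mono) auto
          finally show "A ^ j \<le> K ^ (k - 2)" .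
        qed
        finally show ?thesis .
      qed
    next
      case False
      then obtain m where m: "k = 2 * m + 1" by (rule oddE)
      define j where "j = m - 1"
      have j: "k = 2 * j + 3" using m k by (simp add: j_def)
      have f: "fact (Suc (Suc j)) \<le> (2 * 4 ^ j * fact j :: real)"
      proof -
        have "(real j + 2) * (real j + 1) \<le> 2 * 4 ^ j"
        proof (induction j)
          case (Suc j)
          have "(real (Suc j) + 2) * (real (Suc j) + 1) \<le> 4 * ((real j + 2) * (real j + 1))" by (simp add: algebra_simps)
          also have "\<dots> \<le> 2 * 4 ^ Suc j" using mult_left_mono[OF Suc, of 4] by simp
          finally show ?case .
        qed simp
        from mult_right_mono[OF this, of "fact j"] show ?thesis by (simp add: algebra_simps)
      qed
      have y: "6 * th ^ 3 * (fact j / 2 ^ j) \<le> yvar_moment N th k"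
        unfolding j using th k j N by (intro yvar_moment_odd_ge) auto
      have "\<bar>mu k\<bar> \<le> 1 + 2 * ((4 * exp C) ^ Suc (Suc j) * fact (Suc (Suc j)))"
        using mu_odd_le[of "Suc j"] j by (simp del: fact_Suc power_Suc add: numeral_3_eq_3)
      also have "\<dots> \<le> fact j * A ^ (j + 2) + 4 * (A ^ (j + 2) * fact j)"
      proof (intro add_mono)
        have "1 * 1 \<le> fact j * A ^ (j + 2)" using A fact_ge_1[of j] by (intro mult_mono one_le_power) auto
        then show "1 \<le> fact j * A ^ (j + 2)" by simp
        have "2 * ((4 * exp C) ^ Suc (Suc j) * fact (Suc (Suc j))) \<le> 2 * ((4 * exp C) ^ (j + 2) * (2 * 4 ^ j * fact j))"
          unfolding add_2_eq_Suc' by (rule mult_left_mono[OF mult_left_mono[OF f]]) simp_all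
        also have "\<dots> \<le> 2 * ((4 * exp C) ^ (j + 2) * (2 * 4 ^ (j + 2) * fact j))"
          by (intro mult_left_mono mult_right_mono power_increasing) auto
        also have "\<dots> = 4 * (A ^ (j + 2) * fact j)"
        proof -
          have "A = 4 * exp C * 4" by (simp add: A_def)
          then have p: "A ^ (j + 2) = (4 * exp C) ^ (j + 2) * 4 ^ (j + 2)" by (simp only: power_mult_distrib)
          have "2 * (x * (2 * y * z)) = 4 * ((x * y) * z)" for x y z :: real by simp
          from this[of "(4 * exp C) ^ (j + 2)" "4 ^ (j + 2)" "fact j"] show ?thesis unfolding p .
        qed
        finally show "2 * ((4 * exp C) ^ Suc (Suc j) * fact (Suc (Suc j))) \<le> 4 * (A ^ (j + 2) * fact j)" .
      qed
      also have "\<dots> = 5 * A ^ (j + 2) * fact j" by (simp add: algebra_simps)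
      also have "\<dots> \<le> 6 * A ^ (j + 2) * fact j" using A by (intro mult_right_mono) auto
      also have "\<dots> = A ^ (j + 2) * 2 ^ j / th ^ 3 * (6 * th ^ 3 * (fact j / 2 ^ j))" using th by simp
      also have "\<dots> \<le> A ^ (j + 2) * 2 ^ j / th ^ 3 * yvar_moment N th k" using A th by (intro mult_left_mono y) auto
      also have "\<dots> \<le> K ^ (k - 2) * yvar_moment N th k"
      proof (intro mult_right_mono y0)
        have "A ^ (j + 2) * 2 ^ j \<le> A ^ (j + 2) * 2 ^ (j + 2)" using A by (intro mult_left_mono power_increasing) auto
        also have "\<dots> = (2 * A) ^ (j + 2)" by (simp add: power_mult_distrib mult.commute)
        also have "\<dots> \<le> (2 * A) ^ (2 * (2 * j + 1))" using A by (intro power_increasing) auto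
        also have "\<dots> = ((2 * A)\<^sup>2) ^ (2 * j) * (2 * A)\<^sup>2" by (simp only: power_mult power_add power_one_right)
        finally have "A ^ (j + 2) * 2 ^ j / th ^ 3 \<le> ((2 * A)\<^sup>2) ^ (2 * j) * (2 * A)\<^sup>2 / th ^ 3"
          by (rule divide_right_mono) (use th in simp)
        also have "\<dots> = ((2 * A)\<^sup>2) ^ (2 * j) * K" by (simp only: K_def times_divide_eq_right)
        also have "\<dots> \<le> K ^ (2 * j) * K" using KA K by (intro mult_right_mono power_mono) auto
        also have "\<dots> = K ^ (k - 2)" using j by (simp flip: power_Suc2)
        finally show "A ^ (j + 2) * 2 ^ j / th ^ 3 \<le> K ^ (k - 2)" .
      qed
      finally show ?thesis .
    qed
  qed
qed

end

subsection \<open>Expected traces of the random matrix\<close>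

definition hadamard :: "(nat \<Rightarrow> nat \<Rightarrow> 'a \<Rightarrow> real) \<Rightarrow> (nat \<Rightarrow> nat \<Rightarrow> real) \<Rightarrow> 'a \<Rightarrow> nat \<Rightarrow> nat \<Rightarrow> real" where
  "hadamard W \<sigma> \<omega> i j = \<sigma> i j * W i j \<omega>"

locale rmatrix = subg +
  fixes n :: nat and W :: "nat \<Rightarrow> nat \<Rightarrow> 'a \<Rightarrow> real" and \<sigma> :: "nat \<Rightarrow> nat \<Rightarrow> real" and s :: real
  assumes n_pos: "0 < n"
    and W_rv: "W i j \<in> borel_measurable M"
    and W_sym: "i < n \<Longrightarrow> j < n \<Longrightarrow> W i j = W j i"
    and W_distr: "i \<le> j \<Longrightarrow> j < n \<Longrightarrow> distr M borel (W i j) = distr M borel \<xi>"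
    and W_indep: "indep_vars (\<lambda>_. borel) (\<lambda>(i, j). W i j) (edges n)"
    and \<sigma>_bounds: "i < n \<Longrightarrow> j < n \<Longrightarrow> 0 \<le> \<sigma> i j \<and> \<sigma> i j \<le> s"
    and \<sigma>_sym: "sym_mat n \<sigma>"
    and \<sigma>_rows: "i < n \<Longrightarrow> (\<Sum>j<n. (\<sigma> i j)\<^sup>2) = 1"
begin

definition entry :: "nat \<times> nat \<Rightarrow> 'a \<Rightarrow> real" where "entry e = W (fst e) (snd e)"

abbreviation XX :: "'a \<Rightarrow> nat \<Rightarrow> nat \<Rightarrow> real" where "XX \<equiv> hadamard W \<sigma>"

lemma s_nonneg: "0 \<le> s" using \<sigma>_bounds[OF n_pos n_pos] by linarith

lemma XX_sym: "sym_mat n (XX \<omega>)"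
  using \<sigma>_sym W_sym by (auto simp: sym_mat_def hadamard_def)

lemma entry_rv [measurable]: "entry e \<in> borel_measurable M"
  by (simp add: entry_def W_rv)

lemma entry_indep: "indep_vars (\<lambda>_. borel) entry (edges n)"
  using W_indep by (simp add: entry_def[abs_def] case_prod_beta')

lemma entry_transfer:
  fixes f :: "real \<Rightarrow> real"
  assumes "e \<in> edges n" and [measurable]: "f \<in> borel_measurable borel"
  shows "(\<integral>\<omega>. f (entry e \<omega>) \<partial>M) = (\<integral>\<omega>. f (\<xi> \<omega>) \<partial>M)"
    and "integrable M (\<lambda>\<omega>. f (entry e \<omega>)) \<longleftrightarrow> integrable M (\<lambda>\<omega>. f (\<xi> \<omega>))"
proof -
  have d: "distr M borel (entry e) = distr M borel \<xi>" using assms(1) W_distr by (auto simp: entry_def edges_def)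
  show "(\<integral>\<omega>. f (entry e \<omega>) \<partial>M) = (\<integral>\<omega>. f (\<xi> \<omega>) \<partial>M)"
    using integral_distr[of "entry e" M borel f] integral_distr[of \<xi> M borel f] rv d by simp
  show "integrable M (\<lambda>\<omega>. f (entry e \<omega>)) \<longleftrightarrow> integrable M (\<lambda>\<omega>. f (\<xi> \<omega>))"
    using integrable_distr_eq[of "entry e" M borel f] integrable_distr_eq[of \<xi> M borel f] rv d by simp
qed

lemma word_expectation:
  assumes "set vs \<subseteq> edges n"
  shows "(\<integral>\<omega>. (\<Prod>e\<leftarrow>vs. entry e \<omega>) \<partial>M) = weight mu vs" and "integrable M (\<lambda>\<omega>. \<Prod>e\<leftarrow>vs. entry e \<omega>)"
proof -
  have eq: "(\<Prod>e\<leftarrow>vs. entry e \<omega>) = (\<Prod>e\<in>set vs. entry e \<omega> ^ count_list vs e)" for \<omega>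
    by (rule prod_list_count) auto
  have ind: "indep_vars (\<lambda>_. borel) (\<lambda>e \<omega>. entry e \<omega> ^ count_list vs e) (set vs)"
    by (rule indep_vars_compose2[OF indep_vars_subset[OF entry_indep assms]]) simp
  have int: "integrable M (\<lambda>\<omega>. entry e \<omega> ^ count_list vs e)" if "e \<in> set vs" for e
    using entry_transfer(2)[of e "\<lambda>x. x ^ count_list vs e"] that assms power_int by auto
  show "integrable M (\<lambda>\<omega>. \<Prod>e\<leftarrow>vs. entry e \<omega>)"
    unfolding eq by (rule indep_vars_integrable[OF _ ind int]) auto
  have "(\<integral>\<omega>. (\<Prod>e\<leftarrow>vs. entry e \<omega>) \<partial>M) = (\<Prod>e\<in>set vs. \<integral>\<omega>. entry e \<omega> ^ count_list vs e \<partial>M)"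
    unfolding eq by (rule indep_vars_lebesgue_integral[OF _ ind int]) auto
  also have "\<dots> = weight mu vs"
    unfolding weight_def mu_def using assms by (intro prod.cong refl entry_transfer) auto
  finally show "(\<integral>\<omega>. (\<Prod>e\<leftarrow>vs. entry e \<omega>) \<partial>M) = weight mu vs" .
qed

lemma monomial_XX:
  assumes "set ws \<subseteq> {..<n} \<times> {..<n}"
  shows "monomial (XX \<omega>) ws = monomial \<sigma> ws * (\<Prod>e\<leftarrow>map sort_pair ws. entry e \<omega>)"
  using assms
proof (induction ws)
  case (Cons w ws)
  obtain x y where w: "w = (x, y)" by force
  have "entry (sort_pair (x, y)) \<omega> = W x y \<omega>"
    using Cons.prems W_sym[of x y] by (cases "x \<le> y") (auto simp: w entry_def sort_pair_def min_def max_def)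
  then show ?case using Cons by (simp add: w hadamard_def)
qed simp

lemma walk_expectation:
  assumes "i < n" "u \<in> walks n i L"
  shows "(\<integral>\<omega>. monomial (XX \<omega>) (steps u) \<partial>M) = monomial \<sigma> (steps u) * weight mu (map sort_pair (steps u))"
    and "integrable M (\<lambda>\<omega>. monomial (XX \<omega>) (steps u))"
proof -
  have s: "set (steps u) \<subseteq> {..<n} \<times> {..<n}" using steps_set[of u] walks_set[OF assms] by blast
  show "(\<integral>\<omega>. monomial (XX \<omega>) (steps u) \<partial>M) = monomial \<sigma> (steps u) * weight mu (map sort_pair (steps u))"
    unfolding monomial_XX[OF s] using word_expectation(1)[OF sort_pair_set[OF s]] by (simp del: map_map)
  show "integrable M (\<lambda>\<omega>. monomial (XX \<omega>) (steps u))"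
    unfolding monomial_XX[OF s] using word_expectation(2)[OF sort_pair_set[OF s]] by (rule integrable_mult_right)
qed

lemma trace_pow_integrable: "integrable M (\<lambda>\<omega>. trace_pow n (XX \<omega>) L)"
  unfolding trace_pow_walks by (auto intro!: Bochner_Integration.integrable_sum integrable_mult_left walk_expectation)

lemma trace_pow_expectation:
  "(\<integral>\<omega>. trace_pow n (XX \<omega>) L \<partial>M) = (\<Sum>i<n. \<Sum>u\<in>walks n i L. if hd u = i then monomial \<sigma> (steps u) * weight mu (map sort_pair (steps u)) else 0)"
proof -
  have "(\<integral>\<omega>. trace_pow n (XX \<omega>) L \<partial>M) = (\<Sum>i<n. \<Sum>u\<in>walks n i L. \<integral>\<omega>. monomial (XX \<omega>) (steps u) * (if hd u = i then 1 else 0) \<partial>M)"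
    unfolding trace_pow_walks
    by (subst Bochner_Integration.integral_sum, force intro!: Bochner_Integration.integrable_sum integrable_mult_left walk_expectation,
      intro sum.cong refl Bochner_Integration.integral_sum integrable_mult_left walk_expectation) auto
  also have "\<dots> = (\<Sum>i<n. \<Sum>u\<in>walks n i L. if hd u = i then monomial \<sigma> (steps u) * weight mu (map sort_pair (steps u)) else 0)"
    by (intro sum.cong refl) (auto simp: walk_expectation)
  finally show ?thesis .
qed

lemma expected_trace_le:
  assumes c: "\<And>r N P th. 0 < r \<Longrightarrow> 0 < N \<Longrightarrow> 0 \<le> th \<Longrightarrow> real P \<le> c * real r \<Longrightarrow>
     avg (samples r (comparison_space N)) (\<lambda>\<omega>. trace_pow r (rmat (yvar N th) \<omega>) (2 * P)) \<le> 4 * (real r)\<^sup>2 * ((1 + 3 * th)\<^sup>2 * (4 * \<kappa> * real r)) ^ P"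
    and K: "1 \<le> K" "\<And>N k. 0 < N \<Longrightarrow> 2 \<le> k \<Longrightarrow> k \<le> 2 * N \<Longrightarrow> \<bar>mu k\<bar> \<le> K ^ (k - 2) * yvar_moment N th k"
    and th: "0 \<le> th" and p: "0 < p" "p < r" "real p \<le> c * real r" and sK: "(s * K)\<^sup>2 * (real r - real p) \<le> 1"
  shows "(\<integral>\<omega>. trace_pow n (XX \<omega>) (2 * p) \<partial>M)
    \<le> 4 * real n * real r * (real r / (real r - real p) * ((1 + 3 * th)\<^sup>2 * (4 * \<kappa>))) ^ p"
proof -
  have r: "0 < r" using p by simp
  \<comment> \<open>\<open>p\<close> signs suffice, as a walk of length \<open>2 * p\<close> uses no
    edge more than \<open>2 * p\<close> times.\<close>
  let ?\<beta> = "yvar_moment p th"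
  have wt: "avg (samples r (comparison_space p)) (\<lambda>\<omega>. monomial (rmat (yvar p th) \<omega>) (steps u)) = weight ?\<beta> (map sort_pair (steps u))"
    if "i < r" "u \<in> walks r i (2 * p)" for i u
  proof -
    have s: "set (steps u) \<subseteq> {..<r} \<times> {..<r}" using steps_set[of u] walks_set[OF that] by blast
    have "avg (samples r (comparison_space p)) (\<lambda>\<omega>. monomial (rmat (yvar p th) \<omega>) (steps u)) = moment_prod r ?\<beta> (map sort_pair (steps u))"
      unfolding yvar_moment_def[abs_def] by (rule avg_monomial_rmat[OF finite_comparison_space s])
    also have "\<dots> = weight ?\<beta> (map sort_pair (steps u))"
      unfolding moment_prod_def weight_def
    proof (rule prod.mono_neutral_right[OF finite_edges sort_pair_set[OF s]], intro ballI)
      fix e assume "e \<in> edges r - set (map sort_pair (steps u))"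
      then have "count_list (map sort_pair (steps u)) e = 0" by (simp only: count_list_0_iff) simp
      then show "?\<beta> (count_list (map sort_pair (steps u)) e) = 1" by (simp only: yvar_moment_0)
    qed
    finally show ?thesis .
  qed
  have Y: "(\<Sum>i<r. \<Sum>u\<in>walks r i (2*p). if hd u = i then weight ?\<beta> (map sort_pair (steps u)) else 0)
     = avg (samples r (comparison_space p)) (\<lambda>\<omega>. trace_pow r (rmat (yvar p th) \<omega>) (2 * p))"
    unfolding trace_pow_walks avg_sum
  proof (intro sum.cong refl)
    fix i u assume iu: "i \<in> {..<r}" "u \<in> walks r i (2 * p)"
    have "avg (samples r (comparison_space p)) (\<lambda>\<omega>. monomial (rmat (yvar p th) \<omega>) (steps u) * (if hd u = i then 1 else 0))
      = avg (samples r (comparison_space p)) (\<lambda>\<omega>. (if hd u = i then 1 else 0) * monomial (rmat (yvar p th) \<omega>) (steps u))"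
      by (simp only: mult.commute)
    also have "\<dots> = (if hd u = i then weight ?\<beta> (map sort_pair (steps u)) else 0)"
      unfolding avg_cmult using wt iu by simp
    finally show "(if hd u = i then weight ?\<beta> (map sort_pair (steps u)) else 0)
       = avg (samples r (comparison_space p)) (\<lambda>\<omega>. monomial (rmat (yvar p th) \<omega>) (steps u) * (if hd u = i then 1 else 0))" by simp
  qed
  have "real r * (\<integral>\<omega>. trace_pow n (XX \<omega>) (2 * p) \<partial>M) = real r * (\<Sum>i<n. \<Sum>u\<in>walks n i (2*p). if hd u = i then monomial \<sigma> (steps u) * weight mu (map sort_pair (steps u)) else 0)"
    by (simp only: trace_pow_expectation)
  also have "\<dots> \<le> real r * (\<Sum>i<n. \<Sum>u\<in>walks n i (2*p). if hd u = i then \<bar>monomial \<sigma> (steps u) * weight mu (map sort_pair (steps u))\<bar> else 0)"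
    by (intro mult_left_mono sum_mono) auto
  also have "\<dots> \<le> real n * ((1 / (real r - real p)) ^ p * (\<Sum>i<r. \<Sum>u\<in>walks r i (2*p). if hd u = i then weight ?\<beta> (map sort_pair (steps u)) else 0))"
    by (rule walk_sum_comparison[where K = K and s = s])
      (use \<sigma>_sym \<sigma>_rows \<sigma>_bounds s_nonneg mu_1 K p sK yvar_moment_nonneg[OF th] in auto)
  also have "\<dots> \<le> real n * ((1 / (real r - real p)) ^ p * (4 * (real r)\<^sup>2 * ((1 + 3 * th)\<^sup>2 * (4 * \<kappa> * real r)) ^ p))"
    unfolding Y using p r th by (intro mult_left_mono c) auto
  also have "\<dots> = real r * (4 * real n * real r * ((1 / (real r - real p)) ^ p * ((1 + 3 * th)\<^sup>2 * (4 * \<kappa> * real r)) ^ p))"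
    by (simp add: power2_eq_square mult_ac)
  also have "(1 / (real r - real p)) ^ p * ((1 + 3 * th)\<^sup>2 * (4 * \<kappa> * real r)) ^ p
     = (real r / (real r - real p) * ((1 + 3 * th)\<^sup>2 * (4 * \<kappa>))) ^ p"
    unfolding power_mult_distrib[symmetric] by (rule arg_cong[of _ _ "\<lambda>x. x ^ p"]) simp
  finally show ?thesis using r by simp
qed

end

subsection \<open>The upper tail\<close>

context subg
begin

text \<open>Valid for all \<open>n\<close> at once, as long as \<open>s^2 * p\<close> is small. It
  serves the upper tail with \<open>p\<close> of order \<open>log n\<close> and the second moment in
  Paley-Zygmund with fixed \<open>p\<close>.\<close>

lemma uniform_trace_bound:
  assumes \<epsilon>: "0 < \<epsilon>"
  obtains D A :: real where "0 < D" "0 < A"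
    "\<And>n W \<sigma> s p. rmatrix M \<xi> C n W \<sigma> s \<Longrightarrow> 0 < p \<Longrightarrow> s\<^sup>2 * A * real p \<le> 1 \<Longrightarrow>
      (\<integral>\<omega>. trace_pow n (hadamard W \<sigma> \<omega>) (2 * p) \<partial>M) \<le> D * real n * real p * (2 + \<epsilon>) ^ (2 * p)"
proof -
  \<comment> \<open>\<open>12 * e <= \<epsilon>\<close> gives
    \<open>2 * \<kappa>^2 <= 2 + \<epsilon>\<close>. The rate \<open>4 * \<kappa>^4\<close> collects
    one \<open>\<kappa>\<close> from the Wick bound, two from \<open>1 + 3 * th\<close> and one from
    \<open>r / (r - p)\<close>.\<close>
  define e where "e = min 1 (\<epsilon> / 12)"
  have e: "0 < e" "e \<le> 1" "12 * e \<le> \<epsilon>" using \<epsilon> by (auto simp: e_def)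
  define \<kappa> where "\<kappa> = 1 + e"
  define th where "th = e / 3"
  have th: "0 < th" "th \<le> 1" "1 + 3 * th = \<kappa>" using e by (auto simp: th_def \<kappa>_def)
  have \<kappa>: "1 < \<kappa>" using e by (simp add: \<kappa>_def)
  have base: "\<kappa> * (\<kappa>\<^sup>2 * (4 * \<kappa>)) \<le> (2 + \<epsilon>)\<^sup>2"
  proof -
    have "e * e \<le> e" using mult_left_mono[of e 1 e] e by simp
    moreover have "2 * \<kappa>\<^sup>2 = 2 + 4 * e + 2 * (e * e)" by (simp add: \<kappa>_def power2_eq_square algebra_simps)
    ultimately have "2 * \<kappa>\<^sup>2 \<le> 2 + \<epsilon>" using e by linarith
    then have "(2 * \<kappa>\<^sup>2)\<^sup>2 \<le> (2 + \<epsilon>)\<^sup>2" by (intro power_mono) auto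
    then show ?thesis by (simp add: power2_eq_square mult_ac)
  qed
  obtain c where c: "0 < c" and cb: "\<And>r N P th. 0 < r \<Longrightarrow> 0 < N \<Longrightarrow> 0 \<le> th \<Longrightarrow> real P \<le> c * real r \<Longrightarrow>
     avg (samples r (comparison_space N)) (\<lambda>\<omega>. trace_pow r (rmat (yvar N th) \<omega>) (2 * P)) \<le> 4 * (real r)\<^sup>2 * ((1 + 3 * th)\<^sup>2 * (4 * \<kappa> * real r)) ^ P"
    using Y_trace_bound[OF \<kappa>] by blast
  obtain K where K: "1 \<le> K" "\<And>N k. 0 < N \<Longrightarrow> 2 \<le> k \<Longrightarrow> k \<le> 2 * N \<Longrightarrow> \<bar>mu k\<bar> \<le> K ^ (k - 2) * yvar_moment N th k"
    using moment_domination[OF th(1,2)] by blast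
  \<comment> \<open>The comparison matrix has size \<open>r = D * p\<close>, large enough for
    \<open>p <= c * r\<close> and for \<open>D / (D - 1) <= \<kappa>\<close>.\<close>
  obtain D :: nat where D: "max (1 / c) (\<kappa> / e) \<le> real D" using real_arch_simple by blast
  have De: "\<kappa> \<le> e * real D" using D e by (simp add: pos_divide_le_eq mult.commute)
  have Dc: "1 \<le> c * real D" using D c by (simp add: pos_divide_le_eq mult.commute)
  have D1: "1 < real D"
  proof -
    have "e * 1 < e * real D" using De e unfolding \<kappa>_def by linarith
    then show ?thesis using e(1) by (simp only: mult_less_cancel_left_pos)
  qed
  \<comment> \<open>Chosen so that \<open>s^2 * A * p <= 1\<close> is the condition
    \<open>(s * K)^2 * (r - p) <= 1\<close>.\<close>
  define A where "A = K\<^sup>2 * (real D - 1)"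
  have A: "0 < A" using K D1 by (simp add: A_def)
  show thesis
  proof (rule that[of "4 * real D" A])
    fix n W \<sigma> s p assume rm: "rmatrix M \<xi> C n W \<sigma> s" and p: "0 < p" and s: "s\<^sup>2 * A * real p \<le> 1"
    interpret rmatrix M \<xi> C n W \<sigma> s by (rule rm)
    have rp: "real (D * p) - real p = (real D - 1) * real p" by (simp add: algebra_simps)
    have "(\<integral>\<omega>. trace_pow n (hadamard W \<sigma> \<omega>) (2 * p) \<partial>M)
      \<le> 4 * real n * real (D * p) * (real (D * p) / (real (D * p) - real p) * ((1 + 3 * th)\<^sup>2 * (4 * \<kappa>))) ^ p"
    proof (rule expected_trace_le[OF cb K])
      show "p < D * p" using D1 p by simp
      show "real p \<le> c * real (D * p)" using mult_right_mono[OF Dc, of "real p"] by simp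
      show "(s * K)\<^sup>2 * (real (D * p) - real p) \<le> 1" using s unfolding rp A_def by (simp add: power_mult_distrib mult_ac)
    qed (use th p in auto)
    also have "\<dots> \<le> 4 * real n * real (D * p) * ((2 + \<epsilon>)\<^sup>2) ^ p"
    proof (intro mult_left_mono power_mono)
      have "real (D * p) / (real (D * p) - real p) = real D / (real D - 1)" unfolding rp using p by simp
      also have "\<dots> \<le> \<kappa>" using D1 De by (simp add: pos_divide_le_eq \<kappa>_def algebra_simps)
      finally have "real (D * p) / (real (D * p) - real p) * ((1 + 3 * th)\<^sup>2 * (4 * \<kappa>)) \<le> \<kappa> * (\<kappa>\<^sup>2 * (4 * \<kappa>))"
        unfolding th(3) using \<kappa> by (intro mult_right_mono) auto
      then show "real (D * p) / (real (D * p) - real p) * ((1 + 3 * th)\<^sup>2 * (4 * \<kappa>)) \<le> (2 + \<epsilon>)\<^sup>2" using base by linarith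
      show "0 \<le> real (D * p) / (real (D * p) - real p) * ((1 + 3 * th)\<^sup>2 * (4 * \<kappa>))"
        unfolding rp using D1 \<kappa> by (intro mult_nonneg_nonneg divide_nonneg_nonneg) auto
    qed auto
    finally show "(\<integral>\<omega>. trace_pow n (hadamard W \<sigma> \<omega>) (2 * p) \<partial>M) \<le> 4 * real D * real n * real p * (2 + \<epsilon>) ^ (2 * p)"
      unfolding power_mult by (simp add: mult_ac)
  qed (use D1 A in auto)
qed

end

locale rmatrix_seq = subg +
  fixes W :: "nat \<Rightarrow> nat \<Rightarrow> nat \<Rightarrow> 'a \<Rightarrow> real" and \<sigma> :: "nat \<Rightarrow> nat \<Rightarrow> nat \<Rightarrow> real" and s :: "nat \<Rightarrow> real"
  assumes rmatrix: "0 < n \<Longrightarrow> rmatrix M \<xi> C n (W n) (\<sigma> n) (s n)"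
    and s_log: "(\<lambda>n. s n * sqrt (ln (real n))) \<longlonglongrightarrow> 0"
begin

abbreviation X :: "nat \<Rightarrow> 'a \<Rightarrow> nat \<Rightarrow> nat \<Rightarrow> real" where "X n \<equiv> hadamard (W n) (\<sigma> n)"

lemma s_nonneg: "0 < n \<Longrightarrow> 0 \<le> s n"
  using rmatrix.s_nonneg[OF rmatrix] .

lemma s2_log: "(\<lambda>n. (s n)\<^sup>2 * ln (real n)) \<longlonglongrightarrow> 0"
proof -
  have "(\<lambda>n. (s n * sqrt (ln (real n)))\<^sup>2) \<longlonglongrightarrow> 0\<^sup>2" by (intro tendsto_power s_log)
  moreover have "\<forall>\<^sub>F n in sequentially. (s n * sqrt (ln (real n)))\<^sup>2 = (s n)\<^sup>2 * ln (real n)"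
    using eventually_gt_at_top[of 0] by eventually_elim (simp add: power_mult_distrib)
  ultimately show ?thesis by (simp add: tendsto_cong)
qed

lemma s_tendsto_0: "s \<longlonglongrightarrow> 0"
proof (rule tendsto_sandwich[OF _ _ tendsto_const s_log])
  show "\<forall>\<^sub>F n in sequentially. 0 \<le> s n" using eventually_gt_at_top[of 0] by eventually_elim (rule s_nonneg)
  have "\<forall>\<^sub>F n :: nat in sequentially. 1 \<le> sqrt (ln (real n))" by real_asymp
  with eventually_gt_at_top[of 0] show "\<forall>\<^sub>F n in sequentially. s n \<le> s n * sqrt (ln (real n))"
  proof eventually_elim
    case (elim n)
    then show ?case using mult_left_mono[of 1 "sqrt (ln (real n))" "s n"] s_nonneg[of n] by simp
  qed
qed

text \<open>Markov's inequality for the trace of order \<open>2 * p n\<close>. The ratio of the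
  bases \<open>2 + \<epsilon> / 2\<close> and \<open>2 + \<epsilon>\<close> gains
  \<open>n ^ 4\<close>; the trace bound spends one factor \<open>n\<close>, and
  \<open>D * p n\<close> at most another. What remains is \<open>1 / n^2\<close>.\<close>

lemma upper_tail:
  assumes \<epsilon>: "0 < \<epsilon>"
  obtains E where "\<And>n. E n \<in> events" "\<forall>\<^sub>F n in sequentially. prob (E n) \<le> 1 / (real n)\<^sup>2"
    "\<And>n \<omega>. 0 < n \<Longrightarrow> \<omega> \<in> space M \<Longrightarrow> \<omega> \<notin> E n \<Longrightarrow> spec_norm n (X n \<omega>) < 2 + \<epsilon>"
proof -
  obtain D A :: real where DA: "0 < D" "0 < A" and b:
    "\<And>n W \<sigma> s p. rmatrix M \<xi> C n W \<sigma> s \<Longrightarrow> 0 < p \<Longrightarrow> s\<^sup>2 * A * real p \<le> 1 \<Longrightarrow>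
      (\<integral>\<omega>. trace_pow n (hadamard W \<sigma> \<omega>) (2 * p) \<partial>M) \<le> D * real n * real p * (2 + \<epsilon> / 2) ^ (2 * p)"
    using uniform_trace_bound[of "\<epsilon> / 2"] \<epsilon> by auto
  define q where "q = ln ((2 + \<epsilon>) / (2 + \<epsilon> / 2))"
  have q: "0 < q" using \<epsilon> by (simp add: q_def)
  define L where "L = 2 / q"
  have L: "0 < L" using q by (simp add: L_def)
  define p where "p n = nat \<lceil>L * ln (real n)\<rceil>" for n :: nat
  have p_ge: "L * ln (real n) \<le> real (p n)" for n unfolding p_def by linarith
  have p_le: "\<forall>\<^sub>F n in sequentially. real (p n) \<le> L * ln (real n) + 1"
    using eventually_gt_at_top[of 1]
  proof eventually_elim
    case (elim n)
    then have "0 \<le> L * ln (real n)" using L by simp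
    then show ?case unfolding p_def by linarith
  qed
  \<comment> \<open>Stated through the trace, a polynomial in the entries, so that measurability is
    immediate; empty for \<open>n = 0\<close>, where the locale \<open>rmatrix\<close> is not at
    hand.\<close>
  define E where "E n = {\<omega> \<in> space M. (2 + \<epsilon>) ^ (2 * p n) \<le> trace_pow n (X n \<omega>) (2 * p n)} \<inter> (if 0 < n then UNIV else {})" for n
  have int: "integrable M (\<lambda>\<omega>. trace_pow n (X n \<omega>) k)" if "0 < n" for n k
    by (rule rmatrix.trace_pow_integrable[OF rmatrix[OF that]])
  have ev: "E n \<in> events" for n
  proof (cases "0 < n")
    case True
    from int[OF True, of "2 * p n"] have [measurable]: "(\<lambda>\<omega>. trace_pow n (X n \<omega>) (2 * p n)) \<in> borel_measurable M" by (rule borel_measurable_integrable)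
    show ?thesis using True unfolding E_def by simp
  qed (simp add: E_def)
  have l1: "\<forall>\<^sub>F n :: nat in sequentially. D * (L * ln (real n) + 1) \<le> real n"
  proof -
    have "(\<lambda>n :: nat. D * (L * ln (real n) + 1) / real n) \<longlonglongrightarrow> 0" by real_asymp
    then have "\<forall>\<^sub>F n in sequentially. D * (L * ln (real n) + 1) / real n < 1" by (rule order_tendstoD) simp
    with eventually_gt_at_top[of 0] show ?thesis by eventually_elim (simp add: field_simps)
  qed
  have l2: "\<forall>\<^sub>F n in sequentially. (s n)\<^sup>2 * A * real (p n) \<le> 1"
  proof -
    have "(\<lambda>n. A * (L + 1) * ((s n)\<^sup>2 * ln (real n))) \<longlonglongrightarrow> A * (L + 1) * 0" by (intro tendsto_mult s2_log tendsto_const)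
    then have "\<forall>\<^sub>F n in sequentially. A * (L + 1) * ((s n)\<^sup>2 * ln (real n)) < 1" by (rule order_tendstoD) simp
    moreover have "\<forall>\<^sub>F n :: nat in sequentially. 1 \<le> ln (real n)" by real_asymp
    ultimately show ?thesis using p_le
    proof eventually_elim
      case (elim n)
      have "real (p n) \<le> (L + 1) * ln (real n)" using elim by (simp add: algebra_simps)
      then have "(s n)\<^sup>2 * A * real (p n) \<le> (s n)\<^sup>2 * A * ((L + 1) * ln (real n))" using DA by (intro mult_left_mono) auto
      then show ?case using elim by (simp add: mult_ac)
    qed
  qed
  have "\<forall>\<^sub>F n in sequentially. prob (E n) \<le> 1 / (real n)\<^sup>2"
    using l1 l2 p_le eventually_gt_at_top[of 1]
  proof eventually_elim
    case (elim n)
    have n: "0 < n" "1 < real n" using elim by auto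
    have pn: "0 < p n" using p_ge[of n] L n by (metis gr0I ln_gt_zero mult_pos_pos not_le of_nat_0)
    have e0: "0 < (2 + \<epsilon>) ^ (2 * p n)" using \<epsilon> by simp
    have "prob (E n) = measure M {\<omega> \<in> space M. (2 + \<epsilon>) ^ (2 * p n) \<le> trace_pow n (X n \<omega>) (2 * p n)}" using n by (simp add: E_def)
    also have "\<dots> \<le> (\<integral>\<omega>. trace_pow n (X n \<omega>) (2 * p n) \<partial>M) / (2 + \<epsilon>) ^ (2 * p n)"
    proof (rule integral_Markov_inequality_measure[OF int[OF n(1)] sets.empty_sets _ e0])
      show "AE \<omega> in M. 0 \<le> trace_pow n (X n \<omega>) (2 * p n)"
        using rmatrix.XX_sym[OF rmatrix[OF n(1)]] by (intro AE_I2 trace_pow_even_nonneg) auto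
    qed
    also have "\<dots> \<le> D * real n * real (p n) * (2 + \<epsilon> / 2) ^ (2 * p n) / (2 + \<epsilon>) ^ (2 * p n)"
      using e0 elim pn by (intro divide_right_mono b[OF rmatrix[OF n(1)]]) auto
    also have "\<dots> = D * real n * real (p n) * ((2 + \<epsilon> / 2) / (2 + \<epsilon>)) ^ (2 * p n)" by (simp add: power_divide)
    also have "((2 + \<epsilon> / 2) / (2 + \<epsilon>)) = exp (- q)" using \<epsilon> by (simp add: q_def exp_minus)
    also have "exp (- q) ^ (2 * p n) = exp (- (2 * q * real (p n)))" by (simp flip: exp_of_nat_mult)
    also have "\<dots> \<le> exp (- (4 * ln (real n)))"
    proof -
      have "2 * ln (real n) \<le> q * real (p n)" using mult_left_mono[OF p_ge[of n], of q] q by (simp add: L_def)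
      then show ?thesis by simp
    qed
    also have "exp (- (4 * ln (real n))) = 1 / real n ^ 4"
    proof -
      have "exp (4 * ln (real n)) = real n ^ 4" using n exp_of_nat_mult[of 4 "ln (real n)"] by simp
      then show ?thesis by (simp add: exp_minus divide_inverse)
    qed
    also have "D * real n * real (p n) * (1 / real n ^ 4) \<le> real n * real n * (1 / real n ^ 4)"
    proof -
      have "D * real (p n) \<le> D * (L * ln (real n) + 1)" using DA elim by (intro mult_left_mono) auto
      then have "D * real (p n) \<le> real n" using elim by linarith
      from mult_right_mono[OF this, of "real n * (1 / real n ^ 4)"] show ?thesis by (simp add: mult_ac)
    qed
    also have "\<dots> = 1 / (real n)\<^sup>2" using n by (simp add: power2_eq_square power4_eq_xxxx)
    finally show ?case using DA by (simp add: mult_left_mono)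
  qed
  moreover have "spec_norm n (X n \<omega>) < 2 + \<epsilon>" if n: "0 < n" and \<omega>: "\<omega> \<in> space M" "\<omega> \<notin> E n" for n \<omega>
  proof (rule ccontr)
    assume "\<not> ?thesis"
    then have "(2 + \<epsilon>) ^ (2 * p n) \<le> spec_norm n (X n \<omega>) ^ (2 * p n)" using \<epsilon> by (intro power_mono) auto
    also have "\<dots> \<le> trace_pow n (X n \<omega>) (2 * p n)"
      using n rmatrix.XX_sym[OF rmatrix[OF n]] by (rule spec_norm_power_le_trace_pow)
    finally show False using \<omega> n by (simp add: E_def)
  qed
  ultimately show thesis using that ev by blast
qed

end

subsection \<open>Dyck walks\<close>

text \<open>The number of paths with steps 1 and -1 that lead from height \<open>d\<close> to height
  0 in \<open>t\<close> steps and never become negative.\<close>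

fun ballot :: "nat \<Rightarrow> nat \<Rightarrow> real" where
  "ballot 0 d = (if d = 0 then 1 else 0)"
| "ballot (Suc t) 0 = ballot t 1"
| "ballot (Suc t) (Suc d) = ballot t (Suc (Suc d)) + ballot t d"

lemma ballot_nonneg: "0 \<le> ballot t d"
  by (induction t d rule: ballot.induct) auto

lemma ballot_ge_1: "d \<le> t \<Longrightarrow> even (t + d) \<Longrightarrow> 1 \<le> ballot t d"
proof (induction t d rule: ballot.induct)
  case (2 t)
  then have "1 \<le> t" by (cases t) auto
  then show ?case using 2 by simp
next
  case (3 t d)
  then have "1 \<le> ballot t d" by simp
  then show ?case using ballot_nonneg[of t "Suc (Suc d)"] by simp
qed auto

text \<open>The vector \<open>sin ((d + 1) \<pi> / (H + 2))\<close> is an eigenvector of the path of length \<open>H\<close> with eigenvalue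
  \<open>2 cos (\<pi> / (H + 2))\<close>.\<close>

lemma ballot_ge_sin:
  fixes H :: nat
  defines "\<alpha> \<equiv> pi / real (H + 2)"
  assumes "d \<le> H" "even (H + t + d)"
  shows "(2 * cos \<alpha>) ^ t * sin (real (d + 1) * \<alpha>) \<le> ballot (H + t) d"
  using assms(2,3)
proof (induction t arbitrary: d)
  case 0
  then have "1 \<le> ballot H d" using ballot_ge_1[of d H] by simp
  then show ?case using order_trans[OF sin_le_one] by simp
next
  case (Suc t)
  have "0 \<le> \<alpha>" by (simp add: \<alpha>_def)
  moreover have "\<alpha> \<le> pi / 2" unfolding \<alpha>_def by (intro divide_left_mono) auto
  ultimately have cos0: "0 \<le> 2 * cos \<alpha>" by (intro mult_nonneg_nonneg cos_ge_zero) auto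
  have up: "(2 * cos \<alpha>) ^ t * sin (real (d + 2) * \<alpha>) \<le> ballot (H + t) (Suc d)"
  \<comment> \<open>The eigenvector vanishes one level above \<open>H\<close>, so paths leaving the
    strip may be ignored.\<close>
  proof (cases "d = H")
    case True
    then have "sin (real (d + 2) * \<alpha>) = 0" by (simp add: \<alpha>_def)
    then show ?thesis using ballot_nonneg by simp
  next
    case False
    then show ?thesis using Suc.IH[of "Suc d"] Suc.prems by simp
  qed
  have trig: "2 * cos \<alpha> * sin (real (d + 1) * \<alpha>) = sin (real (d + 2) * \<alpha>) + sin (real d * \<alpha>)"
  proof -
    have "real (d + 2) * \<alpha> = real (d + 1) * \<alpha> + \<alpha>" "real d * \<alpha> = real (d + 1) * \<alpha> - \<alpha>" by (simp_all add: algebra_simps)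
    then show ?thesis by (simp add: sin_add sin_diff)
  qed
  have "(2 * cos \<alpha>) ^ Suc t * sin (real (d + 1) * \<alpha>) = (2 * cos \<alpha>) ^ t * (2 * cos \<alpha> * sin (real (d + 1) * \<alpha>))"
    by (simp only: power_Suc2 mult.assoc)
  also have "\<dots> = (2 * cos \<alpha>) ^ t * sin (real (d + 2) * \<alpha>) + (2 * cos \<alpha>) ^ t * sin (real d * \<alpha>)"
    unfolding trig by (rule distrib_left)
  also have "\<dots> \<le> ballot (H + Suc t) d"
  proof (cases d)
    case 0
    then show ?thesis using up by simp
  next
    case (Suc e)
    have "(2 * cos \<alpha>) ^ t * sin (real (e + 1) * \<alpha>) \<le> ballot (H + t) e"
      using Suc.IH[of e] Suc.prems Suc by simp
    then show ?thesis using up Suc by simp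
  qed
  finally show ?case .
qed

text \<open>Choose the strip height \<open>H\<close> such that \<open>2 * cos (pi / (H + 2))\<close>
  exceeds the midpoint of \<open>\<rho>\<close> and 2; the ratio of midpoint and
  \<open>\<rho>\<close> then absorbs \<open>V\<close> and the constants depending on
  \<open>H\<close>.\<close>

lemma ballot_growth:
  assumes \<rho>: "0 < \<rho>" "\<rho> < 2"
  obtains k where "0 < k" "V * \<rho> ^ (2 * k) \<le> ballot (2 * k) 0"
proof -
  define \<rho>' where "\<rho>' = (\<rho> + 2) / 2"
  have \<rho>': "\<rho> < \<rho>'" "\<rho>' < 2" "0 < \<rho>'" using \<rho> by (auto simp: \<rho>'_def)
  have "(\<lambda>H :: nat. 2 * cos (pi / real (H + 2))) \<longlonglongrightarrow> 2 * cos 0"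
    by (intro tendsto_mult tendsto_cos tendsto_const) real_asymp
  then have "\<forall>\<^sub>F H in sequentially. \<rho>' < 2 * cos (pi / real (H + 2))"
    by (rule order_tendstoD) (use \<rho>' in simp)
  then obtain H :: nat where H: "\<rho>' < 2 * cos (pi / real (H + 2))" by (auto simp: eventually_sequentially)
  define S where "S = sin (pi / real (H + 2))"
  have "pi / real (H + 2) \<le> pi / 2" by (intro divide_left_mono) auto
  then have S: "0 < S" unfolding S_def using pi_gt_zero by (intro sin_gt_zero) (simp, linarith)
  have g: "\<rho>' ^ (2 * k) / \<rho>' ^ H * S \<le> ballot (2 * k) 0" if "H \<le> 2 * k" for k
  proof -
    have "\<rho>' ^ (2 * k) / \<rho>' ^ H = \<rho>' ^ (2 * k - H)" using \<rho>' that by (simp add: power_diff)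
    also have "\<dots> \<le> (2 * cos (pi / real (H + 2))) ^ (2 * k - H)" using H \<rho>' by (intro power_mono) auto
    finally have "\<rho>' ^ (2 * k) / \<rho>' ^ H * S \<le> (2 * cos (pi / real (H + 2))) ^ (2 * k - H) * sin (real (0 + 1) * (pi / real (H + 2)))"
      using mult_right_mono[OF _ less_imp_le[OF S]] by (simp only: S_def add_0 of_nat_1 mult_1)
    also have "\<dots> \<le> ballot (H + (2 * k - H)) 0" by (rule ballot_ge_sin) (use that in auto)
    finally show ?thesis using that by simp
  qed
  have r1: "1 < \<rho>' / \<rho>" using \<rho> \<rho>' by simp
  obtain k where "\<bar>V\<bar> * \<rho>' ^ H / S < (\<rho>' / \<rho>) ^ k" using real_arch_pow[OF r1] by blast
  then have k: "\<bar>V\<bar> * \<rho>' ^ H / S \<le> (\<rho>' / \<rho>) ^ l" if "k \<le> l" for l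
    using power_increasing[OF that, of "\<rho>' / \<rho>"] r1 by linarith
  define l where "l = max (max k H) 1"
  have l: "k \<le> 2 * l" "H \<le> 2 * l" "0 < l" by (auto simp: l_def)
  have "V * \<rho> ^ (2 * l) \<le> \<bar>V\<bar> * \<rho> ^ (2 * l)" using \<rho> by (intro mult_right_mono) auto
  also have "\<dots> \<le> (\<rho>' ^ (2 * l) / \<rho>' ^ H) * S"
    using k[OF l(1)] \<rho> \<rho>' S by (simp add: power_divide field_simps)
  also have "\<dots> \<le> ballot (2 * l) 0" by (rule g[OF l(2)])
  finally show thesis using that l by blast
qed

text \<open>\<open>tree_path u\<close> is the current tree path of the walk \<open>u\<close>, provided that every step either discovers a new
  vertex or goes back to the parent.\<close>

fun tree_path :: "nat list \<Rightarrow> nat list option" where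
  "tree_path [] = None"
| "tree_path [x] = Some [x]"
| "tree_path (y # x # u) = (case tree_path (x # u) of None \<Rightarrow> None
     | Some st \<Rightarrow> if y \<notin> set (x # u) then Some (y # st)
         else (case st of a # b # r \<Rightarrow> if y = b then Some (b # r) else None | _ \<Rightarrow> None))"

lemma sort_pair_commute: "sort_pair (x, y) = sort_pair (y, x)"
  by (simp add: sort_pair_def min.commute max.commute)

text \<open>Edges on the current tree path have been crossed once, all other discovered edges twice;
  adding the path once more makes every tree edge occur twice. A walk that is back at its root thus
  crosses each tree edge exactly twice.\<close>

lemma tree_path_invariant:
  "tree_path u = Some st \<Longrightarrow> st \<noteq> [] \<and> hd st = hd u \<and> last st = last u \<and> set st \<subseteq> set u \<and>
     mset (map sort_pair (steps u)) + mset (map sort_pair (steps st)) = mset (tree_edges u) + mset (tree_edges u)"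
proof (induction u arbitrary: st rule: tree_path.induct)
  case (3 y x u)
  then obtain st' where st': "tree_path (x # u) = Some st'" by (auto split: option.splits)
  note IH = "3.IH"[OF st']
  show ?case
  proof (cases "y \<in> set (x # u)")
    case False
    then have st: "st = y # st'" using "3.prems" st' by simp
    obtain r where r: "st' = x # r" using IH by (cases st') auto
    show ?thesis using IH False unfolding st r by auto
  next
    case True
    then obtain a r where r: "st' = a # y # r" "st = y # r"
      using "3.prems" st' by (auto split: list.splits if_splits)
    have "a = x" using IH r by simp
    then show ?thesis using IH True unfolding r by (auto simp: sort_pair_commute[of y x])
  qed
qed auto

text \<open>A potential: the second monomial pays in advance for the way back along the current
  path, and \<open>ballot\<close> counts the height profiles of the remaining \<open>m\<close>
  steps.\<close>

definition dyck_weight :: "(nat \<Rightarrow> nat \<Rightarrow> real) \<Rightarrow> nat \<Rightarrow> nat list \<Rightarrow> real" where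
  "dyck_weight \<sigma> m u = (case tree_path u of None \<Rightarrow> 0 | Some st \<Rightarrow> monomial \<sigma> (steps u) * monomial \<sigma> (steps st) * ballot m (length st - 1))"

lemma monomial_nonneg:
  assumes "\<And>i j. i < n \<Longrightarrow> j < n \<Longrightarrow> 0 \<le> \<sigma> i j" "set u \<subseteq> {..<n}"
  shows "0 \<le> monomial \<sigma> (steps u)"
  using assms(2) by (induction u rule: steps.induct) (auto intro!: mult_nonneg_nonneg assms(1))

lemma dyck_weight_nonneg:
  assumes "\<And>i j. i < n \<Longrightarrow> j < n \<Longrightarrow> 0 \<le> \<sigma> i j" "set u \<subseteq> {..<n}"
  shows "0 \<le> dyck_weight \<sigma> m u"
proof (cases "tree_path u")
  case (Some st)
  then have "set st \<subseteq> {..<n}" using tree_path_invariant[OF Some] assms(2) by auto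
  then show ?thesis using assms Some by (auto simp: dyck_weight_def ballot_nonneg intro!: mult_nonneg_nonneg monomial_nonneg[of n])
qed (simp add: dyck_weight_def)

text \<open>A forward step gains \<open>\<sigma>^2\<close>, one factor for the step and one for the
  return. Summed over unvisited vertices this is at least \<open>1 - \<delta>\<close>, since the row
  sum is one and each of the at most \<open>length u\<close> visited vertices takes at most
  \<open>s^2\<close>. A step back moves a factor from one monomial to the other. The two cases are
  the two terms in the recursion of \<open>ballot\<close>.\<close>

lemma dyck_weight_step:
  assumes \<sigma>: "\<And>i j. i < n \<Longrightarrow> j < n \<Longrightarrow> 0 \<le> \<sigma> i j \<and> \<sigma> i j \<le> s" and sym: "sym_mat n \<sigma>"
    and rows: "\<And>i. i < n \<Longrightarrow> (\<Sum>j<n. (\<sigma> i j)\<^sup>2) = 1"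
    and u: "u \<noteq> []" "set u \<subseteq> {..<n}" and \<delta>: "real (length u) * s\<^sup>2 \<le> \<delta>" "0 \<le> \<delta>"
  shows "(1 - \<delta>) * dyck_weight \<sigma> (Suc m) u \<le> (\<Sum>y<n. dyck_weight \<sigma> m (y # u))"
proof (cases "tree_path u")
  case None
  then show ?thesis using u by (cases u) (auto simp: dyck_weight_def)
next
  case (Some st)
  note inv = tree_path_invariant[OF Some]
  obtain x v where xv: "u = x # v" using u by (cases u) auto
  obtain r where r: "st = x # r" using inv xv by (cases st) auto
  have xn: "x < n" using u xv by auto
  have Gy: "0 \<le> dyck_weight \<sigma> m (y # u)" if "y < n" for y using that u \<sigma> by (intro dyck_weight_nonneg[of n]) auto
  define a where "a = monomial \<sigma> (steps u) * monomial \<sigma> (steps st)"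
  have a: "0 \<le> a" unfolding a_def using inv u \<sigma> by (intro mult_nonneg_nonneg monomial_nonneg[of n]) auto
  have new: "(1 - \<delta>) * (a * ballot m (length st)) \<le> (\<Sum>y\<in>{..<n} - set u. dyck_weight \<sigma> m (y # u))"
  proof -
    have "(\<Sum>y\<in>set u. (\<sigma> x y)\<^sup>2) \<le> (\<Sum>y\<in>set u. s\<^sup>2)" using \<sigma> u xn by (intro sum_mono power_mono) auto
    also have "\<dots> \<le> real (length u) * s\<^sup>2" using card_length[of u] by (simp add: mult_right_mono)
    finally have "(\<Sum>y\<in>set u. (\<sigma> x y)\<^sup>2) \<le> \<delta>" using \<delta> by linarith
    moreover have "(\<Sum>y<n. (\<sigma> x y)\<^sup>2) = (\<Sum>y\<in>{..<n} - set u. (\<sigma> x y)\<^sup>2) + (\<Sum>y\<in>set u. (\<sigma> x y)\<^sup>2)"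
      by (rule sum.subset_diff) (use u in auto)
    ultimately have "1 - \<delta> \<le> (\<Sum>y\<in>{..<n} - set u. (\<sigma> x y)\<^sup>2)" using rows[OF xn] by linarith
    then have "(1 - \<delta>) * (a * ballot m (length st)) \<le> (\<Sum>y\<in>{..<n} - set u. (\<sigma> x y)\<^sup>2) * (a * ballot m (length st))"
      using a by (intro mult_right_mono mult_nonneg_nonneg ballot_nonneg)
    also have "\<dots> = (\<Sum>y\<in>{..<n} - set u. dyck_weight \<sigma> m (y # u))"
      unfolding sum_distrib_right
    proof (intro sum.cong refl)
      fix y assume "y \<in> {..<n} - set u"
      then have "tree_path (y # u) = Some (y # st)" using Some xv by simp
      then show "(\<sigma> x y)\<^sup>2 * (a * ballot m (length st)) = dyck_weight \<sigma> m (y # u)"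
        unfolding dyck_weight_def a_def r xv by (simp add: power2_eq_square mult_ac)
    qed
    finally show ?thesis .
  qed
  have all: "(\<Sum>y<n. dyck_weight \<sigma> m (y # u)) = (\<Sum>y\<in>{..<n} - set u. dyck_weight \<sigma> m (y # u)) + (\<Sum>y\<in>set u. dyck_weight \<sigma> m (y # u))"
    by (rule sum.subset_diff) (use u in auto)
  have G: "dyck_weight \<sigma> (Suc m) u = a * ballot (Suc m) (length r)" unfolding dyck_weight_def a_def Some by (simp add: r)
  show ?thesis
  proof (cases r)
    case Nil
    have "0 \<le> (\<Sum>y\<in>set u. dyck_weight \<sigma> m (y # u))" using Gy u by (intro sum_nonneg) auto
    then show ?thesis using new unfolding all G by (simp add: Nil r)
  next
    case (Cons b q)
    have b: "b \<in> set u" using inv r Cons by auto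
    then have bn: "b < n" using u by auto
    have "tree_path (b # u) = Some (b # q)" using Some b Cons r xv by auto
    then have "dyck_weight \<sigma> m (b # u) = a * ballot m (length q)"
      unfolding dyck_weight_def a_def r xv Cons using sym xn bn by (simp add: sym_mat_def mult_ac)
    moreover have "dyck_weight \<sigma> m (b # u) \<le> (\<Sum>y\<in>set u. dyck_weight \<sigma> m (y # u))"
      using Gy u b by (intro member_le_sum) auto
    moreover have "(1 - \<delta>) * (a * ballot m (length q)) \<le> 1 * (a * ballot m (length q))"
      using \<delta> a by (intro mult_right_mono mult_nonneg_nonneg ballot_nonneg) auto
    ultimately have "(1 - \<delta>) * (a * ballot m (length q)) \<le> (\<Sum>y\<in>set u. dyck_weight \<sigma> m (y # u))" by linarith
    then show ?thesis using new unfolding all G by (simp add: Cons r distrib_left)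
  qed
qed

lemma dyck_weight_sum_ge:
  assumes \<sigma>: "\<And>i j. i < n \<Longrightarrow> j < n \<Longrightarrow> 0 \<le> \<sigma> i j \<and> \<sigma> i j \<le> s" and sym: "sym_mat n \<sigma>"
    and rows: "\<And>i. i < n \<Longrightarrow> (\<Sum>j<n. (\<sigma> i j)\<^sup>2) = 1"
    and i: "i < n" and \<delta>: "real L * s\<^sup>2 \<le> \<delta>" "0 \<le> \<delta>" "\<delta> \<le> 1" and t: "t \<le> L"
  shows "(1 - \<delta>) ^ t * ballot L 0 \<le> (\<Sum>u\<in>walks n i t. dyck_weight \<sigma> (L - t) u)"
  using t
proof (induction t)
  case 0
  then show ?case by (simp add: dyck_weight_def)
next
  case (Suc t)
  have "(1 - \<delta>) ^ Suc t * ballot L 0 = (1 - \<delta>) * ((1 - \<delta>) ^ t * ballot L 0)" by simp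
  also have "\<dots> \<le> (1 - \<delta>) * (\<Sum>u\<in>walks n i t. dyck_weight \<sigma> (L - t) u)" using \<delta> Suc by (intro mult_left_mono) auto
  also have "\<dots> = (\<Sum>u\<in>walks n i t. (1 - \<delta>) * dyck_weight \<sigma> (Suc (L - Suc t)) u)"
    using Suc.prems by (simp add: sum_distrib_left Suc_diff_Suc)
  also have "\<dots> \<le> (\<Sum>u\<in>walks n i t. \<Sum>y<n. dyck_weight \<sigma> (L - Suc t) (y # u))"
  proof (intro sum_mono dyck_weight_step[OF \<sigma> sym rows])
    fix u assume u: "u \<in> walks n i t"
    have "real (length u) * s\<^sup>2 \<le> real L * s\<^sup>2" using walks_length[OF u] Suc.prems by (intro mult_right_mono) auto
    then show "real (length u) * s\<^sup>2 \<le> \<delta>" using \<delta> by linarith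
  qed (use walks_nonempty walks_set[OF i] \<delta> in auto)
  also have "\<dots> = (\<Sum>u\<in>walks n i (Suc t). dyck_weight \<sigma> (L - Suc t) u)" by (rule sum_walks_Suc[symmetric])
  finally show ?case .
qed

lemma weight_all_two:
  assumes "\<And>e. e \<in> set E \<Longrightarrow> count_list E e = 2" "m 2 = 1"
  shows "weight m E = 1"
  unfolding weight_def using assms by (intro prod.neutral) auto

context rmatrix
begin

text \<open>If all edges are repeated, then \<open>2 * k\<close> steps over at least
  \<open>k\<close> edges use each exactly twice, and only \<open>mu 2 = 1\<close> occurs; otherwise
  there is a factor \<open>mu 1 = 0\<close>. Hence walks with \<open>k\<close> discoveries may be
  dropped from a lower bound.\<close>

lemma tree_walk_weight_nonneg:
  assumes i: "i < n" and u: "u \<in> walks n i (2 * k)" and num_new: "num_new u = k"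
  shows "0 \<le> monomial \<sigma> (steps u) * weight mu (map sort_pair (steps u))"
proof (cases "repeated (map sort_pair (steps u))")
  case False
  then show ?thesis using weight_not_repeated[of mu "map sort_pair (steps u)"] mu_1 by simp
next
  case True
  let ?E = "map sort_pair (steps u)"
  have c: "2 \<le> count_list ?E e" if "e \<in> set ?E" for e using True that by (simp only: repeated_def)
  have k: "k \<le> card (set ?E)"
    using card_mono[OF _ tree_edges_subset[of u]] distinct_card[OF tree_edges_distinct[of u]] length_tree_edges[of u] num_new by simp
  have sum: "(\<Sum>e\<in>set ?E. count_list ?E e) = 2 * k"
    using sum_count_set[OF order_refl, of ?E] walks_length[OF u] by (simp add: length_steps)
  have "count_list ?E e = 2" if e: "e \<in> set ?E" for e
  proof (rule ccontr)
    assume neq: "count_list ?E e \<noteq> 2"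
    have "(\<Sum>e\<in>set ?E. 2) < (\<Sum>e\<in>set ?E. count_list ?E e)"
    proof (rule sum_strict_mono_ex1[OF finite_set])
      show "\<forall>e\<in>set ?E. 2 \<le> count_list ?E e" using c by blast
      show "\<exists>e\<in>set ?E. 2 < count_list ?E e" using c[OF e] neq by (intro bexI[OF _ e]) linarith
    qed
    then show False using k unfolding sum by simp
  qed
  then have "weight mu ?E = 1" using mu_2 by (intro weight_all_two) auto
  then show ?thesis using monomial_nonneg[of n \<sigma> u] \<sigma>_bounds walks_set[OF i u] by simp
qed

text \<open>After all \<open>2 * k\<close> steps \<open>dyck_weight\<close> vanishes unless the tree
  path has shrunk to its root; the surviving walks are closed and cross every tree edge
  twice.\<close>

lemma tree_walks_ge:
  assumes i: "i < n" and \<delta>: "real (2 * k) * s\<^sup>2 \<le> \<delta>" "0 \<le> \<delta>" "\<delta> \<le> 1"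
  shows "(1 - \<delta>) ^ (2 * k) * ballot (2 * k) 0
    \<le> (\<Sum>u\<in>walks n i (2 * k). if hd u = i \<and> num_new u = k then monomial \<sigma> (steps u) * weight mu (map sort_pair (steps u)) else 0)"
proof -
  have "(1 - \<delta>) ^ (2 * k) * ballot (2 * k) 0 \<le> (\<Sum>u\<in>walks n i (2 * k). dyck_weight \<sigma> (2 * k - 2 * k) u)"
    by (rule dyck_weight_sum_ge[OF \<sigma>_bounds \<sigma>_sym \<sigma>_rows i \<delta>]) auto
  also have "\<dots> \<le> (\<Sum>u\<in>walks n i (2 * k). if hd u = i \<and> num_new u = k then monomial \<sigma> (steps u) * weight mu (map sort_pair (steps u)) else 0)"
  proof (intro sum_mono)
    fix u assume u: "u \<in> walks n i (2 * k)"
    have nonneg: "0 \<le> (if hd u = i \<and> num_new u = k then monomial \<sigma> (steps u) * weight mu (map sort_pair (steps u)) else 0)"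
      using tree_walk_weight_nonneg[OF i u] by simp
    show "dyck_weight \<sigma> (2 * k - 2 * k) u \<le> (if hd u = i \<and> num_new u = k then monomial \<sigma> (steps u) * weight mu (map sort_pair (steps u)) else 0)"
    proof (cases "\<exists>x. tree_path u = Some [x]")
      case False
      have "dyck_weight \<sigma> 0 u = 0"
      proof (cases "tree_path u")
        case (Some st)
        then obtain a b r where "st = a # b # r"
          using False tree_path_invariant[OF Some] by (cases st; cases "tl st") auto
        then show ?thesis using Some by (simp add: dyck_weight_def)
      qed (simp add: dyck_weight_def)
      then show ?thesis using nonneg by simp
    next
      case True
      then obtain x where x: "tree_path u = Some [x]" by blast
      from tree_path_invariant[OF x] have inv: "hd u = x" "x = last u" "mset (map sort_pair (steps u)) = mset (tree_edges u) + mset (tree_edges u)" by auto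
      have h: "hd u = i" using inv walks_last[OF u] by simp
      have "2 * k = 2 * num_new u"
        using arg_cong[OF inv(3), of size] walks_length[OF u] by (simp add: length_steps length_tree_edges)
      then have num_new: "num_new u = k" by simp
      have "count_list (map sort_pair (steps u)) e = 2" if "e \<in> set (map sort_pair (steps u))" for e
      proof -
        have "e \<in> set (tree_edges u)" using that arg_cong[OF inv(3), of set_mset] by (simp del: mset_map set_map)
        then have "count (mset (tree_edges u)) e = 1"
          using tree_edges_distinct[of u, unfolded distinct_count_atmost_1, rule_format, of e] by simp
        then have "count (mset (map sort_pair (steps u))) e = 2" unfolding inv(3) by simp
        then show ?thesis by (simp only: count_mset)
      qed
      then have "weight mu (map sort_pair (steps u)) = 1" using mu_2 by (intro weight_all_two) auto
      then show ?thesis using h num_new x by (simp add: dyck_weight_def)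
    qed
  qed
  finally show ?thesis .
qed

text \<open>The walks that contribute with fewer than \<open>k\<close> discoveries carry at least
  one surplus factor \<open>s\<close>, and the sum over patterns does not depend on
  \<open>n\<close>. Their contribution, possibly negative, is therefore negligible for fixed
  \<open>k\<close> as \<open>s\<close> tends to zero.\<close>

lemma expected_trace_ge:
  assumes \<delta>: "real (2 * k) * s\<^sup>2 \<le> \<delta>" "0 \<le> \<delta>" "\<delta> \<le> 1" and s1: "s \<le> 1"
  shows "real n * ((1 - \<delta>) ^ (2 * k) * ballot (2 * k) 0 - s * (\<Sum>c\<in>patterns (2 * k). \<bar>weight mu (uedges c)\<bar>)) \<le> (\<integral>\<omega>. trace_pow n (XX \<omega>) (2 * k) \<partial>M)"
proof -
  let ?w = "\<lambda>u. monomial \<sigma> (steps u) * weight mu (map sort_pair (steps u))"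
  have split: "(\<integral>\<omega>. trace_pow n (XX \<omega>) (2 * k) \<partial>M) = (\<Sum>i<n. \<Sum>u\<in>walks n i (2 * k). if hd u = i \<and> num_new u = k then ?w u else 0)
      + (\<Sum>i<n. \<Sum>u\<in>walks n i (2 * k). if hd u = i \<and> num_new u \<noteq> k then ?w u else 0)"
    unfolding trace_pow_expectation sum.distrib[symmetric] by (intro sum.cong refl) auto
  have 1: "(\<Sum>i<n. (1 - \<delta>) ^ (2 * k) * ballot (2 * k) 0)
    \<le> (\<Sum>i<n. \<Sum>u\<in>walks n i (2 * k). if hd u = i \<and> num_new u = k then ?w u else 0)"
    by (intro sum_mono tree_walks_ge \<delta>) auto
  have "- (\<Sum>i<n. \<Sum>u\<in>walks n i (2 * k). if hd u = i \<and> num_new u \<noteq> k then ?w u else 0)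
    \<le> (\<Sum>i<n. \<Sum>u\<in>walks n i (2 * k). if hd u = i \<and> num_new u \<noteq> k then \<bar>?w u\<bar> else 0)"
    unfolding sum_negf[symmetric] by (intro sum_mono) auto
  also have "\<dots> \<le> real n * (\<Sum>c\<in>patterns (2 * k). pattern_bound mu s (\<lambda>m. m \<noteq> k) c)"
    by (rule closed_walks_le_patterns) (use \<sigma>_sym \<sigma>_rows \<sigma>_bounds s_nonneg mu_1 in auto)
  also have "\<dots> \<le> real n * (\<Sum>c\<in>patterns (2 * k). s * \<bar>weight mu (uedges c)\<bar>)"
  proof (intro mult_left_mono sum_mono)
    fix c assume "c \<in> patterns (2 * k)"
    moreover have "length c = Suc L" if "c \<in> patterns L" for c L using that by (induction L arbitrary: c) auto
    ultimately have len: "length c = Suc (2 * k)" by blast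
    have "s ^ (2 * k - 2 * num_new c) \<le> s ^ 1" if "num_new c \<noteq> k" "2 * num_new c \<le> 2 * k"
      using that s1 s_nonneg by (intro power_decreasing) auto
    then show "pattern_bound mu s (\<lambda>m. m \<noteq> k) c \<le> s * \<bar>weight mu (uedges c)\<bar>"
      unfolding pattern_bound_def len using s_nonneg by (auto intro!: mult_right_mono mult_nonneg_nonneg)
  qed simp
  finally show ?thesis unfolding split using 1 by (simp add: sum_distrib_left right_diff_distrib)
qed

end

subsection \<open>The bounded differences inequality\<close>

text \<open>The bound involves the oscillation \<open>c\<close> and not \<open>B\<close>:
  Hoeffding's lemma is applied on an interval of length \<open>c\<close> that starts at
  \<open>m - S\<close>, where \<open>S\<close> is the supremum of \<open>f\<close>.\<close>

lemma hoeffding_oscillation: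
  fixes f :: "'b \<Rightarrow> real"
  assumes N: "prob_space N" and [measurable]: "f \<in> borel_measurable N" and B: "\<And>y. \<bar>f y\<bar> \<le> B"
    and c: "\<And>y z. \<bar>f y - f z\<bar> \<le> c" and l: "0 < l"
  shows "(\<integral>y. exp (l * ((\<integral>z. f z \<partial>N) - f y)) \<partial>N) \<le> exp (l\<^sup>2 * c\<^sup>2 / 8)"
proof -
  interpret prob_space N by (rule N)
  define m where "m = (\<integral>z. f z \<partial>N)"
  define S where "S = (SUP y. f y)"
  have bdd: "bdd_above (range f)" by (rule bdd_aboveI[of _ B]) (use B in \<open>auto simp: abs_le_iff\<close>)
  have up: "f y \<le> S" for y unfolding S_def by (rule cSUP_upper[OF _ bdd]) simp
  have low: "S \<le> f y + c" for y
    unfolding S_def using c by (intro cSUP_least) (auto simp: abs_le_iff algebra_simps)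
  interpret interval_bounded_random_variable N "\<lambda>y. m - f y" "m - S" "m - S + c"
    by unfold_locales (use up low in \<open>auto simp: algebra_simps intro!: AE_I2\<close>)
  have int: "integrable N f" by (rule integrable_const_bound[of _ B]) (use B in auto)
  have "expectation (\<lambda>y. m - f y) = 0"
    using int by (simp add: m_def prob_space)
  from Hoeffdings_lemma_nn_integral_0[OF l this]
  have nn: "(\<integral>\<^sup>+ y. exp (l * (m - f y)) \<partial>N) \<le> ennreal (exp (l\<^sup>2 * c\<^sup>2 / 8))" by simp
  have "integrable N (\<lambda>y. exp (l * (m - f y)))"
  proof (rule integrable_const_bound[of _ "exp (l * (m + B))"])
    show "AE y in N. norm (exp (l * (m - f y))) \<le> exp (l * (m + B))"
    proof (intro AE_I2)
      fix y
      have "m - f y \<le> m + B" using B[of y] by linarith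
      then show "norm (exp (l * (m - f y))) \<le> exp (l * (m + B))" using l by (simp add: mult_left_mono)
    qed
  qed measurable
  then have "ennreal (\<integral>y. exp (l * (m - f y)) \<partial>N) = (\<integral>\<^sup>+ y. exp (l * (m - f y)) \<partial>N)"
    by (intro nn_integral_eq_integral[symmetric]) auto
  with nn have "ennreal (\<integral>y. exp (l * (m - f y)) \<partial>N) \<le> ennreal (exp (l\<^sup>2 * c\<^sup>2 / 8))" by (simp only:)
  then show ?thesis unfolding m_def by (subst (asm) ennreal_le_iff) auto
qed

text \<open>Integrate out one coordinate at a time. The partial mean \<open>G\<close> inherits the
  increments in the other coordinates, and for fixed other coordinates Hoeffding's lemma controls
  the deviation of \<open>F\<close> from \<open>G\<close>. With \<open>space N = UNIV\<close> the
  points of the product space are exactly the extensional functions.\<close>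

lemma bounded_differences_mgf:
  fixes F :: "('i \<Rightarrow> 'b) \<Rightarrow> real" and N :: "'b measure"
  assumes N: "prob_space N" and N_UNIV: "space N = UNIV" and I: "finite I" and F: "F \<in> borel_measurable (PiM I (\<lambda>_. N))"
    and B: "\<And>x. \<bar>F x\<bar> \<le> B" 
    and c: "\<And>x i y. i \<in> I \<Longrightarrow> x \<in> extensional I \<Longrightarrow> \<bar>F x - F (x(i := y))\<bar> \<le> c i" and l: "0 < l"
  shows "(\<integral>x. exp (l * ((\<integral>z. F z \<partial>PiM I (\<lambda>_. N)) - F x)) \<partial>PiM I (\<lambda>_. N)) \<le> exp (l\<^sup>2 * (\<Sum>i\<in>I. (c i)\<^sup>2) / 8)"
  using I F B c
proof (induction I arbitrary: F)
  case empty
  interpret P: prob_space "PiM ({} :: 'i set) (\<lambda>_. N)" by (intro prob_space_PiM N)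
  have sp: "x = (\<lambda>_. undefined)" if "x \<in> space (PiM ({} :: 'i set) (\<lambda>_. N))" for x
    using that by (simp add: space_PiM)
  have "(\<integral>z. F z \<partial>PiM {} (\<lambda>_. N)) = (\<integral>z. F (\<lambda>_. undefined) \<partial>PiM ({} :: 'i set) (\<lambda>_. N))"
    by (intro Bochner_Integration.integral_cong refl) (use sp in auto)
  then have m: "(\<integral>z. F z \<partial>PiM {} (\<lambda>_. N)) = F (\<lambda>_. undefined)" by (simp add: P.prob_space)
  have "(\<integral>x. exp (l * (F (\<lambda>_. undefined) - F x)) \<partial>PiM {} (\<lambda>_. N)) = (\<integral>x. 1 \<partial>PiM ({} :: 'i set) (\<lambda>_. N))"
    by (intro Bochner_Integration.integral_cong refl) (use sp in auto)
  then show ?case unfolding m by (simp add: P.prob_space)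
next
  case (insert i I)
  interpret N: prob_space N by (rule N)
  interpret PI: product_prob_space "\<lambda>_ :: 'i. N" by unfold_locales
  interpret P: prob_space "PiM I (\<lambda>_. N)" by (intro prob_space_PiM N)
  interpret Q: prob_space "PiM (insert i I) (\<lambda>_. N)" by (intro prob_space_PiM N)
  have sp: "space (PiM J (\<lambda>_. N)) = extensional J" for J :: "'i set" by (simp add: space_PiM PiE_def N_UNIV)
  have ext: "x(i := y) \<in> extensional (insert i I)" if "x \<in> extensional I" for x y
    using that by (auto simp: extensional_def)
  note [measurable] = insert.prems(1)
  have Fy: "(\<lambda>y. F (x(i := y))) \<in> borel_measurable N" if "x \<in> extensional I" for x
  proof -
    have "(\<lambda>y. x(i := y)) \<in> measurable N (PiM (insert i I) (\<lambda>_. N))"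
      using measurable_compose[OF measurable_Pair1'[of x "PiM I (\<lambda>_. N)" N] measurable_add_dim[of i I "\<lambda>_. N"]] that sp by simp
    then show ?thesis by (rule measurable_compose) (rule insert.prems(1))
  qed
  define G where "G x = (\<integral>y. F (x(i := y)) \<partial>N)" for x
  have Fxy: "(\<lambda>(x, y). F (x(i := y))) \<in> borel_measurable (PiM I (\<lambda>_. N) \<Otimes>\<^sub>M N)"
    using measurable_compose[OF measurable_add_dim[of i I "\<lambda>_. N"] insert.prems(1)] by (simp add: case_prod_beta')
  then have G: "G \<in> borel_measurable (PiM I (\<lambda>_. N))"
    unfolding G_def by (rule N.borel_measurable_lebesgue_integral)
  have int: "integrable N (\<lambda>y. F (x(i := y)))" if "x \<in> extensional I" for x
    by (rule N.integrable_const_bound[of _ B]) (use insert.prems(2) Fy[OF that] in auto)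
  have B0: "0 \<le> B" using insert.prems(2)[of undefined] by linarith
  have GB: "\<bar>G x\<bar> \<le> B" for x
  proof -
    have "\<bar>G x\<bar> \<le> (\<integral>y. \<bar>F (x(i := y))\<bar> \<partial>N)" unfolding G_def by (rule integral_abs_bound)
    also have "\<dots> \<le> (\<integral>y. B \<partial>N)" by (intro integral_mono') (use insert.prems(2) B0 in auto)
    finally show ?thesis by (simp add: N.prob_space)
  qed
  have c0: "0 \<le> c j" if "j \<in> insert i I" for j
    using insert.prems(3)[OF that, of "\<lambda>_. undefined"] by (force simp: extensional_def)
  have Gc: "\<bar>G x - G (x(j := z))\<bar> \<le> c j" if j: "j \<in> I" and x: "x \<in> extensional I" for x j z
  proof -
    have ji: "j \<noteq> i" using j insert.hyps by auto
    have xj: "x(j := z) \<in> extensional I" using x j by (auto simp: extensional_def)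
    have "G x - G (x(j := z)) = (\<integral>y. F (x(i := y)) - F ((x(j := z))(i := y)) \<partial>N)"
      unfolding G_def by (rule Bochner_Integration.integral_diff[symmetric]) (use int x xj in auto)
    also have "\<bar>\<dots>\<bar> \<le> (\<integral>y. \<bar>F (x(i := y)) - F ((x(j := z))(i := y))\<bar> \<partial>N)" by (rule integral_abs_bound)
    also have "\<dots> \<le> (\<integral>y. c j \<partial>N)"
    proof (rule integral_mono')
      fix y
      show "\<bar>F (x(i := y)) - F ((x(j := z))(i := y))\<bar> \<le> c j"
        unfolding fun_upd_twist[OF ji] by (rule insert.prems(3)[OF insertI2[OF j] ext[OF x]])
    qed (use c0 j in auto)
    finally show ?thesis by (simp add: N.prob_space)
  qed
  have intF: "integrable (PiM (insert i I) (\<lambda>_. N)) F"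
    by (rule Q.integrable_const_bound[of _ B]) (use insert.prems in auto)
  define m where "m = (\<integral>z. F z \<partial>PiM (insert i I) (\<lambda>_. N))"
  have m: "m = (\<integral>x. G x \<partial>PiM I (\<lambda>_. N))"
    unfolding m_def G_def by (rule PI.product_integral_insert[OF insert.hyps intF])
  have exp_bound: "norm (exp (l * (a - b))) \<le> exp (l * (2 * B))" if "\<bar>a\<bar> \<le> B" "\<bar>b\<bar> \<le> B" for a b :: real
    using that l by (simp add: mult_left_mono)
  have mB: "\<bar>m\<bar> \<le> B"
  proof -
    have "\<bar>m\<bar> \<le> (\<integral>z. \<bar>F z\<bar> \<partial>PiM (insert i I) (\<lambda>_. N))" unfolding m_def by (rule integral_abs_bound)
    also have "\<dots> \<le> (\<integral>z. B \<partial>PiM (insert i I) (\<lambda>_. N))" by (intro integral_mono') (use insert.prems(2) B0 in auto)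
    finally show ?thesis by (simp add: Q.prob_space)
  qed
  have intE: "integrable (PiM (insert i I) (\<lambda>_. N)) (\<lambda>x. exp (l * (m - F x)))"
    by (rule Q.integrable_const_bound[of _ "exp (l * (2 * B))"]) (use exp_bound mB insert.prems(2) in auto)
  have "(\<integral>x. exp (l * (m - F x)) \<partial>PiM (insert i I) (\<lambda>_. N))
    = (\<integral>x. (\<integral>y. exp (l * (m - F (x(i := y)))) \<partial>N) \<partial>PiM I (\<lambda>_. N))"
    by (rule PI.product_integral_insert[OF insert.hyps intE])
  also have "\<dots> \<le> (\<integral>x. exp (l * (m - G x)) * exp (l\<^sup>2 * (c i)\<^sup>2 / 8) \<partial>PiM I (\<lambda>_. N))"
  proof (rule integral_mono')
    show "integrable (PiM I (\<lambda>_. N)) (\<lambda>x. exp (l * (m - G x)) * exp (l\<^sup>2 * (c i)\<^sup>2 / 8))"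
      by (intro integrable_mult_left P.integrable_const_bound[of _ "exp (l * (2 * B))"])
        (use exp_bound mB GB G in auto)
    fix x assume "x \<in> space (PiM I (\<lambda>_. N))"
    then have x: "x \<in> extensional I" by (simp add: sp)
    have "(\<integral>y. exp (l * (m - F (x(i := y)))) \<partial>N) = (\<integral>y. exp (l * (m - G x)) * exp (l * (G x - F (x(i := y)))) \<partial>N)"
      by (intro Bochner_Integration.integral_cong refl) (simp add: algebra_simps flip: exp_add)
    also have "\<dots> = exp (l * (m - G x)) * (\<integral>y. exp (l * (G x - F (x(i := y)))) \<partial>N)" by simp
    also have "\<dots> \<le> exp (l * (m - G x)) * exp (l\<^sup>2 * (c i)\<^sup>2 / 8)"
      unfolding G_def
    proof (intro mult_left_mono hoeffding_oscillation[OF N Fy[OF x] insert.prems(2) _ l])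
      fix y z
      show "\<bar>F (x(i := y)) - F (x(i := z))\<bar> \<le> c i"
        using insert.prems(3)[OF insertI1 ext[OF x], of y z] unfolding fun_upd_upd .
    qed simp
    finally show "(\<integral>y. exp (l * (m - F (x(i := y)))) \<partial>N) \<le> exp (l * (m - G x)) * exp (l\<^sup>2 * (c i)\<^sup>2 / 8)" .
  qed simp
  also have "\<dots> = (\<integral>x. exp (l * (m - G x)) \<partial>PiM I (\<lambda>_. N)) * exp (l\<^sup>2 * (c i)\<^sup>2 / 8)" by simp
  also have "\<dots> \<le> exp (l\<^sup>2 * (\<Sum>i\<in>I. (c i)\<^sup>2) / 8) * exp (l\<^sup>2 * (c i)\<^sup>2 / 8)"
    unfolding m by (intro mult_right_mono insert.IH G GB Gc) auto
  also have "\<dots> = exp (l\<^sup>2 * (\<Sum>i\<in>insert i I. (c i)\<^sup>2) / 8)"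
    using insert.hyps by (simp add: algebra_simps add_divide_distrib flip: exp_add)
  finally show ?case unfolding m_def .
qed

lemma bounded_differences_lower_tail:
  fixes F :: "('i \<Rightarrow> 'b) \<Rightarrow> real" and N :: "'b measure"
  assumes N: "prob_space N" and N_UNIV: "space N = UNIV" and I: "finite I" and F: "F \<in> borel_measurable (PiM I (\<lambda>_. N))"
    and B: "\<And>x. \<bar>F x\<bar> \<le> B"
    and c: "\<And>x i y. i \<in> I \<Longrightarrow> x \<in> extensional I \<Longrightarrow> \<bar>F x - F (x(i := y))\<bar> \<le> c i"
    and S: "(\<Sum>i\<in>I. (c i)\<^sup>2) \<le> S" "0 < S" and t: "0 < t"
  shows "measure (PiM I (\<lambda>_. N)) {x \<in> space (PiM I (\<lambda>_. N)). F x \<le> (\<integral>z. F z \<partial>PiM I (\<lambda>_. N)) - t} \<le> exp (- (2 * t\<^sup>2 / S))"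
proof -
  interpret P: prob_space "PiM I (\<lambda>_. N)" by (intro prob_space_PiM N)
  define m where "m = (\<integral>z. F z \<partial>PiM I (\<lambda>_. N))"
  \<comment> \<open>The minimiser of \<open>l^2 * S / 8 - l * t\<close>.\<close>
  define l where "l = 4 * t / S"
  have l: "0 < l" using S t by (simp add: l_def)
  note [measurable] = F
  have int: "integrable (PiM I (\<lambda>_. N)) (\<lambda>x. exp (l * (m - F x)))"
  proof (rule P.integrable_const_bound[of _ "exp (l * (m + B))"])
    show "AE x in PiM I (\<lambda>_. N). norm (exp (l * (m - F x))) \<le> exp (l * (m + B))"
    proof (intro AE_I2)
      fix x
      have "m - F x \<le> m + B" using B[of x] by linarith
      then show "norm (exp (l * (m - F x))) \<le> exp (l * (m + B))" using l by (simp add: mult_left_mono)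
    qed
  qed measurable
  have "{x \<in> space (PiM I (\<lambda>_. N)). F x \<le> m - t} = {x \<in> space (PiM I (\<lambda>_. N)). exp (l * t) \<le> exp (l * (m - F x))}"
    using l by (auto simp: mult_le_cancel_left_pos)
  then have "measure (PiM I (\<lambda>_. N)) {x \<in> space (PiM I (\<lambda>_. N)). F x \<le> m - t}
     \<le> (\<integral>x. exp (l * (m - F x)) \<partial>PiM I (\<lambda>_. N)) / exp (l * t)"
    using integral_Markov_inequality_measure[OF int sets.empty_sets _ exp_gt_zero[of "l * t"]] by simp
  also have "\<dots> \<le> exp (l\<^sup>2 * (\<Sum>i\<in>I. (c i)\<^sup>2) / 8) / exp (l * t)"
    unfolding m_def by (intro divide_right_mono bounded_differences_mgf[OF N N_UNIV I F B c l]) auto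
  also have "\<dots> = exp (l\<^sup>2 * (\<Sum>i\<in>I. (c i)\<^sup>2) / 8 - l * t)" by (simp add: exp_diff)
  also have "\<dots> \<le> exp (l\<^sup>2 * S / 8 - l * t)"
    using S by (simp add: mult_left_mono divide_right_mono)
  also have "l\<^sup>2 * S / 8 - l * t = - (2 * t\<^sup>2 / S)" using S by (simp add: l_def power2_eq_square field_simps)
  finally show ?thesis unfolding m_def .
qed

subsection \<open>A functional with bounded differences below the spectral norm\<close>

lemma trace_pow_Suc_le:
  assumes "0 < n" "sym_mat n A"
  shows "trace_pow n A (2 * k + 2) \<le> (spec_norm n A)\<^sup>2 * trace_pow n A (2 * k)"
proof -
  have "trace_pow n A (2 * k + 2) = (\<Sum>j<n. \<Sum>i<n. (mat_pow n A (Suc k) i j)\<^sup>2)"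
    using trace_pow_double[OF assms(2), of "Suc k"] sum.swap[of "\<lambda>i j. (mat_pow n A (Suc k) i j)\<^sup>2" "{..<n}" "{..<n}"] by simp
  also have "\<dots> = (\<Sum>j<n. (L2_set (\<lambda>i. \<Sum>l<n. A i l * mat_pow n A k l j) {..<n})\<^sup>2)"
    by (simp add: L2_set_def sum_nonneg)
  also have "\<dots> \<le> (\<Sum>j<n. (spec_norm n A * L2_set (\<lambda>l. mat_pow n A k l j) {..<n})\<^sup>2)"
    by (intro sum_mono power_mono spec_norm_apply L2_set_nonneg)
  also have "\<dots> = (spec_norm n A)\<^sup>2 * (\<Sum>j<n. \<Sum>i<n. (mat_pow n A k i j)\<^sup>2)"
    by (simp add: power_mult_distrib L2_set_def sum_nonneg sum_distrib_left)
  also have "(\<Sum>j<n. \<Sum>i<n. (mat_pow n A k i j)\<^sup>2) = trace_pow n A (2 * k)"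
    unfolding trace_pow_double[OF assms(2)] by (rule sum.swap)
  finally show ?thesis .
qed

text \<open>The power mean inequality for the squared eigenvalues, obtained by induction from the
  log-convexity of the even traces.\<close>

lemma trace_pow_power_mean:
  assumes "sym_mat n A"
  shows "trace_pow n A (2 * k) ^ (k + 1) \<le> real n * trace_pow n A (2 * k + 2) ^ k"
proof (induction k)
  case (Suc k)
  define a b c where "a = trace_pow n A (2 * k)" and "b = trace_pow n A (2 * k + 2)" and "c = trace_pow n A (2 * k + 4)"
  have nn: "0 \<le> a" "0 \<le> b" "0 \<le> c" unfolding a_def b_def c_def by (auto intro!: trace_pow_even_nonneg assms)
  have lc: "b\<^sup>2 \<le> a * c" unfolding a_def b_def c_def by (rule trace_pow_ratio_mono[OF assms])
  have IH: "a ^ (k + 1) \<le> real n * b ^ k" using Suc unfolding a_def b_def .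
  have "b ^ (k + 2) \<le> real n * c ^ (k + 1)"
  proof (cases "b = 0")
    case False
    then have b: "0 < b ^ k" using nn by simp
    have "k + (k + 2) = 2 * (k + 1)" by simp
    then have "b ^ k * b ^ (k + 2) = (b\<^sup>2) ^ (k + 1)" by (simp only: power_mult[symmetric] power_add[symmetric])
    also have "\<dots> \<le> (a * c) ^ (k + 1)" using lc by (intro power_mono) auto
    also have "\<dots> = a ^ (k + 1) * c ^ (k + 1)" by (rule power_mult_distrib)
    also have "\<dots> \<le> real n * b ^ k * c ^ (k + 1)" using IH nn by (intro mult_right_mono) auto
    finally have "b ^ k * b ^ (k + 2) \<le> b ^ k * (real n * c ^ (k + 1))" by (simp add: mult_ac)
    then show ?thesis using b by (simp only: mult_le_cancel_left_pos)
  qed (use nn in auto)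
  moreover have "b = trace_pow n A (2 * Suc k)" "c = trace_pow n A (2 * Suc k + 2)"
    unfolding b_def c_def by (rule arg_cong[of _ _ "trace_pow n A"], simp)+
  ultimately show ?case by simp
qed simp

text \<open>Turns a lower bound for one trace into one for a ratio of consecutive even traces. The
  square root of that ratio is the pairing of \<open>A\<close> with its own normalised odd
  power.\<close>

lemma trace_pow_ratio_ge:
  assumes "0 < n" "sym_mat n A" "0 < trace_pow n A (2 * k + 2)"
  shows "0 < trace_pow n A (2 * k)" "trace_pow n A (2 * k + 2) / real n \<le> (trace_pow n A (2 * k + 2) / trace_pow n A (2 * k)) ^ (k + 1)"
proof -
  define a b where "a = trace_pow n A (2 * k)" and "b = trace_pow n A (2 * k + 2)"
  have b: "0 < b" using assms(3) by (simp add: b_def)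
  have "0 \<le> a" unfolding a_def by (intro trace_pow_even_nonneg assms) simp
  moreover have "a \<noteq> 0" using trace_pow_Suc_le[OF assms(1,2), of k] b by (auto simp: a_def b_def)
  ultimately have a: "0 < a" by simp
  then show "0 < trace_pow n A (2 * k)" by (simp add: a_def)
  have "a ^ (k + 1) \<le> real n * b ^ k" unfolding a_def b_def by (rule trace_pow_power_mean[OF assms(2)])
  then have "b * a ^ (k + 1) \<le> b * (real n * b ^ k)" using b by (intro mult_left_mono) auto
  then have "b / real n \<le> b ^ (k + 1) / a ^ (k + 1)" using a b assms(1) by (simp add: field_simps)
  then show "trace_pow n A (2 * k + 2) / real n \<le> (trace_pow n A (2 * k + 2) / trace_pow n A (2 * k)) ^ (k + 1)"
    by (simp add: a_def b_def power_divide)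
qed

section \<open>Clipped entries and the supremum over a countable dual ball\<close>

definition clip :: "real \<Rightarrow> real \<Rightarrow> real" where
  "clip T x = max (- T) (min T x)"

lemma clip_abs: "0 \<le> T \<Longrightarrow> \<bar>clip T x\<bar> \<le> T"
  by (auto simp: clip_def)

lemma clip_id: "\<bar>x\<bar> \<le> T \<Longrightarrow> clip T x = x"
  by (auto simp: clip_def)

lemma clip_measurable [measurable]: "clip T \<in> borel_measurable borel"
  unfolding clip_def[abs_def] by measurable

text \<open>The last condition says that the trace norm of \<open>B\<close> is at most one. The
  bound \<open>b\<close> limits the influence of single entries. Rational entries that vanish
  outside the \<open>n\<close> by \<open>n\<close> block make the set countable, hence the supremum
  measurable.\<close>

definition dual_ball :: "nat \<Rightarrow> real \<Rightarrow> (nat \<Rightarrow> nat \<Rightarrow> real) set" where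
  "dual_ball n b = {B. (\<forall>i j. B i j \<in> \<rat> \<and> \<bar>B i j\<bar> \<le> b) \<and> (\<forall>i j. \<not> (i < n \<and> j < n) \<longrightarrow> B i j = 0) \<and>
     (\<forall>A. (\<Sum>i<n. \<Sum>j<n. A i j * B i j) \<le> spec_norm n A)}"

definition pairing :: "nat \<Rightarrow> real \<Rightarrow> (nat \<Rightarrow> nat \<Rightarrow> real) \<Rightarrow> (nat \<Rightarrow> nat \<Rightarrow> real) \<Rightarrow> (nat \<times> nat \<Rightarrow> real) \<Rightarrow> real" where
  "pairing n T \<sigma> B w = (\<Sum>i<n. \<Sum>j<n. \<sigma> i j * clip T (w (sort_pair (i, j))) * B i j)"

definition dual_sup :: "nat \<Rightarrow> real \<Rightarrow> real \<Rightarrow> (nat \<Rightarrow> nat \<Rightarrow> real) \<Rightarrow> (nat \<times> nat \<Rightarrow> real) \<Rightarrow> real" where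
  "dual_sup n b T \<sigma> w = (SUP B\<in>dual_ball n b. pairing n T \<sigma> B w)"

lemma countable_dual_ball: "countable (dual_ball n b)"
proof -
  let ?S = "PiE ({..<n} \<times> {..<n}) (\<lambda>_. \<rat> :: real set)"
  have sub: "dual_ball n b \<subseteq> (\<lambda>f i j. if i < n \<and> j < n then f (i, j) else 0) ` ?S"
  proof
    fix B assume B: "B \<in> dual_ball n b"
    let ?f = "restrict (\<lambda>(i, j). B i j) ({..<n} \<times> {..<n})"
    have "B = (\<lambda>i j. if i < n \<and> j < n then ?f (i, j) else 0)" using B by (auto simp: dual_ball_def fun_eq_iff)
    moreover have "?f \<in> ?S" using B by (auto simp: dual_ball_def)
    ultimately show "B \<in> (\<lambda>f i j. if i < n \<and> j < n then f (i, j) else 0) ` ?S" by blast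
  qed
  have "countable ?S" by (intro countable_PiE) (auto simp: countable_rat)
  then show ?thesis by (rule countable_subset[OF sub countable_image])
qed

lemma zero_in_dual_ball: "0 < n \<Longrightarrow> 0 \<le> b \<Longrightarrow> (\<lambda>_ _. 0) \<in> dual_ball n b"
  by (simp add: dual_ball_def spec_norm_nonneg)

locale clipped_dual =
  fixes n :: nat and b T :: real and \<sigma> :: "nat \<Rightarrow> nat \<Rightarrow> real" and s :: real
  assumes n: "0 < n" and b: "0 \<le> b" and T: "0 \<le> T" and \<sigma>: "i < n \<Longrightarrow> j < n \<Longrightarrow> 0 \<le> \<sigma> i j \<and> \<sigma> i j \<le> s"
    and sym: "sym_mat n \<sigma>" and rows: "i < n \<Longrightarrow> (\<Sum>j<n. (\<sigma> i j)\<^sup>2) = 1"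
begin

lemma pairing_abs_le:
  assumes "B \<in> dual_ball n b"
  shows "\<bar>pairing n T \<sigma> B w\<bar> \<le> real n * (real n * (s * T * b))"
proof -
  have "\<bar>pairing n T \<sigma> B w\<bar> \<le> (\<Sum>i<n. \<bar>\<Sum>j<n. \<sigma> i j * clip T (w (sort_pair (i, j))) * B i j\<bar>)"
    unfolding pairing_def by (rule sum_abs)
  also have "\<dots> \<le> (\<Sum>i<n. \<Sum>j<n. \<bar>\<sigma> i j * clip T (w (sort_pair (i, j))) * B i j\<bar>)"
    by (intro sum_mono sum_abs)
  also have "\<dots> \<le> (\<Sum>i<n. \<Sum>j<n. s * T * b)"
  proof (intro sum_mono)
    fix i j assume "i \<in> {..<n}" "j \<in> {..<n}"
    then show "\<bar>\<sigma> i j * clip T (w (sort_pair (i, j))) * B i j\<bar> \<le> s * T * b"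
      using \<sigma>[of i j] clip_abs[OF T] assms T b unfolding abs_mult dual_ball_def
      by (intro mult_mono) (auto intro: order_trans)
  qed
  finally show ?thesis by simp
qed

lemma pairing_bdd: "bdd_above ((\<lambda>B. pairing n T \<sigma> B w) ` dual_ball n b)"
  by (rule bdd_aboveI[of _ "real n * (real n * (s * T * b))"]) (use pairing_abs_le in \<open>force simp: abs_le_iff\<close>)

lemma pairing_le_dual_sup: "B \<in> dual_ball n b \<Longrightarrow> pairing n T \<sigma> B w \<le> dual_sup n b T \<sigma> w"
  unfolding dual_sup_def by (rule cSUP_upper[OF _ pairing_bdd])

lemma dual_sup_least: "(\<And>B. B \<in> dual_ball n b \<Longrightarrow> pairing n T \<sigma> B w \<le> u) \<Longrightarrow> dual_sup n b T \<sigma> w \<le> u"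
  unfolding dual_sup_def using zero_in_dual_ball[OF n b] by (intro cSUP_least) auto

lemma dual_sup_abs_le: "\<bar>dual_sup n b T \<sigma> w\<bar> \<le> real n * (real n * (s * T * b))"
proof -
  have "dual_sup n b T \<sigma> w \<le> real n * (real n * (s * T * b))"
    using pairing_abs_le[of _ w] by (intro dual_sup_least) (auto simp: abs_le_iff)
  moreover have "0 \<le> dual_sup n b T \<sigma> w"
    using pairing_le_dual_sup[OF zero_in_dual_ball[OF n b], of w] by (simp add: pairing_def)
  ultimately show ?thesis by simp
qed

lemma dual_sup_measurable:
  assumes N: "sets N = sets borel"
  shows "dual_sup n b T \<sigma> \<in> borel_measurable (PiM (edges n) (\<lambda>_. N))"
proof -
  have "pairing n T \<sigma> B \<in> borel_measurable (PiM (edges n) (\<lambda>_. N))" for B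
  proof -
    have "(\<lambda>w. w e) \<in> borel_measurable (PiM (edges n) (\<lambda>_. N))" if "e \<in> edges n" for e
      using measurable_component_singleton[OF that, of "\<lambda>_. N"] measurable_cong_sets[OF refl N] by blast
    then have "(\<lambda>w. clip T (w (sort_pair (i, j)))) \<in> borel_measurable (PiM (edges n) (\<lambda>_. N))" if "i < n" "j < n" for i j
      using measurable_compose[OF _ clip_measurable] sort_pair_in_edges that by blast
    then show ?thesis unfolding pairing_def[abs_def]
      by (intro borel_measurable_sum borel_measurable_times borel_measurable_const) auto
  qed
  then show ?thesis unfolding dual_sup_def[abs_def]
    by (intro borel_measurable_cSUP countable_dual_ball pairing_bdd)
qed

lemma pairing_update_le:
  assumes e: "e \<in> edges n" and B: "B \<in> dual_ball n b"
  shows "\<bar>pairing n T \<sigma> B x - pairing n T \<sigma> B (x(e := y))\<bar> \<le> 4 * \<sigma> (fst e) (snd e) * b * T"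
proof -
  obtain p q where pq: "e = (p, q)" "p < n" "q < n" using e by (auto simp: edges_def)
  let ?d = "\<lambda>i j. clip T (x (sort_pair (i, j))) - clip T ((x(e := y)) (sort_pair (i, j)))"
  define u where "u = \<sigma> p q * (2 * T) * b"
  have u0: "0 \<le> u" unfolding u_def using \<sigma>[of p q] pq T b by simp
  \<comment> \<open>Covers both orientations of the edge, with a double count when
    \<open>p = q\<close>.\<close>
  define g where "g i j = (if i = p \<and> j = q then u else 0) + (if i = q \<and> j = p then u else 0)" for i j
  have g0: "0 \<le> g i j" for i j unfolding g_def using u0 by (intro add_nonneg_nonneg) simp_all
  have "pairing n T \<sigma> B x - pairing n T \<sigma> B (x(e := y)) = (\<Sum>i<n. \<Sum>j<n. \<sigma> i j * ?d i j * B i j)"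
    unfolding pairing_def sum_subtractf[symmetric] by (simp add: algebra_simps)
  also have "\<bar>\<dots>\<bar> \<le> (\<Sum>i<n. \<Sum>j<n. \<bar>\<sigma> i j * ?d i j * B i j\<bar>)"
    by (rule order_trans[OF sum_abs]) (intro sum_mono sum_abs)
  also have "\<dots> \<le> (\<Sum>i<n. \<Sum>j<n. g i j)"
  proof (intro sum_mono)
    fix i j assume ij: "i \<in> {..<n}" "j \<in> {..<n}"
    show "\<bar>\<sigma> i j * ?d i j * B i j\<bar> \<le> g i j"
    proof (cases "sort_pair (i, j) = e")
      case False
      then have "?d i j = 0" by simp
      then show ?thesis using g0[of i j] by (simp only: mult_zero_right mult_zero_left abs_zero)
    next
      case True
      have "sort_pair (p, q) = e" using e pq by (auto simp: edges_def sort_pair_def)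
      then have "(i = p \<and> j = q) \<or> (i = q \<and> j = p)" using sort_pair_eqD[of i j p q] True by simp
      then have g: "u \<le> g i j" unfolding g_def using u0 by (elim disjE) simp_all
      have sg: "\<sigma> i j = \<sigma> p q" using sigma_sort_pair[OF sym, of i j] ij True pq by simp
      have "\<bar>?d i j\<bar> \<le> 2 * T"
        using clip_abs[OF T, of "x (sort_pair (i, j))"] clip_abs[OF T, of "(x(e := y)) (sort_pair (i, j))"] by linarith
      then have "\<bar>\<sigma> i j * ?d i j * B i j\<bar> \<le> u"
        unfolding u_def abs_mult sg using \<sigma>[of p q] pq B T by (intro mult_mono) (auto simp: dual_ball_def)
      then show ?thesis using g by linarith
    qed
  qed
  also have "\<dots> = 4 * \<sigma> p q * b * T"
  proof -
    have d: "(\<Sum>i<n. \<Sum>j<n. if i = p' \<and> j = q' then c else 0) = c" if "p' < n" "q' < n" for p' q' and c :: real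
    proof -
      have "(\<Sum>i<n. \<Sum>j<n. if i = p' \<and> j = q' then c else 0) = (\<Sum>i<n. if i = p' then (\<Sum>j<n. if j = q' then c else 0) else 0)"
        by (intro sum.cong refl) auto
      then show ?thesis using that by simp
    qed
    show ?thesis unfolding g_def sum.distrib d[OF pq(2,3)] d[OF pq(3,2)] by (simp add: u_def)
  qed
  finally show ?thesis by (simp add: pq)
qed

lemma dual_sup_update_le:
  assumes e: "e \<in> edges n"
  shows "\<bar>dual_sup n b T \<sigma> x - dual_sup n b T \<sigma> (x(e := y))\<bar> \<le> 4 * \<sigma> (fst e) (snd e) * b * T"
proof -
  let ?c = "4 * \<sigma> (fst e) (snd e) * b * T"
  have "dual_sup n b T \<sigma> x \<le> dual_sup n b T \<sigma> (x(e := y)) + ?c"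
  proof (rule dual_sup_least)
    fix B assume B: "B \<in> dual_ball n b"
    show "pairing n T \<sigma> B x \<le> dual_sup n b T \<sigma> (x(e := y)) + ?c"
      using pairing_update_le[OF e B, of x y] pairing_le_dual_sup[OF B, of "x(e := y)"] by linarith
  qed
  moreover have "dual_sup n b T \<sigma> (x(e := y)) \<le> dual_sup n b T \<sigma> x + ?c"
  proof (rule dual_sup_least)
    fix B assume B: "B \<in> dual_ball n b"
    show "pairing n T \<sigma> B (x(e := y)) \<le> dual_sup n b T \<sigma> x + ?c"
      using pairing_update_le[OF e B, of x y] pairing_le_dual_sup[OF B, of x] by linarith
  qed
  ultimately show ?thesis by linarith
qed

text \<open>Here the row sums replace the maximal coefficient: with \<open>b\<close> of order
  \<open>1 / n\<close> and \<open>T\<close> of order \<open>log n\<close> the bound tends to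
  zero.\<close>

lemma sum_squares_le: "(\<Sum>e\<in>edges n. (4 * \<sigma> (fst e) (snd e) * b * T)\<^sup>2) \<le> 16 * b\<^sup>2 * T\<^sup>2 * real n"
proof -
  have "(\<Sum>e\<in>edges n. (\<sigma> (fst e) (snd e))\<^sup>2) \<le> (\<Sum>e\<in>{..<n} \<times> {..<n}. (\<sigma> (fst e) (snd e))\<^sup>2)"
    by (intro sum_mono2) (auto simp: edges_def)
  also have "\<dots> = (\<Sum>i<n. \<Sum>j<n. (\<sigma> i j)\<^sup>2)" by (simp add: sum.cartesian_product case_prod_beta)
  also have "\<dots> = real n" using rows by simp
  finally have "16 * b\<^sup>2 * T\<^sup>2 * (\<Sum>e\<in>edges n. (\<sigma> (fst e) (snd e))\<^sup>2) \<le> 16 * b\<^sup>2 * T\<^sup>2 * real n" by (intro mult_left_mono) auto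
  then show ?thesis by (simp add: sum_distrib_left power_mult_distrib mult_ac)
qed

lemma dual_sup_le_spec_norm: "dual_sup n b T \<sigma> w \<le> spec_norm n (\<lambda>i j. \<sigma> i j * clip T (w (sort_pair (i, j))))"
  by (intro dual_sup_least) (auto simp: pairing_def dual_ball_def)

text \<open>By \<open>ip_odd_power_le\<close>, \<open>A^(2k+1) / Z\<close> is in the dual unit ball;
  it pairs with \<open>A\<close> to \<open>sqrt (p / q)\<close>, which is at least
  \<open>2 - \<epsilon>\<close>. Its entries are at most \<open>3 ^ (2*k+1) / Z\<close>, and
  \<open>Z\<close> is at least \<open>n / 3\<close>. A slightly shrunk rational approximation
  belongs to \<open>dual_ball\<close>.\<close>

lemma dual_sup_ge:
  fixes w :: "nat \<times> nat \<Rightarrow> real" and k :: nat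
  defines "A \<equiv> \<lambda>i j. \<sigma> i j * w (sort_pair (i, j))"
  assumes w: "\<And>e. e \<in> edges n \<Longrightarrow> \<bar>w e\<bar> \<le> T" and norm: "spec_norm n A \<le> 3"
    and \<epsilon>: "0 < \<epsilon>" "\<epsilon> \<le> 1" and tr: "(2 - \<epsilon>) ^ (2 * k + 2) * real n \<le> trace_pow n A (2 * k + 2)"
    and b_eq: "b = 2 * 3 ^ (2 * k + 2) / real n"
  shows "2 - 2 * \<epsilon> \<le> dual_sup n b T \<sigma> w"
proof -
  have As: "sym_mat n A" using sym by (auto simp: A_def sym_mat_def sort_pair_commute)
  define p q where "p = trace_pow n A (2 * k + 2)" and "q = trace_pow n A (2 * k)"
  have "1 \<le> (2 - \<epsilon>) ^ (2 * k + 2)" using \<epsilon> by (intro one_le_power) auto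
  then have "1 * real n \<le> (2 - \<epsilon>) ^ (2 * k + 2) * real n" by (intro mult_right_mono) auto
  then have pn: "real n \<le> p" using tr by (simp add: p_def)
  then have p: "0 < p" using n by simp
  have q: "0 < q" and ratio: "p / real n \<le> (p / q) ^ (k + 1)"
    unfolding p_def q_def by (rule trace_pow_ratio_ge[OF n As], use p p_def in simp)+
  have N0: "0 \<le> spec_norm n A" by (rule spec_norm_nonneg[OF n])
  have qn: "real n \<le> 9 * q"
  proof -
    have "p \<le> (spec_norm n A)\<^sup>2 * q" unfolding p_def q_def by (rule trace_pow_Suc_le[OF n As])
    also have "\<dots> \<le> 3\<^sup>2 * q" using norm N0 q by (intro mult_right_mono power_mono) auto
    finally show ?thesis using pn by simp
  qed
  define Z where "Z = sqrt (p * q)"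
  have Zn: "real n \<le> 3 * Z"
  proof -
    have "(real n)\<^sup>2 \<le> p * (9 * q)" unfolding power2_eq_square using pn qn p by (intro mult_mono) auto
    then have "real n \<le> sqrt (9 * (p * q))" by (intro real_le_rsqrt) (simp add: mult_ac)
    also have "\<dots> = 3 * Z" using real_sqrt_mult[of 9 "p * q"] by (simp add: Z_def)
    finally show ?thesis .
  qed
  have Z: "0 < Z" using p q by (simp add: Z_def)
  define B0 where "B0 i j = mat_pow n A (2 * k + 1) i j / Z" for i j
  have B0_dual: "(\<Sum>i<n. \<Sum>j<n. C i j * B0 i j) \<le> spec_norm n C" for C
  proof -
    have "(\<Sum>i<n. \<Sum>j<n. C i j * mat_pow n A (2 * k + 1) i j) \<le> spec_norm n C * Z"
      using ip_odd_power_le[OF n As, of C k] by (simp add: Z_def p_def q_def)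
    then have "(\<Sum>i<n. \<Sum>j<n. C i j * mat_pow n A (2 * k + 1) i j) / Z \<le> spec_norm n C" using Z by (simp add: pos_divide_le_eq)
    then show ?thesis unfolding B0_def times_divide_eq_right sum_divide_distrib[symmetric] .
  qed
  have AB0: "2 - \<epsilon> \<le> (\<Sum>i<n. \<Sum>j<n. A i j * B0 i j)"
  proof -
    have "(\<Sum>i<n. \<Sum>j<n. A i j * mat_pow n A (2 * k + 1) i j) = trace_pow n A (1 + (2 * k + 1))"
      unfolding trace_pow_add[OF As] by (intro sum.cong refl) (simp add: mat_pow_1 del: mat_pow.simps)
    then have "(\<Sum>i<n. \<Sum>j<n. A i j * mat_pow n A (2 * k + 1) i j) = p" by (simp add: p_def del: mat_pow.simps)
    then have "(\<Sum>i<n. \<Sum>j<n. A i j * B0 i j) = p / Z"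
      unfolding B0_def times_divide_eq_right sum_divide_distrib[symmetric] by (simp only:)
    also have "\<dots> = sqrt (p / q)"
    proof -
      have "p = sqrt p * sqrt p" using p by simp
      then show ?thesis using p q unfolding Z_def real_sqrt_mult real_sqrt_divide
        by (metis mult_divide_mult_cancel_left real_sqrt_gt_0_iff less_irrefl)
    qed
    finally have eq: "(\<Sum>i<n. \<Sum>j<n. A i j * B0 i j) = sqrt (p / q)" .
    have "(2 - \<epsilon>) ^ (2 * k + 2) \<le> p / real n" using tr n by (simp add: p_def pos_le_divide_eq)
    then have "(2 - \<epsilon>) ^ (2 * k + 2) \<le> (p / q) ^ (k + 1)" using ratio by (rule order_trans)
    moreover have "2 * k + 2 = 2 * (k + 1)" by simp
    ultimately have "((2 - \<epsilon>)\<^sup>2) ^ Suc k \<le> (p / q) ^ Suc k" by (simp only: power_mult Suc_eq_plus1)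
    then have "(2 - \<epsilon>)\<^sup>2 \<le> p / q" by (rule power_le_imp_le_base) (use p q in simp)
    then show ?thesis unfolding eq by (rule real_le_rsqrt)
  qed
  have B0_abs: "\<bar>B0 i j\<bar> \<le> 3 ^ (2 * k + 2) / real n" if "i < n" "j < n" for i j
  proof -
    have "\<bar>mat_pow n A (2 * k + 1) i j\<bar> \<le> spec_norm n A ^ (2 * k + 1)" by (rule mat_pow_entry_le[OF that])
    also have "\<dots> \<le> 3 ^ (2 * k + 1)" using norm N0 by (intro power_mono) auto
    finally have "\<bar>B0 i j\<bar> \<le> 3 ^ (2 * k + 1) / Z" unfolding B0_def using Z by (simp add: divide_right_mono)
    also have "\<dots> \<le> 3 ^ (2 * k + 1) / (real n / 3)" using Zn n by (intro divide_left_mono) auto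
    finally show ?thesis by (simp add: mult.commute)
  qed
  \<comment> \<open>The loss \<open>5 * \<eta>\<close> consists of \<open>2 * \<eta>\<close> from
    shrinking and \<open>3 * \<eta>\<close> from rounding, as the norm of \<open>A\<close> is at
    most 3.\<close>
  define \<eta> where "\<eta> = \<epsilon> / 5"
  have \<eta>: "0 < \<eta>" "\<eta> \<le> 1" "5 * \<eta> = \<epsilon>" using \<epsilon> by (auto simp: \<eta>_def)
  \<comment> \<open>Rounding \<open>n^2\<close> entries by at most \<open>\<tau>\<close> changes a
    pairing with \<open>C\<close> by at most \<open>\<eta> * spec_norm n C\<close>, exactly what the
    factor \<open>1 - \<eta>\<close> sets free.\<close>
  define \<tau> where "\<tau> = \<eta> / (real n * real n)"
  have \<tau>: "0 < \<tau>" "real n * (real n * \<tau>) = \<eta>" using \<eta> n by (auto simp: \<tau>_def)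
  have "\<exists>r \<in> \<rat>. (1 - \<eta>) * B0 i j - \<tau> < r \<and> r < (1 - \<eta>) * B0 i j + \<tau>" for i j
    using Rats_dense_in_real[of "(1 - \<eta>) * B0 i j - \<tau>" "(1 - \<eta>) * B0 i j + \<tau>"] \<tau> by auto
  then obtain R where R: "\<And>i j. R i j \<in> \<rat>" "\<And>i j. (1 - \<eta>) * B0 i j - \<tau> < R i j" "\<And>i j. R i j < (1 - \<eta>) * B0 i j + \<tau>" by metis
  define B where "B i j = (if i < n \<and> j < n then R i j else 0)" for i j
  have near: "\<bar>(\<Sum>i<n. \<Sum>j<n. C i j * B i j) - (1 - \<eta>) * (\<Sum>i<n. \<Sum>j<n. C i j * B0 i j)\<bar> \<le> \<eta> * spec_norm n C" for C
  proof -
    have "(\<Sum>i<n. \<Sum>j<n. C i j * B i j) - (1 - \<eta>) * (\<Sum>i<n. \<Sum>j<n. C i j * B0 i j)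
      = (\<Sum>i<n. \<Sum>j<n. C i j * (B i j - (1 - \<eta>) * B0 i j))"
      by (simp add: sum_distrib_left sum_subtractf[symmetric] algebra_simps)
    also have "\<bar>\<dots>\<bar> \<le> (\<Sum>i<n. \<Sum>j<n. \<bar>C i j * (B i j - (1 - \<eta>) * B0 i j)\<bar>)"
      by (rule order_trans[OF sum_abs]) (intro sum_mono sum_abs)
    also have "\<dots> \<le> (\<Sum>i<n. \<Sum>j<n. spec_norm n C * \<tau>)"
    proof (intro sum_mono)
      fix i j assume ij: "i \<in> {..<n}" "j \<in> {..<n}"
      have "\<bar>B i j - (1 - \<eta>) * B0 i j\<bar> \<le> \<tau>" using R(2,3)[of i j] ij by (simp add: B_def abs_le_iff)
      then show "\<bar>C i j * (B i j - (1 - \<eta>) * B0 i j)\<bar> \<le> spec_norm n C * \<tau>"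
        unfolding abs_mult using entry_le_spec_norm[of i n j C] ij spec_norm_nonneg[OF n, of C] by (intro mult_mono) auto
    qed
    also have "\<dots> = spec_norm n C * (real n * (real n * \<tau>))" by simp
    finally show ?thesis unfolding \<tau> by (simp add: mult.commute)
  qed
  have "B \<in> dual_ball n b"
    unfolding dual_ball_def
  proof (intro CollectI conjI allI impI)
    fix i j
    show "B i j \<in> \<rat>" using R(1) by (simp add: B_def)
    show "\<not> (i < n \<and> j < n) \<Longrightarrow> B i j = 0" unfolding B_def by (simp only: if_False)
    show "\<bar>B i j\<bar> \<le> b"
    proof (cases "i < n \<and> j < n")
      case True
      \<comment> \<open>The factor 2 in \<open>b\<close> leaves room for this rounding
        error.\<close>
      have "\<tau> \<le> 1 / (real n * 1)" unfolding \<tau>_def using \<eta> n by (intro frac_le mult_left_mono) auto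
      also have "\<dots> \<le> 3 ^ (2 * k + 2) / real n"
        unfolding mult_1_right by (intro divide_right_mono one_le_power) auto
      finally have t: "\<tau> \<le> 3 ^ (2 * k + 2) / real n" .
      have "\<bar>(1 - \<eta>) * B0 i j\<bar> \<le> 1 * \<bar>B0 i j\<bar>" unfolding abs_mult using \<eta> by (intro mult_right_mono) auto
      then have "\<bar>B i j\<bar> \<le> \<bar>B0 i j\<bar> + \<tau>" using R(2,3)[of i j] True by (simp add: B_def abs_le_iff)
      moreover have "b = 3 ^ (2 * k + 2) / real n + 3 ^ (2 * k + 2) / real n" unfolding b_eq by simp
      ultimately show ?thesis using B0_abs[of i j] True t by linarith
    qed (use b in \<open>auto simp: B_def\<close>)
  next
    fix C
    have "(1 - \<eta>) * (\<Sum>i<n. \<Sum>j<n. C i j * B0 i j) \<le> (1 - \<eta>) * spec_norm n C" using \<eta> by (intro mult_left_mono B0_dual) auto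
    then show "(\<Sum>i<n. \<Sum>j<n. C i j * B i j) \<le> spec_norm n C" using near[of C] by (simp add: algebra_simps abs_le_iff)
  qed
  then have "pairing n T \<sigma> B w \<le> dual_sup n b T \<sigma> w" by (rule pairing_le_dual_sup)
  moreover have "pairing n T \<sigma> B w = (\<Sum>i<n. \<Sum>j<n. A i j * B i j)"
    unfolding pairing_def A_def using w sort_pair_in_edges by (intro sum.cong refl) (simp add: clip_id)
  moreover have "2 - 2 * \<epsilon> \<le> (\<Sum>i<n. \<Sum>j<n. A i j * B i j)"
  proof -
    have "(1 - \<eta>) * (2 - \<epsilon>) \<le> (1 - \<eta>) * (\<Sum>i<n. \<Sum>j<n. A i j * B0 i j)" using \<eta> by (intro mult_left_mono AB0) auto
    moreover have "\<eta> * spec_norm n A \<le> \<eta> * 3" using \<eta> norm by (intro mult_left_mono) auto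
    moreover have "2 - 2 * \<epsilon> \<le> (1 - \<eta>) * (2 - \<epsilon>) - \<eta> * 3"
    proof -
      have "0 \<le> \<eta> * \<epsilon>" using \<eta> \<epsilon> by simp
      then show ?thesis using \<eta>(3) by (simp add: algebra_simps)
    qed
    ultimately show ?thesis using near[of A] by (simp add: abs_le_iff)
  qed
  ultimately show ?thesis by linarith
qed

end

subsection \<open>The lower tail\<close>

lemma mat_pow_cong:
  assumes "\<And>i j. i < n \<Longrightarrow> j < n \<Longrightarrow> A i j = B i j"
  shows "i < n \<Longrightarrow> j < n \<Longrightarrow> mat_pow n A k i j = mat_pow n B k i j"
  using assms by (induction k arbitrary: i j) auto

lemma trace_pow_cong: "(\<And>i j. i < n \<Longrightarrow> j < n \<Longrightarrow> A i j = B i j) \<Longrightarrow> trace_pow n A k = trace_pow n B k"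
  unfolding trace_pow_def by (intro sum.cong refl mat_pow_cong) auto

lemma spec_norm_cong:
  assumes "\<And>i j. i < n \<Longrightarrow> j < n \<Longrightarrow> A i j = B i j"
  shows "spec_norm n A = spec_norm n B"
proof -
  have "(\<Sum>i<n. (\<Sum>j<n. A i j * x j)\<^sup>2) = (\<Sum>i<n. (\<Sum>j<n. B i j * x j)\<^sup>2)" for x
    using assms by (intro sum.cong refl arg_cong[of _ _ "\<lambda>x. x\<^sup>2"]) auto
  then show ?thesis unfolding spec_norm_def by simp
qed

context subg
begin

lemma tail_le: "prob {\<omega> \<in> space M. t < \<bar>\<xi> \<omega>\<bar>} \<le> 2 * exp C * exp (- t)"
proof -
  note [measurable] = rv
  have int: "integrable M (\<lambda>\<omega>. exp (1 * \<xi> \<omega>) + exp (- 1 * \<xi> \<omega>))" by (intro Bochner_Integration.integrable_add exp_int)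
  have "prob {\<omega> \<in> space M. t < \<bar>\<xi> \<omega>\<bar>} \<le> prob {\<omega> \<in> space M. exp t \<le> exp (1 * \<xi> \<omega>) + exp (- 1 * \<xi> \<omega>)}"
  proof (intro finite_measure_mono subsetI CollectI conjI)
    fix \<omega> assume "\<omega> \<in> {\<omega> \<in> space M. t < \<bar>\<xi> \<omega>\<bar>}"
    then have "exp t \<le> exp \<bar>\<xi> \<omega>\<bar>" by simp
    also have "\<dots> \<le> exp (\<xi> \<omega>) + exp (- \<xi> \<omega>)" by (cases "0 \<le> \<xi> \<omega>") auto
    finally show "exp t \<le> exp (1 * \<xi> \<omega>) + exp (- 1 * \<xi> \<omega>)" by simp
  qed auto
  also have "\<dots> \<le> (\<integral>\<omega>. exp (1 * \<xi> \<omega>) + exp (- 1 * \<xi> \<omega>) \<partial>M) / exp t"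
    by (rule integral_Markov_inequality_measure[OF int sets.empty_sets]) (auto intro!: AE_I2 add_nonneg_nonneg)
  also have "\<dots> \<le> (exp C + exp C) / exp t"
  proof (intro divide_right_mono)
    have "(\<integral>\<omega>. exp (1 * \<xi> \<omega>) + exp (- 1 * \<xi> \<omega>) \<partial>M) = (\<integral>\<omega>. exp (1 * \<xi> \<omega>) \<partial>M) + (\<integral>\<omega>. exp (- 1 * \<xi> \<omega>) \<partial>M)"
      by (intro Bochner_Integration.integral_add exp_int)
    then show "(\<integral>\<omega>. exp (1 * \<xi> \<omega>) + exp (- 1 * \<xi> \<omega>) \<partial>M) \<le> exp C + exp C"
      using exp_le[of 1] exp_le[of "-1"] by simp
  qed simp
  finally show ?thesis by (simp add: exp_minus divide_inverse)
qed

end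

context rmatrix
begin

definition clip_event :: "real \<Rightarrow> 'a set" where
  "clip_event t = (\<Union>e\<in>edges n. {\<omega> \<in> space M. t < \<bar>entry e \<omega>\<bar>})"

lemma clip_event_events: "clip_event t \<in> events"
  unfolding clip_event_def by (intro sets.finite_UN) auto

lemma prob_clip_event_le: "prob (clip_event t) \<le> (real n)\<^sup>2 * (2 * exp C * exp (- t))"
proof -
  have "prob (clip_event t) \<le> (\<Sum>e\<in>edges n. prob {\<omega> \<in> space M. t < \<bar>entry e \<omega>\<bar>})"
    unfolding clip_event_def by (intro finite_measure_subadditive_finite) auto
  also have "\<dots> \<le> (\<Sum>e\<in>edges n. 2 * exp C * exp (- t))"
  proof (intro sum_mono)
    fix e assume e: "e \<in> edges n"
    have d: "distr M borel (entry e) = distr M borel \<xi>" using e W_distr by (auto simp: entry_def edges_def)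
    have "prob {\<omega> \<in> space M. t < \<bar>entry e \<omega>\<bar>} = measure (distr M borel (entry e)) {x. t < \<bar>x\<bar>}"
      by (subst measure_distr) (auto simp: vimage_def Int_def conj_commute)
    also have "\<dots> = prob {\<omega> \<in> space M. t < \<bar>\<xi> \<omega>\<bar>}"
      unfolding d using rv by (subst measure_distr) (auto simp: vimage_def Int_def conj_commute)
    finally show "prob {\<omega> \<in> space M. t < \<bar>entry e \<omega>\<bar>} \<le> 2 * exp C * exp (- t)" using tail_le[of t] by simp
  qed
  also have "\<dots> = real (card (edges n)) * (2 * exp C * exp (- t))" by simp
  also have "\<dots> \<le> (real n)\<^sup>2 * (2 * exp C * exp (- t))"
  proof (intro mult_right_mono)
    have "card (edges n) \<le> card ({..<n} \<times> {..<n})" by (intro card_mono) (auto simp: edges_def)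
    then have "real (card (edges n)) \<le> real (n * n)" by (simp del: of_nat_mult)
    then show "real (card (edges n)) \<le> (real n)\<^sup>2" by (simp add: power2_eq_square)
  qed simp
  finally show ?thesis .
qed

definition entries :: "'a \<Rightarrow> nat \<times> nat \<Rightarrow> real" where
  "entries \<omega> = (\<lambda>e\<in>edges n. entry e \<omega>)"

lemma entries_measurable: "entries \<in> measurable M (PiM (edges n) (\<lambda>_. borel))"
  unfolding entries_def[abs_def] by (rule measurable_restrict) simp

lemma entries_distr: "distr M (PiM (edges n) (\<lambda>_. borel)) entries = PiM (edges n) (\<lambda>_. distr M borel \<xi>)"
proof -
  have "(0, 0) \<in> edges n" using n_pos by (simp add: edges_def)
  then have ne: "edges n \<noteq> {}" by blast
  have "distr M (PiM (edges n) (\<lambda>_. borel)) entries = PiM (edges n) (\<lambda>e. distr M borel (entry e))"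
    using indep_vars_iff_distr_eq_PiM'[OF ne, where M' = "\<lambda>_. borel" and X = entry] entry_indep unfolding entries_def[abs_def] by simp
  also have "\<dots> = PiM (edges n) (\<lambda>_. distr M borel \<xi>)"
    using W_distr by (intro PiM_cong refl) (auto simp: entry_def edges_def)
  finally show ?thesis .
qed

lemma prob_entries:
  fixes c :: real
  assumes "f \<in> borel_measurable (PiM (edges n) (\<lambda>_. borel))"
  shows "prob {\<omega> \<in> space M. f (entries \<omega>) \<le> c}
     = measure (PiM (edges n) (\<lambda>_. distr M borel \<xi>)) {x \<in> space (PiM (edges n) (\<lambda>_. distr M borel \<xi>)). f x \<le> c}"
proof -
  have sp: "space (PiM (edges n) (\<lambda>_. distr M borel \<xi>)) = space (PiM (edges n) (\<lambda>_. borel :: real measure))"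
    by (simp add: space_PiM)
  have "{x \<in> space (PiM (edges n) (\<lambda>_. borel)). f x \<le> c} \<in> sets (PiM (edges n) (\<lambda>_. borel))" using assms by measurable
  then have "measure (distr M (PiM (edges n) (\<lambda>_. borel)) entries) {x \<in> space (PiM (edges n) (\<lambda>_. borel)). f x \<le> c}
    = prob (entries -` {x \<in> space (PiM (edges n) (\<lambda>_. borel)). f x \<le> c} \<inter> space M)"
    by (intro measure_distr entries_measurable)
  also have "entries -` {x \<in> space (PiM (edges n) (\<lambda>_. borel)). f x \<le> c} \<inter> space M = {\<omega> \<in> space M. f (entries \<omega>) \<le> c}"
    using measurable_space[OF entries_measurable] by auto
  finally show ?thesis unfolding entries_distr sp ..
qed

lemma XX_entries: "i < n \<Longrightarrow> j < n \<Longrightarrow> XX \<omega> i j = \<sigma> i j * entries \<omega> (sort_pair (i, j))"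
  using sort_pair_in_edges[of i n j] W_sym[of i j]
  by (cases "i \<le> j") (auto simp: hadamard_def entries_def entry_def sort_pair_def min_def max_def)

lemma entries_bounded: "\<omega> \<in> space M \<Longrightarrow> \<omega> \<notin> clip_event t \<Longrightarrow> e \<in> edges n \<Longrightarrow> \<bar>entries \<omega> e\<bar> \<le> t"
  by (auto simp: clip_event_def entries_def not_less)

text \<open>The second moment of \<open>tr X^(2k)\<close> needs no covariances: by Cauchy-Schwarz
  the square is at most \<open>n * tr X^(4k)\<close>, so a bound for one more expected trace
  suffices.\<close>

lemma paley_zygmund:
  assumes \<theta>: "0 < \<theta>" "2 * \<theta> * real n \<le> (\<integral>\<omega>. trace_pow n (XX \<omega>) (2 * k) \<partial>M)"
    and V: "0 < V" "(\<integral>\<omega>. trace_pow n (XX \<omega>) (4 * k) \<partial>M) \<le> V * real n"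
  shows "\<theta>\<^sup>2 / V \<le> prob {\<omega> \<in> space M. \<theta> * real n \<le> trace_pow n (XX \<omega>) (2 * k)}"
proof -
  have n: "0 < real n" using n_pos by simp
  let ?A = "{\<omega> \<in> space M. \<theta> * real n \<le> trace_pow n (XX \<omega>) (2 * k)}"
  have [measurable]: "(\<lambda>\<omega>. trace_pow n (XX \<omega>) (2 * k)) \<in> borel_measurable M" by (rule borel_measurable_integrable[OF trace_pow_integrable])
  have A: "?A \<in> events" by measurable
  \<comment> \<open>This makes \<open>a * V = \<theta> / 2\<close>. The pointwise bound rests on
    \<open>z - a * z^2 <= 1 / (4 * a)\<close>, and after integration \<open>\<theta> / 2\<close>
    remains for the event.\<close>
  define a where "a = \<theta> / (2 * V)"
  have a: "0 < a" using \<theta> V by (simp add: a_def)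
  have pt: "trace_pow n (XX \<omega>) (2 * k) / real n \<le> \<theta> + a / real n * trace_pow n (XX \<omega>) (4 * k) + 1 / (4 * a) * indicator ?A \<omega>"
    if "\<omega> \<in> space M" for \<omega>
  proof -
    define z where "z = trace_pow n (XX \<omega>) (2 * k) / real n"
    have "(trace_pow n (XX \<omega>) (2 * k))\<^sup>2 \<le> real n * trace_pow n (XX \<omega>) (4 * k)"
      using trace_pow_add_cs[OF XX_sym, where a = 0 and b = "2 * k"] by simp
    then have "z\<^sup>2 \<le> real n * trace_pow n (XX \<omega>) (4 * k) / (real n)\<^sup>2"
      unfolding z_def power_divide by (intro divide_right_mono) auto
    then have "z\<^sup>2 \<le> trace_pow n (XX \<omega>) (4 * k) / real n" using n by (simp add: power2_eq_square)
    from mult_left_mono[OF this less_imp_le[OF a]]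
    have az: "a * z\<^sup>2 \<le> a / real n * trace_pow n (XX \<omega>) (4 * k)" by simp
    show ?thesis
    proof (cases "\<omega> \<in> ?A")
      case True
      have "0 \<le> (2 * a * z - 1)\<^sup>2 / (4 * a)" using a by simp
      also have "\<dots> = a * z\<^sup>2 + 1 / (4 * a) - z" using a by (simp add: power2_eq_square field_simps)
      finally show ?thesis using True az \<theta> unfolding z_def[symmetric] by simp
    next
      case False
      then have "z < \<theta>" using that n by (simp add: z_def pos_divide_less_eq not_le)
      moreover have "0 \<le> a * z\<^sup>2" using a by simp
      ultimately show ?thesis using False az unfolding z_def[symmetric] by simp
    qed
  qed
  have "2 * \<theta> \<le> (\<integral>\<omega>. trace_pow n (XX \<omega>) (2 * k) / real n \<partial>M)" using \<theta> n by (simp add: pos_le_divide_eq)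
  also have "\<dots> \<le> (\<integral>\<omega>. \<theta> + a / real n * trace_pow n (XX \<omega>) (4 * k) + 1 / (4 * a) * indicator ?A \<omega> \<partial>M)"
    using A by (intro integral_mono pt integrable_divide Bochner_Integration.integrable_add integrable_mult_right trace_pow_integrable)
      (auto simp: integrable_indicator_iff emeasure_eq_measure)
  also have "\<dots> = \<theta> + a / real n * (\<integral>\<omega>. trace_pow n (XX \<omega>) (4 * k) \<partial>M) + 1 / (4 * a) * prob ?A"
    using A trace_pow_integrable[of "4 * k"] by (simp add: prob_space emeasure_eq_measure integrable_indicator_iff)
  also have "a / real n * (\<integral>\<omega>. trace_pow n (XX \<omega>) (4 * k) \<partial>M) \<le> a / real n * (V * real n)"
    using V a n by (intro mult_left_mono) auto
  also have "a / real n * (V * real n) = \<theta> / 2" using n V by (simp add: a_def)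
  finally have "\<theta> / 2 \<le> 1 / (4 * a) * prob ?A" by simp
  then show ?thesis using \<theta> V by (simp add: a_def power2_eq_square field_simps)
qed

end

context rmatrix_seq
begin

lemma interp: "0 < n \<Longrightarrow> rmatrix M \<xi> C n (W n) (\<sigma> n) (s n)"
  by (rule rmatrix)

lemma eventually_trace_ge:
  assumes "\<theta> < ballot (2 * k) 0"
  shows "\<forall>\<^sub>F n in sequentially. \<theta> * real n \<le> (\<integral>\<omega>. trace_pow n (X n \<omega>) (2 * k) \<partial>M)"
proof -
  define K where "K = (\<Sum>c\<in>patterns (2 * k). \<bar>weight mu (uedges c)\<bar>)"
  have s2: "(\<lambda>n. real (2 * k) * (s n)\<^sup>2) \<longlonglongrightarrow> real (2 * k) * 0\<^sup>2"
    by (intro tendsto_mult tendsto_power s_tendsto_0 tendsto_const)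
  have "(\<lambda>n. (1 - real (2 * k) * (s n)\<^sup>2) ^ (2 * k) * ballot (2 * k) 0 - s n * K) \<longlonglongrightarrow> (1 - real (2 * k) * 0\<^sup>2) ^ (2 * k) * ballot (2 * k) 0 - 0 * K"
    by (intro tendsto_diff tendsto_mult tendsto_power tendsto_const s2[simplified] s2 s_tendsto_0)
  then have "\<forall>\<^sub>F n in sequentially. \<theta> < (1 - real (2 * k) * (s n)\<^sup>2) ^ (2 * k) * ballot (2 * k) 0 - s n * K"
    by (rule order_tendstoD) (use assms in simp)
  moreover have "\<forall>\<^sub>F n in sequentially. real (2 * k) * (s n)\<^sup>2 < 1" using s2 by (rule order_tendstoD) simp
  moreover have "\<forall>\<^sub>F n in sequentially. s n < 1" using s_tendsto_0 by (rule order_tendstoD) simp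
  ultimately show ?thesis using eventually_gt_at_top[of 0]
  proof eventually_elim
    case (elim n)
    interpret rmatrix M \<xi> C n "W n" "\<sigma> n" "s n" using elim by (intro interp)
    have "\<theta> * real n \<le> real n * ((1 - real (2 * k) * (s n)\<^sup>2) ^ (2 * k) * ballot (2 * k) 0 - s n * K)"
      using elim by (simp add: mult.commute)
    also have "\<dots> \<le> (\<integral>\<omega>. trace_pow n (X n \<omega>) (2 * k) \<partial>M)"
      unfolding K_def by (rule expected_trace_ge) (use elim in auto)
    finally show ?case .
  qed
qed

lemma eventually_trace_le:
  assumes k: "0 < k"
  obtains V where "0 < V" "\<forall>\<^sub>F n in sequentially. (\<integral>\<omega>. trace_pow n (X n \<omega>) (2 * k) \<partial>M) \<le> V * real n"
proof -
  obtain D A :: real where DA: "0 < D" "0 < A" and b: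
    "\<And>n W \<sigma> s p. rmatrix M \<xi> C n W \<sigma> s \<Longrightarrow> 0 < p \<Longrightarrow> s\<^sup>2 * A * real p \<le> 1 \<Longrightarrow>
      (\<integral>\<omega>. trace_pow n (hadamard W \<sigma> \<omega>) (2 * p) \<partial>M) \<le> D * real n * real p * (2 + 1) ^ (2 * p)"
    using uniform_trace_bound[of 1] by auto
  have "(\<lambda>n. (s n)\<^sup>2 * A * real k) \<longlonglongrightarrow> 0\<^sup>2 * A * real k"
    by (intro tendsto_mult tendsto_power s_tendsto_0 tendsto_const)
  then have "\<forall>\<^sub>F n in sequentially. (s n)\<^sup>2 * A * real k < 1" by (rule order_tendstoD) simp
  with eventually_gt_at_top[of 0]
  have "\<forall>\<^sub>F n in sequentially. (\<integral>\<omega>. trace_pow n (X n \<omega>) (2 * k) \<partial>M) \<le> (D * real k * 3 ^ (2 * k)) * real n"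
  proof eventually_elim
    case (elim n)
    then show ?case using b[OF interp[OF elim(1)] k] by (simp add: mult_ac)
  qed
  then show thesis using that[of "D * real k * 3 ^ (2 * k)"] DA k by simp
qed

text \<open>The functional \<open>F n\<close> concentrates around its mean, and Paley-Zygmund
  locates the mean. One \<open>\<epsilon>\<close> is lost in each of four places: the growth rate of
  the trace, the dual approximation, locating the mean, and the final deviation from it.\<close>

lemma lower_tail:
  assumes \<epsilon>: "0 < \<epsilon>" "\<epsilon> \<le> 1"
  obtains E where "\<And>n. E n \<in> events" "\<forall>\<^sub>F n in sequentially. prob (E n) \<le> 2 / (real n)\<^sup>2"
    "\<forall>\<^sub>F n in sequentially. \<forall>\<omega>\<in>space M. \<omega> \<notin> E n \<longrightarrow> 2 - 4 * \<epsilon> \<le> spec_norm n (X n \<omega>)"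
proof -
  \<comment> \<open>The factor 4 leaves the 2 that \<open>paley_zygmund\<close> asks for and makes
    the inequality strict.\<close>
  obtain k0 where k0: "0 < k0" "4 * (2 - \<epsilon>) ^ (2 * k0) \<le> ballot (2 * k0) 0"
    using ballot_growth[of "2 - \<epsilon>" 4] \<epsilon> by auto
  obtain k where k: "k0 = Suc k" using k0 by (cases k0) auto
  define \<theta> where "\<theta> = (2 - \<epsilon>) ^ (2 * k + 2)"
  have \<theta>: "0 < \<theta>" using \<epsilon> by (simp add: \<theta>_def)
  have "2 * \<theta> < ballot (2 * Suc k) 0" using k0 \<theta> unfolding k \<theta>_def by simp
  note tr_ge = eventually_trace_ge[OF this]
  obtain V where V: "0 < V" and tr_le: "\<forall>\<^sub>F n in sequentially. (\<integral>\<omega>. trace_pow n (X n \<omega>) (2 * (2 * Suc k)) \<partial>M) \<le> V * real n"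
    using eventually_trace_le[of "2 * Suc k"] by auto
  obtain U where U: "\<And>n. U n \<in> events" "\<forall>\<^sub>F n in sequentially. prob (U n) \<le> 1 / (real n)\<^sup>2"
    "\<And>n \<omega>. 0 < n \<Longrightarrow> \<omega> \<in> space M \<Longrightarrow> \<omega> \<notin> U n \<Longrightarrow> spec_norm n (X n \<omega>) < 2 + 1"
    using upper_tail[of 1] by auto
  \<comment> \<open>With the rate 5 the union bound over at most \<open>n^2\<close> entries is of
    order \<open>n^2 * n^(-5)\<close>, eventually below \<open>1 / n^2\<close>.\<close>
  define T where "T n = 5 * ln (real n)" for n :: nat
  define b where "b n = 2 * 3 ^ (2 * k + 2) / real n" for n :: nat
  \<comment> \<open>\<open>16 * 2^2 * 5^2 = 1600\<close>: with this \<open>S n\<close> equals the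
    bound \<open>16 * b^2 * T^2 * n\<close> of \<open>sum_squares_le\<close>.\<close>
  define K :: real where "K = 1600 * (3 ^ (2 * k + 2))\<^sup>2"
  have K: "0 < K" by (simp add: K_def)
  define S where "S n = K * (ln (real n))\<^sup>2 / real n" for n :: nat
  define q where "q n = exp (- (2 * \<epsilon>\<^sup>2 / S n))" for n
  define \<nu> where "\<nu> = distr M borel \<xi>"
  have \<nu>: "prob_space \<nu>" "space \<nu> = UNIV" "sets \<nu> = sets borel"
    unfolding \<nu>_def using rv by (auto intro: prob_space_distr)
  define F where "F n = dual_sup n (b n) (T n) (\<sigma> n)" for n
  define Cl where "Cl n = (if 0 < n then rmatrix.clip_event M n (W n) (T n) else {})" for n
  define w where "w n = rmatrix.entries n (W n)" for n
  define E where "E n = (if 0 < n then {\<omega> \<in> space M. F n (w n \<omega>) \<le> 2 - 4 * \<epsilon>} \<union> Cl n else {})" for n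
  have fn: "clipped_dual n (b n) (T n) (\<sigma> n) (s n)" if "0 < n" for n
  proof -
    interpret rmatrix M \<xi> C n "W n" "\<sigma> n" "s n" by (rule interp[OF that])
    show ?thesis
      by unfold_locales (use that \<sigma>_bounds \<sigma>_sym \<sigma>_rows in \<open>auto simp: b_def T_def\<close>)
  qed
  have Fm: "F n \<in> borel_measurable (PiM (edges n) (\<lambda>_. N))" if "0 < n" "sets N = sets borel" for n N
    unfolding F_def by (rule clipped_dual.dual_sup_measurable[OF fn[OF that(1)] that(2)])
  have wm: "w n \<in> measurable M (PiM (edges n) (\<lambda>_. borel))" if "0 < n" for n
    unfolding w_def by (rule rmatrix.entries_measurable[OF interp[OF that]])
  have Fw: "(\<lambda>\<omega>. F n (w n \<omega>)) \<in> borel_measurable M" if "0 < n" for n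
    by (rule measurable_compose[OF wm[OF that] Fm[OF that refl]])
  have Cl_ev: "Cl n \<in> events" for n
    unfolding Cl_def using rmatrix.clip_event_events[OF interp] by auto
  have E_ev: "E n \<in> events" for n
  proof (cases "0 < n")
    case True
    note [measurable] = Fw[OF True]
    show ?thesis unfolding E_def using True Cl_ev by auto
  qed (simp add: E_def)
  have Cl_prob: "\<forall>\<^sub>F n in sequentially. prob (Cl n) \<le> 1 / (real n)\<^sup>2"
  proof -
    have "(\<lambda>n :: nat. (real n) ^ 4 * (2 * exp C * exp (- (5 * ln (real n))))) \<longlonglongrightarrow> 0" by real_asymp
    then have "\<forall>\<^sub>F n :: nat in sequentially. (real n) ^ 4 * (2 * exp C * exp (- (5 * ln (real n)))) < 1"
      by (rule order_tendstoD) simp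
    with eventually_gt_at_top[of 0] show ?thesis
    proof eventually_elim
      case (elim n)
      have n: "0 < real n" using elim by simp
      have "prob (Cl n) \<le> (real n)\<^sup>2 * (2 * exp C * exp (- T n))"
        unfolding Cl_def using elim rmatrix.prob_clip_event_le[OF interp[OF elim(1)]] by simp
      moreover have "(real n)\<^sup>2 * ((real n)\<^sup>2 * (2 * exp C * exp (- T n))) \<le> 1"
        using elim by (simp add: T_def power2_eq_square power4_eq_xxxx mult_ac)
      then have "(real n)\<^sup>2 * (2 * exp C * exp (- T n)) \<le> 1 / (real n)\<^sup>2" using n by (simp add: pos_le_divide_eq mult_ac)
      ultimately show ?case by linarith
    qed
  qed
  \<comment> \<open>For \<open>F n\<close> and \<open>- F n\<close>: the upper tail locates the
    mean, the lower tail gives the result.\<close>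
  have mcd: "prob {\<omega> \<in> space M. f (w n \<omega>) \<le> (\<integral>z. f z \<partial>PiM (edges n) (\<lambda>_. \<nu>)) - \<epsilon>} \<le> q n"
    if n1: "1 < n" and f: "f = F n \<or> f = (\<lambda>x. - F n x)" for n f
  proof -
    have n0: "0 < n" using n1 by simp
    interpret clipped_dual n "b n" "T n" "\<sigma> n" "s n" by (rule fn[OF n0])
    have fm: "f \<in> borel_measurable (PiM (edges n) (\<lambda>_. N))" if "sets N = sets borel" for N
      using f Fm[OF n0 that] by auto
    have "prob {\<omega> \<in> space M. f (w n \<omega>) \<le> (\<integral>z. f z \<partial>PiM (edges n) (\<lambda>_. \<nu>)) - \<epsilon>}
      = measure (PiM (edges n) (\<lambda>_. \<nu>)) {x \<in> space (PiM (edges n) (\<lambda>_. \<nu>)). f x \<le> (\<integral>z. f z \<partial>PiM (edges n) (\<lambda>_. \<nu>)) - \<epsilon>}"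
      unfolding w_def \<nu>_def by (rule rmatrix.prob_entries[OF interp[OF n0] fm[OF refl]])
    also have "\<dots> \<le> exp (- (2 * \<epsilon>\<^sup>2 / S n))"
    proof (rule bounded_differences_lower_tail[OF \<nu>(1,2) finite_edges fm[OF \<nu>(3)]])
      show "\<bar>f x\<bar> \<le> real n * (real n * (s n * T n * b n))" for x using f dual_sup_abs_le[of x] by (auto simp: F_def)
      show "\<bar>f x - f (x(e := y))\<bar> \<le> 4 * \<sigma> n (fst e) (snd e) * b n * T n" if "e \<in> edges n" for x e y
        using f dual_sup_update_le[OF that, of x y] by (auto simp: F_def abs_minus_commute)
      have "16 * (b n)\<^sup>2 * (T n)\<^sup>2 * real n = S n"
        using n1 by (simp add: b_def T_def S_def K_def power_divide power_mult_distrib power2_eq_square field_simps)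
      then show "(\<Sum>e\<in>edges n. (4 * \<sigma> n (fst e) (snd e) * b n * T n)\<^sup>2) \<le> S n" using sum_squares_le by simp
      show "0 < S n" using K n1 by (simp add: S_def)
    qed (use \<epsilon> in auto)
    finally show ?thesis by (simp add: q_def)
  qed
  have q0: "\<forall>\<^sub>F n in sequentially. q n \<le> 1 / (real n)\<^sup>2"
  proof -
    have "(\<lambda>n :: nat. (ln (real n)) ^ 3 / real n) \<longlonglongrightarrow> 0" by real_asymp
    then have "\<forall>\<^sub>F n :: nat in sequentially. (ln (real n)) ^ 3 / real n < \<epsilon>\<^sup>2 / K"
      by (rule order_tendstoD) (use \<epsilon> K in simp)
    with eventually_gt_at_top[of 1] show ?thesis
    proof eventually_elim
      case (elim n)
      have n: "0 < real n" "0 < ln (real n)" using elim by auto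
      have "K * (ln (real n)) ^ 3 \<le> \<epsilon>\<^sup>2 * real n" using elim n K by (simp add: field_simps)
      then have "2 * ln (real n) \<le> 2 * \<epsilon>\<^sup>2 / S n"
        unfolding S_def using n K by (simp add: pos_le_divide_eq power2_eq_square power3_eq_cube mult_ac)
      then have "q n \<le> exp (- (2 * ln (real n)))" by (simp add: q_def)
      also have "\<dots> = 1 / (real n)\<^sup>2" using n by (simp add: exp_minus exp_double divide_inverse)
      finally show ?case .
    qed
  qed
  define \<gamma> where "\<gamma> = \<theta>\<^sup>2 / V"
  have \<gamma>: "0 < \<gamma>" using \<theta> V by (simp add: \<gamma>_def)
  have small: "\<forall>\<^sub>F n :: nat in sequentially. 3 * (1 / (real n)\<^sup>2) < \<gamma>"
  proof -
    have "(\<lambda>n :: nat. 3 * (1 / (real n)\<^sup>2)) \<longlonglongrightarrow> 0" by real_asymp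
    then show ?thesis by (rule order_tendstoD) (use \<gamma> in simp)
  qed
  \<comment> \<open>If the mean were below \<open>2 - 3 * \<epsilon>\<close>, the Paley-Zygmund
    event, of probability at least \<open>\<gamma>\<close>, would up to \<open>U n\<close> and
    \<open>Cl n\<close> force \<open>F n\<close> to exceed its mean by \<open>\<epsilon>\<close>.
    The three exceptional probabilities sum to at most \<open>3 / n^2\<close>, which is below
    \<open>\<gamma>\<close>.\<close>
  have mean: "\<forall>\<^sub>F n in sequentially. 2 - 3 * \<epsilon> \<le> (\<integral>z. F n z \<partial>PiM (edges n) (\<lambda>_. \<nu>))"
    using tr_ge tr_le U(2) Cl_prob q0 small eventually_gt_at_top[of 1]
  proof eventually_elim
    case (elim n)
    have n: "0 < n" "1 < n" using elim by auto
    interpret rmatrix M \<xi> C n "W n" "\<sigma> n" "s n" by (rule interp[OF n(1)])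
    interpret f: clipped_dual n "b n" "T n" "\<sigma> n" "s n" by (rule fn[OF n(1)])
    let ?m = "\<integral>z. F n z \<partial>PiM (edges n) (\<lambda>_. \<nu>)"
    let ?Z = "{\<omega> \<in> space M. \<theta> * real n \<le> trace_pow n (X n \<omega>) (2 * Suc k)}"
    show ?case
    proof (rule ccontr)
      assume low: "\<not> 2 - 3 * \<epsilon> \<le> ?m"
      have "\<gamma> \<le> prob ?Z"
      proof -
        have "2 * (2 * Suc k) = 4 * Suc k" by simp
        with elim(2) have "(\<integral>\<omega>. trace_pow n (X n \<omega>) (4 * Suc k) \<partial>M) \<le> V * real n" by (simp only:)
        then show ?thesis unfolding \<gamma>_def by (rule paley_zygmund[OF \<theta> elim(1) V])
      qed
      also have "\<dots> \<le> prob (U n \<union> (Cl n \<union> {\<omega> \<in> space M. - F n (w n \<omega>) \<le> - ?m - \<epsilon>}))"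
      proof (intro finite_measure_mono subsetI)
        fix \<omega> assume \<omega>: "\<omega> \<in> ?Z"
        show "\<omega> \<in> U n \<union> (Cl n \<union> {\<omega> \<in> space M. - F n (w n \<omega>) \<le> - ?m - \<epsilon>})"
        proof (cases "\<omega> \<in> U n \<or> \<omega> \<in> Cl n")
          case False
          have eq: "X n \<omega> i j = \<sigma> n i j * w n \<omega> (sort_pair (i, j))" if "i < n" "j < n" for i j
            unfolding w_def by (rule XX_entries[OF that])
          have "2 - 2 * \<epsilon> \<le> dual_sup n (b n) (T n) (\<sigma> n) (w n \<omega>)"
          proof (rule f.dual_sup_ge[OF _ _ \<epsilon>])
            show "\<bar>w n \<omega> e\<bar> \<le> T n" if "e \<in> edges n" for e
              unfolding w_def by (rule entries_bounded[OF _ _ that]) (use \<omega> False n in \<open>auto simp: Cl_def\<close>)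
            show "spec_norm n (\<lambda>i j. \<sigma> n i j * w n \<omega> (sort_pair (i, j))) \<le> 3"
              using U(3)[OF n(1), of \<omega>] \<omega> False spec_norm_cong[of n "X n \<omega>" "\<lambda>i j. \<sigma> n i j * w n \<omega> (sort_pair (i, j))"] eq by simp
            show "(2 - \<epsilon>) ^ (2 * k + 2) * real n \<le> trace_pow n (\<lambda>i j. \<sigma> n i j * w n \<omega> (sort_pair (i, j))) (2 * k + 2)"
              using \<omega> trace_pow_cong[of n "X n \<omega>" "\<lambda>i j. \<sigma> n i j * w n \<omega> (sort_pair (i, j))" "2 * k + 2"] eq by (simp add: \<theta>_def)
          qed (simp add: b_def)
          then show ?thesis using \<omega> low by (simp add: F_def)
        qed auto
      next
        show "U n \<union> (Cl n \<union> {\<omega> \<in> space M. - F n (w n \<omega>) \<le> - ?m - \<epsilon>}) \<in> events"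
        proof (intro sets.Un U Cl_ev)
          note [measurable] = Fw[OF n(1)]
          show "{\<omega> \<in> space M. - F n (w n \<omega>) \<le> - ?m - \<epsilon>} \<in> events" by measurable
        qed
      qed
      also have "\<dots> \<le> prob (U n) + (prob (Cl n) + prob {\<omega> \<in> space M. - F n (w n \<omega>) \<le> - ?m - \<epsilon>})"
      proof -
        note [measurable] = Fw[OF n(1)]
        have ev: "{\<omega> \<in> space M. - F n (w n \<omega>) \<le> - ?m - \<epsilon>} \<in> events" by measurable
        then have "Cl n \<union> {\<omega> \<in> space M. - F n (w n \<omega>) \<le> - ?m - \<epsilon>} \<in> events" using Cl_ev by auto
        from measure_Un_le[OF U(1) this] measure_Un_le[OF Cl_ev ev] show ?thesis by (meson add_left_mono order_trans)
      qed
      also have "prob {\<omega> \<in> space M. - F n (w n \<omega>) \<le> - ?m - \<epsilon>} \<le> q n"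
        using mcd[OF n(2), of "\<lambda>x. - F n x"] by simp
      finally show False using elim by linarith
    qed
  qed
  have E_prob: "\<forall>\<^sub>F n in sequentially. prob (E n) \<le> 2 / (real n)\<^sup>2"
    using mean Cl_prob q0 eventually_gt_at_top[of 1]
  proof eventually_elim
    case (elim n)
    have n: "0 < n" using elim by simp
    note [measurable] = Fw[OF n]
    have "prob (E n) \<le> prob {\<omega> \<in> space M. F n (w n \<omega>) \<le> 2 - 4 * \<epsilon>} + prob (Cl n)"
      unfolding E_def using n Cl_ev by (simp add: measure_Un_le)
    also have "prob {\<omega> \<in> space M. F n (w n \<omega>) \<le> 2 - 4 * \<epsilon>}
      \<le> prob {\<omega> \<in> space M. F n (w n \<omega>) \<le> (\<integral>z. F n z \<partial>PiM (edges n) (\<lambda>_. \<nu>)) - \<epsilon>}"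
      by (intro finite_measure_mono) (use elim in auto)
    also have "\<dots> \<le> q n" by (rule mcd) (use elim in auto)
    finally show ?case using elim by simp
  qed
  have "\<forall>\<^sub>F n in sequentially. \<forall>\<omega>\<in>space M. \<omega> \<notin> E n \<longrightarrow> 2 - 4 * \<epsilon> \<le> spec_norm n (X n \<omega>)"
    using eventually_gt_at_top[of 0]
  proof eventually_elim
    case (elim n)
    interpret rmatrix M \<xi> C n "W n" "\<sigma> n" "s n" by (rule interp[OF elim])
    interpret f: clipped_dual n "b n" "T n" "\<sigma> n" "s n" by (rule fn[OF elim])
    show ?case
    proof (intro ballI impI)
      fix \<omega> assume \<omega>: "\<omega> \<in> space M" "\<omega> \<notin> E n"
      have "2 - 4 * \<epsilon> \<le> F n (w n \<omega>)" using \<omega> elim by (auto simp: E_def)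
      also have "\<dots> \<le> spec_norm n (\<lambda>i j. \<sigma> n i j * clip (T n) (w n \<omega> (sort_pair (i, j))))"
        unfolding F_def by (rule f.dual_sup_le_spec_norm)
      also have "\<dots> = spec_norm n (X n \<omega>)"
      proof (rule spec_norm_cong)
        fix i j assume ij: "i < n" "j < n"
        have "\<bar>w n \<omega> (sort_pair (i, j))\<bar> \<le> T n"
          unfolding w_def by (rule entries_bounded[OF \<omega>(1) _ sort_pair_in_edges[OF ij]]) (use \<omega> elim in \<open>auto simp: E_def Cl_def\<close>)
        then have "clip (T n) (w n \<omega> (sort_pair (i, j))) = w n \<omega> (sort_pair (i, j))" by (rule clip_id)
        then show "\<sigma> n i j * clip (T n) (w n \<omega> (sort_pair (i, j))) = X n \<omega> i j"
          unfolding w_def by (simp add: XX_entries[OF ij])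
      qed
      finally show "2 - 4 * \<epsilon> \<le> spec_norm n (X n \<omega>)" .
    qed
  qed
  then show thesis using that[of E] E_ev E_prob by blast
qed

section \<open>Almost sure convergence\<close>

lemma borel_cantelli_eventually:
  assumes E: "\<And>n. E n \<in> events" "\<forall>\<^sub>F n in sequentially. prob (E n) \<le> c / (real n)\<^sup>2"
  shows "AE \<omega> in M. \<forall>\<^sub>F n in sequentially. \<omega> \<notin> E n"
proof -
  have sum: "summable (\<lambda>n. c / (real n)\<^sup>2)"
    using summable_mult[OF inverse_power_summable[of 2, where 'a = real], of c] by (simp add: divide_inverse)
  have "summable (\<lambda>n. prob (E n))"
    by (rule summable_comparison_test_ev[OF _ sum]) (use E(2) in simp)
  then have "AE \<omega> in M. \<forall>\<^sub>F n in sequentially. \<omega> \<in> space M - E n"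
    by (intro borel_cantelli_AE1 E) (simp add: emeasure_eq_measure)
  then show ?thesis by eventually_elim (auto elim: eventually_mono)
qed

text \<open>The tolerance runs through \<open>4 / (m + 1)\<close>, so that only countably many null
  sets are discarded.\<close>

theorem spec_norm_tendsto_2: "AE \<omega> in M. (\<lambda>n. spec_norm n (X n \<omega>)) \<longlonglongrightarrow> 2"
proof -
  have "AE \<omega> in M. \<forall>\<^sub>F n in sequentially. dist (spec_norm n (X n \<omega>)) 2 \<le> 4 / real (Suc m)" for m
  proof -
    define \<epsilon> where "\<epsilon> = 1 / real (Suc m)"
    have \<epsilon>: "0 < \<epsilon>" "\<epsilon> \<le> 1" by (auto simp: \<epsilon>_def)
    obtain U where U: "\<And>n. U n \<in> events" "\<forall>\<^sub>F n in sequentially. prob (U n) \<le> 1 / (real n)\<^sup>2"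
      "\<And>n \<omega>. 0 < n \<Longrightarrow> \<omega> \<in> space M \<Longrightarrow> \<omega> \<notin> U n \<Longrightarrow> spec_norm n (X n \<omega>) < 2 + \<epsilon>"
      using upper_tail[OF \<epsilon>(1)] by blast
    obtain L where L: "\<And>n. L n \<in> events" "\<forall>\<^sub>F n in sequentially. prob (L n) \<le> 2 / (real n)\<^sup>2"
      "\<forall>\<^sub>F n in sequentially. \<forall>\<omega>\<in>space M. \<omega> \<notin> L n \<longrightarrow> 2 - 4 * \<epsilon> \<le> spec_norm n (X n \<omega>)"
      using lower_tail[OF \<epsilon>] by blast
    from borel_cantelli_eventually[OF U(1,2)] borel_cantelli_eventually[OF L(1,2)] AE_space show ?thesis
    proof eventually_elim
      case (elim \<omega>)
      from elim(1,2) L(3) eventually_gt_at_top[of 0] show ?case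
      proof eventually_elim
        case (elim n)
        then have "spec_norm n (X n \<omega>) < 2 + \<epsilon>" "2 - 4 * \<epsilon> \<le> spec_norm n (X n \<omega>)"
          using U(3)[of n \<omega>] \<open>\<omega> \<in> space M\<close> by auto
        moreover have "4 / real (Suc m) = 4 * \<epsilon>" by (simp add: \<epsilon>_def)
        ultimately show ?case using \<epsilon> unfolding dist_real_def by linarith
      qed
    qed
  qed
  then have "AE \<omega> in M. \<forall>m. \<forall>\<^sub>F n in sequentially. dist (spec_norm n (X n \<omega>)) 2 \<le> 4 / real (Suc m)"
    by (simp only: AE_all_countable) blast
  then show ?thesis
  proof eventually_elim
    case (elim \<omega>)
    show ?case
    proof (rule tendstoI)
      fix e :: real assume e: "0 < e"
      obtain m where m: "4 / e < real (Suc m)" using reals_Archimedean2[of "4 / e"] by (metis less_SucI of_nat_less_iff order_less_trans lessI)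
      then have "4 / real (Suc m) < e" using e by (simp add: field_simps)
      with elim[rule_format, of m] show "\<forall>\<^sub>F n in sequentially. dist (spec_norm n (X n \<omega>)) 2 < e"
        by (auto elim: eventually_mono)
    qed
  qed
qed

end

theorem theorem1p2:
  fixes M :: "'a measure"
    and \<xi> :: "'a \<Rightarrow> real"
    and W :: "nat \<Rightarrow> nat \<Rightarrow> nat \<Rightarrow> 'a \<Rightarrow> real"
    and \<sigma> :: "nat \<Rightarrow> nat \<Rightarrow> nat \<Rightarrow> real"
  assumes prob: "prob_space M"
    and xi_rv: "\<xi> \<in> borel_measurable M"
    and xi_subg: "subgaussian M \<xi>"
    and xi_int: "integrable M \<xi>"
    and xi_centered: "(\<integral>x. \<xi> x \<partial>M) = 0"
    and xi_sq_int: "integrable M (\<lambda>x. (\<xi> x)\<^sup>2)"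
    and xi_var: "(\<integral>x. (\<xi> x)\<^sup>2 \<partial>M) = 1"
    and W_rv: "\<And>n i j. W n i j \<in> borel_measurable M"
    and W_sym: "\<And>n i j. i < n \<Longrightarrow> j < n \<Longrightarrow> W n i j = W n j i"
    and W_distr: "\<And>n i j. i \<le> j \<Longrightarrow> j < n \<Longrightarrow> distr M borel (W n i j) = distr M borel \<xi>"
    and W_indep: "\<And>n. prob_space.indep_vars M (\<lambda>_. borel) (\<lambda>(i, j). W n i j)
                          {(i, j). i \<le> j \<and> j < n}"
    and \<sigma>_nonneg: "\<And>n i j. i < n \<Longrightarrow> j < n \<Longrightarrow> 0 \<le> \<sigma> n i j"
    and \<sigma>_sym: "\<And>n i j. i < n \<Longrightarrow> j < n \<Longrightarrow> \<sigma> n i j = \<sigma> n j i"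
    and \<sigma>_rows: "\<And>n i. i < n \<Longrightarrow> (\<Sum>j<n. (\<sigma> n i j)\<^sup>2) = 1"
    and \<sigma>_max: "(\<lambda>n. Max {\<sigma> n i j | i j. i < n \<and> j < n} * sqrt (ln (real n)))
                  \<longlonglongrightarrow> 0"
  shows "AE x in M. (\<lambda>n. spec_norm n (\<lambda>i j. \<sigma> n i j * W n i j x)) \<longlonglongrightarrow> 2"
proof -
  interpret prob_space M by (rule prob)
  obtain C0 where C0: "\<And>l. integrable M (\<lambda>x. exp (l * \<xi> x)) \<and> (\<integral>x. exp (l * \<xi> x) \<partial>M) \<le> exp (C0 * l\<^sup>2)"
    using xi_subg unfolding subgaussian_def xi_centered by auto
  \<comment> \<open>The locale asks for \<open>0 <= C\<close>, and enlarging the constant preserves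
    the exponential bound.\<close>
  define C where "C = max C0 0"
  have subg: "subg M \<xi> C"
  proof
    fix l
    have "C0 * l\<^sup>2 \<le> C * l\<^sup>2" by (intro mult_right_mono) (auto simp: C_def)
    then have "exp (C0 * l\<^sup>2) \<le> exp (C * l\<^sup>2)" by simp
    then show "(\<integral>x. exp (l * \<xi> x) \<partial>M) \<le> exp (C * l\<^sup>2)" using C0[of l] by linarith
  qed (use xi_rv xi_centered xi_var C0 in \<open>auto simp: C_def\<close>)
  define s where "s n = Max {\<sigma> n i j | i j. i < n \<and> j < n}" for n
  \<comment> \<open>For \<open>n = 0\<close> the maximum ranges over the empty set, so the locale is
    built for positive \<open>n\<close>.\<close>
  have rm: "rmatrix M \<xi> C n (W n) (\<sigma> n) (s n)" if n: "0 < n" for n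
  proof (rule rmatrix.intro[OF subg], unfold_locales)
    fix i j assume ij: "i < n" "j < n"
    have "{\<sigma> n i j | i j. i < n \<and> j < n} = (\<lambda>(i, j). \<sigma> n i j) ` ({..<n} \<times> {..<n})" by auto
    then have "finite {\<sigma> n i j | i j. i < n \<and> j < n}" by simp
    then show "0 \<le> \<sigma> n i j \<and> \<sigma> n i j \<le> s n"
      using \<sigma>_nonneg[OF ij] ij unfolding s_def by (auto intro!: Max_ge)
  next
    show "indep_vars (\<lambda>_. borel) (\<lambda>(i, j). W n i j) (edges n)" using W_indep[of n] by (simp add: edges_def)
  qed (use n W_rv W_sym W_distr \<sigma>_sym \<sigma>_rows in \<open>auto simp: sym_mat_def\<close>)
  have "rmatrix_seq M \<xi> C W \<sigma> s"
  proof (intro rmatrix_seq.intro[OF subg] rmatrix_seq_axioms.intro)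
    show "(\<lambda>n. s n * sqrt (ln (real n))) \<longlonglongrightarrow> 0" unfolding s_def by (rule \<sigma>_max)
  qed (rule rm)
  then show ?thesis using rmatrix_seq.spec_norm_tendsto_2 unfolding hadamard_def[abs_def] by blast
qed

end
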